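(* Let $\mathcal{E}$ be a separable complex Hilbert space, and let $A \in \mathcal{B}(H^2_{\mathcal{E}}(\mathbb{T}))$. Then the following are equivalent: (1) $A$ is a Toeplitz + Hankel operator, i.e. there exist $\Phi, \Psi \in L^\infty_{\mathcal{B}(\mathcal{E})}(\mathbb{T})$ such that $A = T_\Phi + H_\Psi$. (2) $A T_z - T_z^* A$ is a Toeplitz operator. (3) $T_z^* A T_z - A$ is a Hankel operator. (4) $A T_z + T_z^{*2} A T_z = T_z^* A + T_z^* A T_z^2$.
   Context: $\mathbb{T}$ is the unit circle in $\mathbb{C}$; all Hilbert spaces are separable and over $\mathbb{C}$; $\mathcal{B}(\mathcal{H})$ denotes the bounded linear operators on a Hilbert space $\mathcal{H}$. $L^2_{\mathcal{E}}(\mathbb{T})$ is the Lebesgue-Bochner space of measurable $f:\mathbb{T}\to\mathcal{E}$ with $\|f\|^2 = \frac{1}{2\pi}\int_0^{2\pi}\|f(e^{i\theta})\|^2\,d\theta<\infty$. The Hardy space $H^2_{\mathcal{E}}(\mathbb{T})$ is the closed subspace of those $f \in L^2_{\mathcal{E}}(\mathbb{T})$ whose Fourier coefficients of negative index all vanish, and $P_{H^2_{\mathcal{E}}(\mathbb{T})}$ is the orthogonal projection of $L^2_{\mathcal{E}}(\mathbb{T})$ onto it. $L^\infty_{\mathcal{B}(\mathcal{E})}(\mathbb{T})$ is the space of measurable $\Phi:\mathbb{T}\to\mathcal{B}(\mathcal{E})$ with $\|\Phi\|_\infty = \operatorname{ess\,sup}_{\theta}\|\Phi(e^{i\theta})\|<\infty$.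 For such $\Phi$, $M_\Phi f = \Phi f$ on $L^2_{\mathcal{E}}(\mathbb{T})$. The Toeplitz operator with symbol $\Phi\in L^\infty_{\mathcal{B}(\mathcal{E})}(\mathbb{T})$ is $T_\Phi = P_{H^2_{\mathcal{E}}(\mathbb{T})} M_\Phi|_{H^2_{\mathcal{E}}(\mathbb{T})}$, and the Hankel operator with symbol $\Phi\in L^\infty_{\mathcal{B}(\mathcal{E})}(\mathbb{T})$ is $H_\Phi = P_{H^2_{\mathcal{E}}(\mathbb{T})} M_\Phi J|_{H^2_{\mathcal{E}}(\mathbb{T})}$, where $(Jf)(z) = f(\bar z)$ for $f\in L^2_{\mathcal{E}}(\mathbb{T})$, $z\in\mathbb{T}$. Both are bounded operators on $H^2_{\mathcal{E}}(\mathbb{T})$. An operator on $H^2_{\mathcal{E}}(\mathbb{T})$ is called a Toeplitz (respectively Hankel) operator if it equals $T_\Phi$ (respectively $H_\Phi$) for some $\Phi\in L^\infty_{\mathcal{B}(\mathcal{E})}(\mathbb{T})$. $T_z$ denotes the Toeplitz operator with symbol $z I_{\mathcal{E}}$ (the shift). *)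

theory Defs
  imports "HOL-Analysis.Analysis"
begin

section \<open>Complex Hilbert spaces\<close>

text \<open>
  A complex inner product space is built on top of the library class \<^class>\<open>real_inner\<close>, whose
  real inner product is required to be the real part of the complex one. In particular
  the norm is the usual \<open>\<parallel>x\<parallel>\<^sup>2 = \<langle>x, x\<rangle>\<close>, and positive definiteness is inherited.
  The inner product is linear in its first argument.
\<close>

class complex_inner = real_inner +
  fixes scaleC :: "complex \<Rightarrow> 'a \<Rightarrow> 'a" (infixr "*\<^sub>C" 75)
    and cinner :: "'a \<Rightarrow> 'a \<Rightarrow> complex"
  assumes scaleC_add_right: "a *\<^sub>C (x + y) = a *\<^sub>C x + a *\<^sub>C y"
    and scaleC_add_left: "(a + b) *\<^sub>C x = a *\<^sub>C x + b *\<^sub>C x"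
    and scaleC_scaleC: "a *\<^sub>C (b *\<^sub>C x) = (a * b) *\<^sub>C x"
    and scaleR_scaleC: "r *\<^sub>R x = complex_of_real r *\<^sub>C x"
    and cinner_commute: "cinner x y = cnj (cinner y x)"
    and cinner_add_left: "cinner (x + y) z = cinner x z + cinner y z"
    and cinner_scaleC_left: "cinner (a *\<^sub>C x) y = a * cinner x y"
    and Re_cinner: "Re (cinner x y) = inner x y"

text \<open>
  Separability is expressed by \<^class>\<open>polish_space\<close> (complete and second countable; for metric
  spaces second countability is separability).
\<close>

class separable_complex_hilbert = complex_inner + polish_space

subclass (in separable_complex_hilbert) banach ..

instantiation complex :: separable_complex_hilbert
begin

definition scaleC_complex :: "complex \<Rightarrow> complex \<Rightarrow> complex"
  where "scaleC_complex a x = a * x"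

definition cinner_complex :: "complex \<Rightarrow> complex \<Rightarrow> complex"
  where "cinner_complex x y = x * cnj y"

instance
  by standard
    (auto simp: scaleC_complex_def cinner_complex_def algebra_simps inner_complex_def
      scaleR_conv_of_real)

end

lemma cinner_self: "cinner x x = complex_of_real ((norm x)\<^sup>2)"
  using cinner_commute[of x x] Re_cinner[of x x]
  by (simp add: complex_eq_iff power2_norm_eq_inner)

lemma norm_scaleC: "norm (a *\<^sub>C (x::'a::complex_inner)) = cmod a * norm x"
proof -
  have "cinner (a *\<^sub>C x) (a *\<^sub>C x) = a * (cnj a * cnj (cinner x x))"
    by (metis cinner_commute cinner_scaleC_left complex_cnj_mult)
  also have "\<dots> = complex_of_real ((cmod a)\<^sup>2 * (norm x)\<^sup>2)"
    by (simp add: cinner_self complex_norm_square del: of_real_power)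
  finally have "(norm (a *\<^sub>C x))\<^sup>2 = (cmod a * norm x)\<^sup>2"
    by (metis cinner_self of_real_eq_iff power_mult_distrib)
  then show ?thesis by simp
qed

lemma norm_cinner_le: "cmod (cinner x y) \<le> norm (x::'a::complex_inner) * norm y"
proof (cases "cinner x y = 0")
  case False
  define u where "u = cnj (cinner x y) / cmod (cinner x y)"
  have u: "cmod u = 1" using False by (simp add: u_def norm_divide)
  have "cinner x y * cnj (cinner x y) = complex_of_real (cmod (cinner x y)) * cmod (cinner x y)"
    by (simp add: complex_norm_square[symmetric] power2_eq_square flip: of_real_mult)
  then have "u * cinner x y = cmod (cinner x y)"
    using False by (simp add: u_def field_simps)
  then have "cinner (u *\<^sub>C x) y = cmod (cinner x y)"
    by (simp add: cinner_scaleC_left)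
  then have "cmod (cinner x y) = inner (u *\<^sub>C x) y"
    using Re_cinner[of "u *\<^sub>C x" y] by simp
  also have "\<dots> \<le> norm (u *\<^sub>C x) * norm y" by (rule norm_cauchy_schwarz)
  finally show ?thesis by (simp add: norm_scaleC u)
qed simp

lemma bounded_bilinear_cinner:
  "bounded_bilinear (cinner :: 'a::complex_inner \<Rightarrow> 'a \<Rightarrow> complex)"
proof
  fix a a' b b' :: 'a and r :: real
  show "cinner (a + a') b = cinner a b + cinner a' b" by (rule cinner_add_left)
  show "cinner a (b + b') = cinner a b + cinner a b'"
    by (metis cinner_add_left cinner_commute complex_cnj_add)
  show "cinner (r *\<^sub>R a) b = r *\<^sub>R cinner a b"
    by (simp add: scaleR_scaleC cinner_scaleC_left scaleC_complex_def)
  show "cinner a (r *\<^sub>R b) = r *\<^sub>R cinner a b"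
    by (subst (1 2) cinner_commute)
      (simp add: scaleR_scaleC cinner_scaleC_left scaleC_complex_def)
  show "\<exists>K. \<forall>a b::'a. cmod (cinner a b) \<le> norm a * norm b * K"
    by (rule exI[of _ 1]) (simp add: norm_cinner_le)
qed

lemma bounded_bilinear_scaleC:
  "bounded_bilinear (scaleC :: complex \<Rightarrow> 'a \<Rightarrow> 'a::complex_inner)"
proof
  fix a a' :: complex and b b' :: 'a and r :: real
  show "(a + a') *\<^sub>C b = a *\<^sub>C b + a' *\<^sub>C b" by (rule scaleC_add_left)
  show "a *\<^sub>C (b + b') = a *\<^sub>C b + a *\<^sub>C b'" by (rule scaleC_add_right)
  show "(r *\<^sub>R a) *\<^sub>C b = r *\<^sub>R a *\<^sub>C b"
    by (simp add: scaleR_scaleC scaleC_scaleC scaleC_complex_def)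
  show "a *\<^sub>C (r *\<^sub>R b) = r *\<^sub>R a *\<^sub>C b"
    by (simp add: scaleR_scaleC scaleC_scaleC mult.commute)
  show "\<exists>K. \<forall>a (b::'a). norm (a *\<^sub>C b) \<le> norm a * norm b * K"
    by (rule exI[of _ 1]) (simp add: norm_scaleC)
qed

lemma borel_measurable_bilinear:
  fixes f :: "'m \<Rightarrow> 'a::{real_normed_vector, second_countable_topology}"
    and g :: "'m \<Rightarrow> 'b::{real_normed_vector, second_countable_topology}"
  assumes H: "bounded_bilinear H" and f: "f \<in> borel_measurable M" and g: "g \<in> borel_measurable M"
  shows "(\<lambda>x. H (f x) (g x)) \<in> borel_measurable M"
  using f g
  by (rule borel_measurable_continuous_Pair)
    (rule bounded_bilinear.continuous_on[OF H continuous_on_fst[OF continuous_on_id]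
        continuous_on_snd[OF continuous_on_id]])

definition bounded_clinear :: "('a::complex_inner \<Rightarrow> 'b::complex_inner) \<Rightarrow> bool"
  where "bounded_clinear A \<longleftrightarrow> bounded_linear A \<and> (\<forall>c x. A (c *\<^sub>C x) = c *\<^sub>C A x)"

text \<open>
  The Hilbert space adjoint. It is unique whenever it exists, and it exists for bounded operators on
  a complete space.
\<close>

definition cadjoint :: "('a::complex_inner \<Rightarrow> 'b::complex_inner) \<Rightarrow> 'b \<Rightarrow> 'a"
  where "cadjoint A = (THE B. \<forall>x y. cinner (A x) y = cinner x (B y))"


section \<open>Normalised arc length on the unit circle\<close>

definition circle :: "complex measure"
  where "circle = distr (uniform_measure lborel {0..2 * pi}) (restrict_space borel (sphere 0 1)) cis"

lemma space_circle [simp]: "space circle = sphere 0 1"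
  by (simp add: circle_def space_restrict_space)

lemma sets_circle: "sets circle = sets (restrict_space borel (sphere 0 1))"
  by (simp add: circle_def)

lemma measurable_cis_borel [measurable]: "cis \<in> borel_measurable borel"
  by (intro borel_measurable_continuous_onI continuous_intros)

lemma measurable_cis_sphere [measurable]:
  "cis \<in> uniform_measure lborel A \<rightarrow>\<^sub>M restrict_space borel (sphere 0 1)"
  by (rule measurable_restrict_space2) auto

lemma borel_measurable_circle_continuous:
  "continuous_on (sphere 0 1) f \<Longrightarrow> f \<in> borel_measurable circle"
  by (simp add: measurable_cong_sets[OF sets_circle refl] borel_measurable_continuous_on_restrict)

lemma emeasure_circle_space: "emeasure circle (sphere 0 1) = 1"
proof -
  have "cis -` sphere 0 1 = UNIV" by auto
  then show ?thesis
    unfolding circle_def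
    by (subst emeasure_distr) (auto simp: sets_restrict_space intro!: emeasure_uniform_measure_1)
qed

lemma finite_measure_circle: "finite_measure circle"
  by (rule finite_measureI) (simp add: emeasure_circle_space)

lemma measurable_cnj_circle [measurable]: "cnj \<in> circle \<rightarrow>\<^sub>M circle"
proof -
  have "cnj \<in> circle \<rightarrow>\<^sub>M restrict_space borel (sphere 0 1)"
    by (rule measurable_restrict_space2)
      (auto intro!: borel_measurable_circle_continuous continuous_intros)
  then show ?thesis by (simp add: measurable_cong_sets[OF refl sets_circle])
qed

lemma distr_circle_cnj: "distr circle circle cnj = circle"
proof (rule measure_eqI)
  fix A assume "A \<in> sets (distr circle circle cnj)"
  then have A: "A \<in> sets circle" by simp
  define B where "B = cis -` A"
  have A': "A \<in> sets (restrict_space borel (sphere 0 1))" using A by (simp add: sets_circle)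
  have B [measurable]: "B \<in> sets borel"
    using measurable_sets[OF measurable_cis_sphere[of UNIV] A'] by (simp add: B_def)
  have emeasure_eq: "emeasure circle C =
      (\<integral>\<^sup>+t. indicator (cis -` C) t * indicator {0..2*pi} t \<partial>lborel) / emeasure lborel {0..2*pi}"
    if C: "C \<in> sets circle" for C
  proof -
    have C': "C \<in> sets (restrict_space borel (sphere 0 1))" using C by (simp add: sets_circle)
    have [measurable]: "cis -` C \<in> sets borel"
      using measurable_sets[OF measurable_cis_sphere[of UNIV] C'] by simp
    have "emeasure circle C = emeasure (uniform_measure lborel {0..2*pi}) (cis -` C)"
      unfolding circle_def using C' by (subst emeasure_distr) auto
    also have "\<dots> = (\<integral>\<^sup>+t. indicator (cis -` C) t \<partial>uniform_measure lborel {0..2*pi})"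
      by simp
    also have "\<dots> = (\<integral>\<^sup>+t. indicator (cis -` C) t * indicator {0..2*pi} t \<partial>lborel)
        / emeasure lborel {0..2*pi}"
      by (rule nn_integral_uniform_measure) auto
    finally show ?thesis .
  qed
  have cnjA: "cnj -` A \<inter> space circle \<in> sets circle"
    using A by (rule measurable_sets[OF measurable_cnj_circle])
  have cis_flip: "cis (2*pi - t) = cnj (cis t)" for t
    by (simp add: complex_eq_iff cos_diff sin_diff)
  have flip: "indicator (cis -` (cnj -` A \<inter> space circle)) t * indicator {0..2*pi} t
      = (indicator B (2*pi + (-1) * t) * indicator {0..2*pi} (2*pi + (-1) * t) :: ennreal)" for t
    by (auto simp: B_def indicator_def cis_flip)
  have "(\<integral>\<^sup>+t. indicator (cis -` (cnj -` A \<inter> space circle)) t * indicator {0..2*pi} t \<partial>lborel)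
      = (\<integral>\<^sup>+t. indicator B t * indicator {0..2*pi} t \<partial>lborel)"
    by (subst (2) nn_integral_real_affine[where c = "-1" and t = "2*pi"])
      (simp_all only: flip, auto)
  then show "emeasure (distr circle circle cnj) A = emeasure circle A"
    using A cnjA by (simp add: emeasure_distr emeasure_eq B_def)
qed simp

lemma AE_circle_cnj: "AE z in circle. P z \<Longrightarrow> AE z in circle. P (cnj z)"
  by (rule AE_distrD[OF measurable_cnj_circle, unfolded distr_circle_cnj])


section \<open>The Lebesgue-Bochner space\<close>

text \<open>
  Elements of \<open>L\<^sup>2\<close> are classes of functions on the type \<^typ>\<open>complex\<close>; as \<^const>\<open>circle\<close> has
  the unit circle as its space, values off the circle do not matter.
\<close>

definition square_integrable :: "(complex \<Rightarrow> 'e::separable_complex_hilbert) \<Rightarrow> bool"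
  where "square_integrable f \<longleftrightarrow>
    f \<in> borel_measurable circle \<and> integrable circle (\<lambda>z. (norm (f z))\<^sup>2)"

definition L2_rel :: "(complex \<Rightarrow> 'e::separable_complex_hilbert) \<Rightarrow> (complex \<Rightarrow> 'e) \<Rightarrow> bool"
  where "L2_rel f g \<longleftrightarrow> square_integrable f \<and> square_integrable g \<and> (AE z in circle. f z = g z)"

lemma square_integrable_0 [simp]: "square_integrable (\<lambda>_. 0)"
  by (simp add: square_integrable_def)

lemma square_integrable_bounded_pointwise:
  assumes f: "square_integrable f" and g: "g \<in> borel_measurable circle"
    and le: "AE z in circle. norm (g z) \<le> M * norm (f z)"
  shows "square_integrable g"
  unfolding square_integrable_def
proof
  note g [measurable]
  have "integrable circle (\<lambda>z. M\<^sup>2 * (norm (f z))\<^sup>2)"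
    using f by (simp add: square_integrable_def)
  moreover have "AE z in circle. norm ((norm (g z))\<^sup>2) \<le> norm (M\<^sup>2 * (norm (f z))\<^sup>2)"
    using le by eventually_elim (simp add: power_mono flip: power_mult_distrib)
  moreover have "(\<lambda>z. (norm (g z))\<^sup>2) \<in> borel_measurable circle"
    by measurable
  ultimately show "integrable circle (\<lambda>z. (norm (g z))\<^sup>2)"
    using Bochner_Integration.integrable_bound by blast
qed (rule g)

lemma square_integrable_add:
  assumes f: "square_integrable f" and g: "square_integrable g"
  shows "square_integrable (\<lambda>z. f z + g z)"
  unfolding square_integrable_def
proof
  have [measurable]: "f \<in> borel_measurable circle" "g \<in> borel_measurable circle"
    using f g by (auto simp: square_integrable_def)
  show "(\<lambda>z. f z + g z) \<in> borel_measurable circle" by measurable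
  have "(norm (f z + g z))\<^sup>2 \<le> 2 * (norm (f z))\<^sup>2 + 2 * (norm (g z))\<^sup>2" for z
  proof -
    have "(norm (f z + g z))\<^sup>2 \<le> (norm (f z) + norm (g z))\<^sup>2"
      by (intro power_mono norm_triangle_ineq) simp
    also have "\<dots> \<le> 2 * (norm (f z))\<^sup>2 + 2 * (norm (g z))\<^sup>2"
      using sum_squares_bound[of "norm (f z)" "norm (g z)"] by (simp add: power2_sum)
    finally show ?thesis .
  qed
  moreover have "integrable circle (\<lambda>z. 2 * (norm (f z))\<^sup>2 + 2 * (norm (g z))\<^sup>2)"
    using f g by (simp add: square_integrable_def)
  ultimately show "integrable circle (\<lambda>z. (norm (f z + g z))\<^sup>2)"
    by (auto intro: Bochner_Integration.integrable_bound)
qed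

lemma square_integrable_scaleC:
  assumes "square_integrable f"
  shows "square_integrable (\<lambda>z. a *\<^sub>C f z)"
proof (rule square_integrable_bounded_pointwise[OF assms, where M = "cmod a"])
  have "continuous_on UNIV (\<lambda>x::'a. a *\<^sub>C x)"
    by (intro linear_continuous_on bounded_bilinear.bounded_linear_right[OF bounded_bilinear_scaleC])
  then show "(\<lambda>z. a *\<^sub>C f z) \<in> borel_measurable circle"
    using assms by (auto simp: square_integrable_def intro: borel_measurable_continuous_on)
qed (simp add: norm_scaleC)

lemma square_integrable_scaleR: "square_integrable f \<Longrightarrow> square_integrable (\<lambda>z. r *\<^sub>R f z)"
  by (simp add: scaleR_scaleC square_integrable_scaleC)

lemma square_integrable_uminus: "square_integrable f \<Longrightarrow> square_integrable (\<lambda>z. - f z)"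
  using square_integrable_scaleR[of f "-1"] by simp

lemma square_integrable_diff:
  "square_integrable f \<Longrightarrow> square_integrable g \<Longrightarrow> square_integrable (\<lambda>z. f z - g z)"
  using square_integrable_add[of f "\<lambda>z. - g z"] by (simp add: square_integrable_uminus)

lemma square_integrable_cnj:
  assumes "square_integrable f"
  shows "square_integrable (\<lambda>z. f (cnj z))"
proof -
  have [measurable]: "f \<in> borel_measurable circle"
    and int: "integrable circle (\<lambda>z. (norm (f z))\<^sup>2)"
    using assms by (auto simp: square_integrable_def)
  have "integrable (distr circle circle cnj) (\<lambda>z. (norm (f z))\<^sup>2)"
    using int by (simp add: distr_circle_cnj)
  then have "integrable circle (\<lambda>z. (norm (f (cnj z)))\<^sup>2)"
    by (subst (asm) integrable_distr_eq) auto
  then show ?thesis by (simp add: square_integrable_def)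
qed

lemma integrable_cinner:
  assumes f: "square_integrable f" and g: "square_integrable g"
  shows "integrable circle (\<lambda>z. cinner (f z) (g z))"
proof (rule Bochner_Integration.integrable_bound)
  have [measurable]: "f \<in> borel_measurable circle" "g \<in> borel_measurable circle"
    using f g by (auto simp: square_integrable_def)
  show "integrable circle (\<lambda>z. (norm (f z))\<^sup>2 + (norm (g z))\<^sup>2)"
    using f g by (simp add: square_integrable_def)
  show "(\<lambda>z. cinner (f z) (g z)) \<in> borel_measurable circle"
    by (intro borel_measurable_bilinear[OF bounded_bilinear_cinner]) measurable
  have "cmod (cinner (f z) (g z)) \<le> norm ((norm (f z))\<^sup>2 + (norm (g z))\<^sup>2)" for z
  proof -
    have "cmod (cinner (f z) (g z)) \<le> norm (f z) * norm (g z)" by (rule norm_cinner_le)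
    also have "\<dots> \<le> (norm (f z))\<^sup>2 + (norm (g z))\<^sup>2"
      using sum_squares_bound[of "norm (f z)" "norm (g z)"]
        mult_nonneg_nonneg[OF norm_ge_zero norm_ge_zero, of "f z" "g z"] by linarith
    finally show ?thesis by simp
  qed
  then show "AE z in circle. cmod (cinner (f z) (g z)) \<le> norm ((norm (f z))\<^sup>2 + (norm (g z))\<^sup>2)"
    by simp
qed

lemma integrable_inner:
  assumes "square_integrable f" "square_integrable g"
  shows "integrable circle (\<lambda>z. inner (f z) (g z))"
  using integrable_Re[OF integrable_cinner[OF assms]] by (simp add: Re_cinner)

quotient_type (overloaded) 'e L2 = "complex \<Rightarrow> 'e::separable_complex_hilbert" / partial: L2_rel
proof (rule part_equivpI)
  show "\<exists>f. L2_rel f f" by (rule exI[of _ "\<lambda>_. 0"]) (simp add: L2_rel_def)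
  show "symp L2_rel" by (auto simp: symp_def L2_rel_def)
  show "transp L2_rel" by (auto simp: transp_def L2_rel_def)
qed

lemma L2_rel_self: "L2_rel f f \<longleftrightarrow> square_integrable f"
  by (simp add: L2_rel_def)

instantiation L2 :: (separable_complex_hilbert) complex_inner
begin

lift_definition zero_L2 :: "'a L2" is "\<lambda>_. 0"
  by (simp add: L2_rel_def)

lift_definition plus_L2 :: "'a L2 \<Rightarrow> 'a L2 \<Rightarrow> 'a L2" is "\<lambda>f g z. f z + g z"
  by (auto simp: L2_rel_def square_integrable_add)

lift_definition minus_L2 :: "'a L2 \<Rightarrow> 'a L2 \<Rightarrow> 'a L2" is "\<lambda>f g z. f z - g z"
  by (auto simp: L2_rel_def square_integrable_diff)

lift_definition uminus_L2 :: "'a L2 \<Rightarrow> 'a L2" is "\<lambda>f z. - f z"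
  by (auto simp: L2_rel_def square_integrable_uminus)

lift_definition scaleR_L2 :: "real \<Rightarrow> 'a L2 \<Rightarrow> 'a L2" is "\<lambda>r f z. r *\<^sub>R f z"
  by (auto simp: L2_rel_def square_integrable_scaleR)

lift_definition scaleC_L2 :: "complex \<Rightarrow> 'a L2 \<Rightarrow> 'a L2" is "\<lambda>a f z. a *\<^sub>C f z"
  by (auto simp: L2_rel_def square_integrable_scaleC)

lift_definition cinner_L2 :: "'a L2 \<Rightarrow> 'a L2 \<Rightarrow> complex"
  is "\<lambda>f g. LINT z|circle. cinner (f z) (g z)"
proof -
  fix f f' g g' :: "complex \<Rightarrow> 'a"
  assume "L2_rel f f'" "L2_rel g g'"
  then have "AE z in circle. cinner (f z) (g z) = cinner (f' z) (g' z)"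
    and "integrable circle (\<lambda>z. cinner (f z) (g z))" "integrable circle (\<lambda>z. cinner (f' z) (g' z))"
    by (auto simp: L2_rel_def integrable_cinner)
  then show "(LINT z|circle. cinner (f z) (g z)) = (LINT z|circle. cinner (f' z) (g' z))"
    by (intro integral_cong_AE borel_measurable_integrable)
qed

definition inner_L2 :: "'a L2 \<Rightarrow> 'a L2 \<Rightarrow> real"
  where "inner_L2 f g = Re (cinner f g)"

definition norm_L2 :: "'a L2 \<Rightarrow> real"
  where "norm_L2 f = sqrt (inner f f)"

definition dist_L2 :: "'a L2 \<Rightarrow> 'a L2 \<Rightarrow> real"
  where "dist_L2 f g = norm (f - g)"

definition sgn_L2 :: "'a L2 \<Rightarrow> 'a L2"
  where "sgn_L2 f = scaleR (inverse (norm f)) f"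

definition uniformity_L2 :: "('a L2 \<times> 'a L2) filter"
  where "uniformity_L2 = (INF e\<in>{0 <..}. principal {(f, g). dist f g < e})"

definition open_L2 :: "'a L2 set \<Rightarrow> bool"
  where "open_L2 U = (\<forall>f\<in>U. \<forall>\<^sub>F (f', g) in uniformity. f' = f \<longrightarrow> g \<in> U)"

instance
proof
  fix f g h :: "'a L2" and r s :: real and a b :: complex
  show "f + g + h = f + (g + h)"
    by transfer (auto simp: L2_rel_def square_integrable_add add.assoc)
  show "f + g = g + f"
    by transfer (auto simp: L2_rel_def square_integrable_add add.commute)
  show "0 + f = f" by transfer (auto simp: L2_rel_def)
  show "- f + f = 0" by transfer (auto simp: L2_rel_def)
  show "f - g = f + - g" by transfer (auto simp: L2_rel_def square_integrable_diff)
  show "r *\<^sub>R (f + g) = r *\<^sub>R f + r *\<^sub>R g"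
    by transfer (auto simp: L2_rel_def square_integrable_add square_integrable_scaleR
        scaleR_add_right)
  show "(r + s) *\<^sub>R f = r *\<^sub>R f + s *\<^sub>R f"
    by transfer (auto simp: L2_rel_def square_integrable_add square_integrable_scaleR
        scaleR_add_left)
  show "r *\<^sub>R s *\<^sub>R f = (r * s) *\<^sub>R f"
    by transfer (auto simp: L2_rel_def square_integrable_scaleR)
  show "1 *\<^sub>R f = f" by transfer (auto simp: L2_rel_def)
  show "dist f g = norm (f - g)" by (rule dist_L2_def)
  show "sgn f = inverse (norm f) *\<^sub>R f" by (rule sgn_L2_def)
  show "uniformity = (INF e\<in>{0 <..}. principal {(f, g :: 'a L2). dist f g < e})"
    by (rule uniformity_L2_def)
  show "open U = (\<forall>f\<in>U. \<forall>\<^sub>F (f', g) in uniformity. f' = f \<longrightarrow> g \<in> U)" for U :: "'a L2 set"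
    by (rule open_L2_def)
  show "a *\<^sub>C (f + g) = a *\<^sub>C f + a *\<^sub>C g"
    by transfer (auto simp: L2_rel_def square_integrable_add square_integrable_scaleC
        scaleC_add_right)
  show "(a + b) *\<^sub>C f = a *\<^sub>C f + b *\<^sub>C f"
    by transfer (auto simp: L2_rel_def square_integrable_add square_integrable_scaleC
        scaleC_add_left)
  show "a *\<^sub>C b *\<^sub>C f = (a * b) *\<^sub>C f"
    by transfer (auto simp: L2_rel_def square_integrable_scaleC scaleC_scaleC)
  show "r *\<^sub>R f = complex_of_real r *\<^sub>C f"
    by transfer (auto simp: L2_rel_def square_integrable_scaleC scaleR_scaleC)
  show cinner_commute_L2: "cinner f g = cnj (cinner g f)" for f g :: "'a L2"
    by transfer (simp add: Bochner_Integration.integral_cnj[symmetric] flip: cinner_commute)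
  show cinner_add: "cinner (f + g) h = cinner f h + cinner g h"
    by transfer (simp add: L2_rel_self cinner_add_left integrable_cinner)
  show "cinner (a *\<^sub>C f) g = a * cinner f g"
    by transfer (simp add: cinner_scaleC_left)
  show "Re (cinner f g) = inner f g" by (simp add: inner_L2_def)
  show "inner f g = inner g f"
    unfolding inner_L2_def by (subst cinner_commute_L2) simp
  show "inner (f + g) h = inner f h + inner g h"
    by (simp add: inner_L2_def cinner_add)
  show "inner (r *\<^sub>R f) g = r * inner f g"
    unfolding inner_L2_def by transfer (simp add: scaleR_scaleC cinner_scaleC_left)
  have inner_eq: "inner (f :: 'a L2) f = (LINT z|circle. (norm (rep_L2 f z))\<^sup>2)" for f
    unfolding inner_L2_def cinner_L2.rep_eq by (simp add: cinner_self del: of_real_power)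
  show "0 \<le> inner f f" by (simp add: inner_eq)
  have rep: "square_integrable (rep_L2 f)"
    by (metis L2_rel_self Quotient_L2 Quotient_rep_reflp)
  have "inner f f = 0 \<longleftrightarrow> (AE z in circle. (norm (rep_L2 f z))\<^sup>2 = 0)"
    unfolding inner_eq using rep
    by (intro integral_nonneg_eq_0_iff_AE) (auto simp: square_integrable_def)
  also have "\<dots> \<longleftrightarrow> L2_rel (rep_L2 f) (\<lambda>_. 0)"
    using rep by (simp add: L2_rel_def)
  also have "\<dots> \<longleftrightarrow> f = 0"
    using Quotient_rel[OF Quotient_L2, of "rep_L2 f" "\<lambda>_. 0"] rep
    by (simp add: L2_rel_self Quotient_abs_rep[OF Quotient_L2] zero_L2_def)
  finally show "inner f f = 0 \<longleftrightarrow> f = 0" .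
  show "norm f = sqrt (inner f f)" by (rule norm_L2_def)
qed

end

text \<open>The operator \<open>J\<close>.\<close>

lift_definition flip :: "'e::separable_complex_hilbert L2 \<Rightarrow> 'e L2" is "\<lambda>f z. f (cnj z)"
  by (simp add: L2_rel_def square_integrable_cnj) (rule AE_circle_cnj, simp)


section \<open>The Hardy space\<close>

lemma integrable_fourier:
  assumes "square_integrable f"
  shows "integrable circle (\<lambda>z. z powi n *\<^sub>C f z)"
proof (rule Bochner_Integration.integrable_bound)
  interpret finite_measure circle by (rule finite_measure_circle)
  have [measurable]: "f \<in> borel_measurable circle"
    using assms by (simp add: square_integrable_def)
  show "integrable circle (\<lambda>z. 1 + (norm (f z))\<^sup>2)"
    using assms by (simp add: square_integrable_def)
  have [measurable]: "(\<lambda>z::complex. z powi n) \<in> borel_measurable circle"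
    by (rule borel_measurable_circle_continuous) (auto intro!: continuous_intros)
  show "(\<lambda>z. z powi n *\<^sub>C f z) \<in> borel_measurable circle"
    by (intro borel_measurable_bilinear[OF bounded_bilinear_scaleC]) measurable
  have "x \<le> 1 + x\<^sup>2" for x :: real
    using sum_squares_bound[of x 1] zero_le_power2[of x] by (simp, linarith)
  then show "AE z in circle. norm (z powi n *\<^sub>C f z) \<le> norm (1 + (norm (f z))\<^sup>2)"
    by (intro AE_I2) (simp add: norm_scaleC norm_power_int)
qed

lift_definition fourier :: "'e::separable_complex_hilbert L2 \<Rightarrow> int \<Rightarrow> 'e"
  is "\<lambda>f n. LINT z|circle. z powi (- n) *\<^sub>C f z"
proof
  fix f g :: "complex \<Rightarrow> 'e" and n
  assume "L2_rel f g"
  then have "AE z in circle. z powi (- n) *\<^sub>C f z = z powi (- n) *\<^sub>C g z"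
    and "integrable circle (\<lambda>z. z powi (- n) *\<^sub>C f z)" "integrable circle (\<lambda>z. z powi (- n) *\<^sub>C g z)"
    unfolding L2_rel_def by (auto intro!: integrable_fourier)
  then show "(LINT z|circle. z powi (- n) *\<^sub>C f z) = (LINT z|circle. z powi (- n) *\<^sub>C g z)"
    by (intro integral_cong_AE borel_measurable_integrable)
qed

lemma fourier_add: "fourier (f + g) n = fourier f n + fourier g n"
  by transfer (simp add: L2_rel_self scaleC_add_right integrable_fourier)

lemma fourier_scaleC: "fourier (a *\<^sub>C f) n = a *\<^sub>C fourier f n"
proof transfer
  fix a n and f :: "complex \<Rightarrow> 'a"
  assume "L2_rel f f"
  then have int: "integrable circle (\<lambda>z. z powi (- n) *\<^sub>C f z)"
    unfolding L2_rel_self by (rule integrable_fourier)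
  have "(LINT z|circle. z powi (- n) *\<^sub>C a *\<^sub>C f z) = (LINT z|circle. a *\<^sub>C z powi (- n) *\<^sub>C f z)"
    by (simp only: scaleC_scaleC mult.commute)
  also have "\<dots> = a *\<^sub>C (LINT z|circle. z powi (- n) *\<^sub>C f z)"
    by (rule integral_bounded_linear[OF _ int])
      (rule bounded_bilinear.bounded_linear_right[OF bounded_bilinear_scaleC])
  finally show "(LINT z|circle. z powi (- n) *\<^sub>C a *\<^sub>C f z) = a *\<^sub>C (LINT z|circle. z powi (- n) *\<^sub>C f z)" .
qed

lemma fourier_scaleR: "fourier (r *\<^sub>R f) n = r *\<^sub>R fourier f n"
  by (simp add: scaleR_scaleC fourier_scaleC)

lemma fourier_uminus: "fourier (- f) n = - fourier f n"
  using fourier_scaleR[of "-1" f n] by simp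

lemma fourier_diff: "fourier (f - g) n = fourier f n - fourier g n"
  using fourier_add[of f "- g" n] by (simp add: fourier_uminus)

lemma fourier_0: "fourier 0 n = 0"
  using fourier_scaleR[of 0 0 n] by simp

typedef (overloaded) 'e hardy =
  "{f :: 'e::separable_complex_hilbert L2. \<forall>n<0. fourier f n = 0}"
  by (rule exI[of _ 0]) (simp add: fourier_0)

setup_lifting type_definition_hardy

instantiation hardy :: (separable_complex_hilbert) complex_inner
begin

lift_definition zero_hardy :: "'a hardy" is 0
  by (simp add: fourier_0)

lift_definition plus_hardy :: "'a hardy \<Rightarrow> 'a hardy \<Rightarrow> 'a hardy" is "(+)"
  by (simp add: fourier_add)

lift_definition minus_hardy :: "'a hardy \<Rightarrow> 'a hardy \<Rightarrow> 'a hardy" is "(-)"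
  by (simp add: fourier_diff)

lift_definition uminus_hardy :: "'a hardy \<Rightarrow> 'a hardy" is uminus
  by (simp add: fourier_uminus)

lift_definition scaleR_hardy :: "real \<Rightarrow> 'a hardy \<Rightarrow> 'a hardy" is scaleR
  by (simp add: fourier_scaleR)

lift_definition scaleC_hardy :: "complex \<Rightarrow> 'a hardy \<Rightarrow> 'a hardy" is scaleC
  by (simp add: fourier_scaleC bounded_bilinear.zero_right[OF bounded_bilinear_scaleC])

lift_definition cinner_hardy :: "'a hardy \<Rightarrow> 'a hardy \<Rightarrow> complex" is cinner .

lift_definition inner_hardy :: "'a hardy \<Rightarrow> 'a hardy \<Rightarrow> real" is inner .

lift_definition norm_hardy :: "'a hardy \<Rightarrow> real" is norm .

lift_definition dist_hardy :: "'a hardy \<Rightarrow> 'a hardy \<Rightarrow> real" is dist .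

lift_definition sgn_hardy :: "'a hardy \<Rightarrow> 'a hardy" is sgn
  by (simp add: sgn_div_norm fourier_scaleR)

definition uniformity_hardy :: "('a hardy \<times> 'a hardy) filter"
  where "uniformity_hardy = (INF e\<in>{0 <..}. principal {(f, g). dist f g < e})"

definition open_hardy :: "'a hardy set \<Rightarrow> bool"
  where "open_hardy U = (\<forall>f\<in>U. \<forall>\<^sub>F (f', g) in uniformity. f' = f \<longrightarrow> g \<in> U)"

instance
proof
  fix f g h :: "'a hardy" and r s :: real and a b :: complex
  show "f + g + h = f + (g + h)" by transfer (rule add.assoc)
  show "f + g = g + f" by transfer (rule add.commute)
  show "0 + f = f" by transfer simp
  show "- f + f = 0" by transfer simp
  show "f - g = f + - g" by transfer simp
  show "r *\<^sub>R (f + g) = r *\<^sub>R f + r *\<^sub>R g" by transfer (rule scaleR_add_right)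
  show "(r + s) *\<^sub>R f = r *\<^sub>R f + s *\<^sub>R f" by transfer (rule scaleR_add_left)
  show "r *\<^sub>R s *\<^sub>R f = (r * s) *\<^sub>R f" by transfer simp
  show "1 *\<^sub>R f = f" by transfer simp
  show "dist f g = norm (f - g)" by transfer (rule dist_norm)
  show "sgn f = inverse (norm f) *\<^sub>R f" by transfer (rule sgn_div_norm)
  show "uniformity = (INF e\<in>{0 <..}. principal {(f, g :: 'a hardy). dist f g < e})"
    by (rule uniformity_hardy_def)
  show "open U = (\<forall>f\<in>U. \<forall>\<^sub>F (f', g) in uniformity. f' = f \<longrightarrow> g \<in> U)" for U :: "'a hardy set"
    by (rule open_hardy_def)
  show "a *\<^sub>C (f + g) = a *\<^sub>C f + a *\<^sub>C g" by transfer (rule scaleC_add_right)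
  show "(a + b) *\<^sub>C f = a *\<^sub>C f + b *\<^sub>C f" by transfer (rule scaleC_add_left)
  show "a *\<^sub>C b *\<^sub>C f = (a * b) *\<^sub>C f" by transfer (rule scaleC_scaleC)
  show "r *\<^sub>R f = complex_of_real r *\<^sub>C f" by transfer (rule scaleR_scaleC)
  show "cinner f g = cnj (cinner g f)" by transfer (rule cinner_commute)
  show "cinner (f + g) h = cinner f h + cinner g h" by transfer (rule cinner_add_left)
  show "cinner (a *\<^sub>C f) g = a * cinner f g" by transfer (rule cinner_scaleC_left)
  show "Re (cinner f g) = inner f g" by transfer (rule Re_cinner)
  show "inner f g = inner g f" by transfer (rule inner_commute)
  show "inner (f + g) h = inner f h + inner g h" by transfer (rule inner_add_left)
  show "inner (r *\<^sub>R f) g = r * inner f g" by transfer simp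
  show "0 \<le> inner f f" by transfer simp
  show "inner f f = 0 \<longleftrightarrow> f = 0" by transfer simp
  show "norm f = sqrt (inner f f)" by transfer (rule norm_eq_sqrt_inner)
qed

end

text \<open>
  The orthogonal projection onto the Hardy space: \<open>P f\<close> is the element \<open>g\<close> of the (closed) subspace
  such that \<open>f - g\<close> is orthogonal to the subspace.
\<close>

definition hardy_proj :: "'e::separable_complex_hilbert L2 \<Rightarrow> 'e hardy"
  where "hardy_proj f = (THE g. \<forall>h. cinner (f - Rep_hardy g) (Rep_hardy h) = 0)"


section \<open>Bounded operator-valued symbols\<close>

text \<open>
  Measurability of an operator-valued function is meant in the strong operator sense, as is
  usual for \<open>L\<^sup>\<infinity>\<close> with values in the bounded operators (for separable \<open>\<E>\<close> this agrees with weak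
  operator measurability). Measurability for the norm topology would be too restrictive: it
  excludes \<open>z \<mapsto> diag(1, z, z\<^sup>2, \<dots>)\<close>.
\<close>

definition bounded_symbol :: "(complex \<Rightarrow> 'e \<Rightarrow> 'e::separable_complex_hilbert) \<Rightarrow> bool"
  where "bounded_symbol \<Phi> \<longleftrightarrow>
    (\<forall>z\<in>sphere 0 1. bounded_clinear (\<Phi> z)) \<and>
    (\<forall>x. (\<lambda>z. \<Phi> z x) \<in> borel_measurable circle) \<and>
    (\<exists>M. AE z in circle. onorm (\<Phi> z) \<le> M)"

definition Linf_rel ::
    "(complex \<Rightarrow> 'e \<Rightarrow> 'e::separable_complex_hilbert) \<Rightarrow> (complex \<Rightarrow> 'e \<Rightarrow> 'e) \<Rightarrow> bool"
  where "Linf_rel \<Phi> \<Psi> \<longleftrightarrow> bounded_symbol \<Phi> \<and> bounded_symbol \<Psi> \<and> (AE z in circle. \<Phi> z = \<Psi> z)"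

lemma bounded_symbol_scaleC:
  assumes "continuous_on (sphere 0 1) f"
  shows "bounded_symbol (\<lambda>z x. f z *\<^sub>C (x::'e::separable_complex_hilbert))"
  unfolding bounded_symbol_def
proof (intro conjI ballI allI)
  fix z
  show "bounded_clinear (\<lambda>x::'e. f z *\<^sub>C x)"
    using bounded_bilinear.bounded_linear_right[OF bounded_bilinear_scaleC]
    by (auto simp: bounded_clinear_def scaleC_scaleC mult.commute)
next
  fix x :: 'e
  show "(\<lambda>z. f z *\<^sub>C x) \<in> borel_measurable circle"
    by (rule borel_measurable_circle_continuous)
      (rule bounded_bilinear.continuous_on[OF bounded_bilinear_scaleC assms continuous_on_const])
next
  have "compact (f ` sphere 0 1)"
    using assms by (intro compact_continuous_image) auto
  then obtain M where M: "\<And>z. z \<in> sphere 0 1 \<Longrightarrow> cmod (f z) \<le> M"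
    by (meson bounded_iff compact_imp_bounded imageI)
  have "onorm (\<lambda>x::'e. f z *\<^sub>C x) \<le> M" if "z \<in> sphere 0 1" for z
  proof (rule onorm_bound)
    show "0 \<le> M" using M[OF that] norm_ge_zero[of "f z"] by linarith
    show "norm (f z *\<^sub>C x) \<le> M * norm x" for x :: 'e
      using M[OF that] by (simp add: norm_scaleC mult_right_mono)
  qed
  then show "\<exists>M. AE z in circle. onorm (\<lambda>x::'e. f z *\<^sub>C x) \<le> M"
    by (intro exI AE_I2) auto
qed

quotient_type (overloaded) 'e Linf =
  "complex \<Rightarrow> 'e \<Rightarrow> 'e::separable_complex_hilbert" / partial: Linf_rel
proof (rule part_equivpI)
  show "\<exists>\<Phi> :: complex \<Rightarrow> 'e \<Rightarrow> 'e. Linf_rel \<Phi> \<Phi>"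
    using bounded_symbol_scaleC[of "\<lambda>_. 0"] by (auto simp: Linf_rel_def)
  show "symp (Linf_rel :: (complex \<Rightarrow> 'e \<Rightarrow> 'e) \<Rightarrow> _)" by (auto simp: symp_def Linf_rel_def)
  show "transp (Linf_rel :: (complex \<Rightarrow> 'e \<Rightarrow> 'e) \<Rightarrow> _)" by (auto simp: transp_def Linf_rel_def)
qed

lift_definition z_symbol :: "'e::separable_complex_hilbert Linf" is "\<lambda>z x. z *\<^sub>C x"
  by (simp add: Linf_rel_def bounded_symbol_scaleC)

lemma borel_measurable_symbol_apply:
  fixes \<Phi> :: "complex \<Rightarrow> 'e \<Rightarrow> 'e::separable_complex_hilbert"
  assumes \<Phi>: "bounded_symbol \<Phi>" and f: "f \<in> borel_measurable circle"
  shows "(\<lambda>z. \<Phi> z (f z)) \<in> borel_measurable circle"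
proof -
  from borel_measurable_implies_sequence_metric[OF f, of 0]
  obtain F where F: "\<And>i. simple_function circle (F i)"
    and lim: "\<And>z. z \<in> space circle \<Longrightarrow> (\<lambda>i. F i z) \<longlonglongrightarrow> f z"
    by metis
  show ?thesis
  proof (rule borel_measurable_LIMSEQ_metric)
    fix i
    have "F i \<in> circle \<rightarrow>\<^sub>M count_space (F i ` space circle)"
      using F[of i] by (auto simp: measurable_count_space_eq2 simple_function_def)
    moreover have "countable (F i ` space circle)"
      using F[of i] by (simp add: simple_function_def countable_finite)
    moreover have "(\<lambda>z. \<Phi> z x) \<in> borel_measurable circle" for x
      using \<Phi> by (simp add: bounded_symbol_def)
    ultimately show "(\<lambda>z. \<Phi> z (F i z)) \<in> borel_measurable circle"
      by (rule measurable_compose_countable'[where f = "\<lambda>x z. \<Phi> z x", rotated])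
  next
    fix z assume z: "z \<in> space circle"
    then have "bounded_linear (\<Phi> z)"
      using \<Phi> by (simp add: bounded_symbol_def bounded_clinear_def)
    then show "(\<lambda>i. \<Phi> z (F i z)) \<longlonglongrightarrow> \<Phi> z (f z)"
      using lim[OF z] by (rule bounded_linear.tendsto)
  qed
qed

lift_definition mult_op ::
    "'e::separable_complex_hilbert Linf \<Rightarrow> 'e L2 \<Rightarrow> 'e L2" is "\<lambda>\<Phi> f z. \<Phi> z (f z)"
proof -
  fix \<Phi> \<Psi> :: "complex \<Rightarrow> 'e \<Rightarrow> 'e" and f g :: "complex \<Rightarrow> 'e"
  assume rel: "Linf_rel \<Phi> \<Psi>" "L2_rel f g"
  have square_integrable_apply: "square_integrable (\<lambda>z. \<Phi> z (f z))"
    if \<Phi>: "bounded_symbol \<Phi>" and f: "square_integrable f" for \<Phi> :: "complex \<Rightarrow> 'e \<Rightarrow> 'e" and f :: "complex \<Rightarrow> 'e"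
  proof -
    obtain M where M: "AE z in circle. onorm (\<Phi> z) \<le> M"
      using \<Phi> by (auto simp: bounded_symbol_def)
    have "AE z in circle. bounded_linear (\<Phi> z)"
      using \<Phi> by (intro AE_I2) (simp add: bounded_symbol_def bounded_clinear_def)
    with M have "AE z in circle. norm (\<Phi> z (f z)) \<le> M * norm (f z)"
    proof eventually_elim
      case (elim z)
      show ?case
        using onorm[OF elim(2), of "f z"] mult_right_mono[OF elim(1) norm_ge_zero[of "f z"]]
        by linarith
    qed
    then show ?thesis
      using f borel_measurable_symbol_apply[OF \<Phi>]
      by (intro square_integrable_bounded_pointwise[OF f]) (auto simp: square_integrable_def)
  qed
  have "AE z in circle. \<Phi> z (f z) = \<Psi> z (g z)"
    using rel by (auto simp: Linf_rel_def L2_rel_def)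
  then show "L2_rel (\<lambda>z. \<Phi> z (f z)) (\<lambda>z. \<Psi> z (g z))"
    using rel by (auto simp: Linf_rel_def L2_rel_def intro: square_integrable_apply)
qed


section \<open>Toeplitz and Hankel operators\<close>

definition toeplitz_op :: "'e::separable_complex_hilbert Linf \<Rightarrow> 'e hardy \<Rightarrow> 'e hardy"
  where "toeplitz_op \<Phi> f = hardy_proj (mult_op \<Phi> (Rep_hardy f))"

definition hankel_op :: "'e::separable_complex_hilbert Linf \<Rightarrow> 'e hardy \<Rightarrow> 'e hardy"
  where "hankel_op \<Phi> f = hardy_proj (mult_op \<Phi> (flip (Rep_hardy f)))"

definition is_toeplitz :: "('e::separable_complex_hilbert hardy \<Rightarrow> 'e hardy) \<Rightarrow> bool"
  where "is_toeplitz A \<longleftrightarrow> (\<exists>\<Phi>. A = toeplitz_op \<Phi>)"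

definition is_hankel :: "('e::separable_complex_hilbert hardy \<Rightarrow> 'e hardy) \<Rightarrow> bool"
  where "is_hankel A \<longleftrightarrow> (\<exists>\<Phi>. A = hankel_op \<Phi>)"

definition shift :: "'e::separable_complex_hilbert hardy \<Rightarrow> 'e hardy"
  where "shift = toeplitz_op z_symbol"

end

theory Submission
  imports Defs
begin

text \<open>
Write \<open>S\<close> for the shift and \<open>S*\<close> for its adjoint. Everything is compared with the last condition, the
identity \<open>A S + S*\<^sup>2 A S = S* A + S* A S\<^sup>2\<close>. Two characterisations of operators by intertwining relations
make this possible: a bounded \<open>T\<close> is Toeplitz iff \<open>S* T S = T\<close> (Brown and Halmos), and a bounded \<open>H\<close>
is Hankel iff \<open>S* H = H S\<close> (Nehari; Page for operator-valued symbols). Writing out the first relation for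
\<open>A S - S* A\<close>, or the second for \<open>S* A S - A\<close>, gives exactly the identity. A sum of a Toeplitz
and a Hankel operator satisfies the identity because each summand does.

Conversely, let \<open>A\<close> satisfy the identity. Its Toeplitz part is recovered as a limit (lemma
\<open>toeplitz_hankel_decomposition\<close>): if \<open>A = T + H\<close> then \<open>S*\<^sup>n A S\<^sup>n = T + S*\<^sup>2\<^sup>n H\<close>, which converges strongly
to \<open>T\<close>. To see that the limit exists, note that \<open>k = S* A S - A\<close> satisfies \<open>S* k = k S\<close>, so
\<open>S*\<^sup>n A S\<^sup>n f - A f\<close> is the \<open>n\<close>-th partial sum of the series \<open>\<Sum> S*\<^sup>2\<^sup>m k f\<close>. These partial sums
are bounded, and a mean ergodic argument shows that bounded partial sums of this kind converge (lemma
\<open>ergodic_limit\<close>). The limit \<open>T\<close> satisfies \<open>S* T S = T\<close>, and the identity forces \<open>S* H = H S\<close> for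
\<open>H = A - T\<close>.

The analytic core is the existence of symbols. Both characterisations reduce to one statement (lemma
\<open>symbol_exists\<close>): a two-sided sequence \<open>\<Gamma>\<close> of linear maps on \<open>\<E>\<close> is the Fourier sequence of a bounded
symbol as soon as, for each vector \<open>x\<close>, multiplication of scalar polynomials by the formal series
\<open>\<Sum> \<Gamma> k x z\<^sup>k\<close> is bounded in the \<open>L\<^sup>2\<close> norm with bound \<open>C * norm x\<close>. Such a series is by Riesz-Fischer a
function \<open>F x\<close>, the polynomial bound gives \<open>norm (F x z) \<le> C * norm x\<close> almost everywhere, and the values on
a countable dense set of vectors extend to a bounded operator for almost every \<open>z\<close>. For a Toeplitz
operator the sequence \<open>\<Gamma>\<close> is read off its matrix. A Hankel matrix only contains the coefficients of
nonnegative index; the missing ones are supplied by extending \<open>H\<close> repeatedly to an \<open>H'\<close> with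
\<open>S* H' = H' S = H\<close> (lemma \<open>extend_hankel_one_step\<close>). Each extension increases the norm bound a little. That
slack makes the quadratic form behind the extension coercive, so that it is a plain orthogonal
projection, and the increments are chosen summable, so that all bounds stay below a constant.
\<close>

section \<open>Bounded complex-linear maps\<close>

lemma bounded_clinear_imp_bounded_linear: "bounded_clinear A \<Longrightarrow> bounded_linear A"
  by (simp add: bounded_clinear_def)

lemma bounded_clinearI:
  assumes "\<And>x y. A (x + y) = A x + A y" "\<And>c x. A (c *\<^sub>C x) = c *\<^sub>C A x"
    "\<And>x. norm (A x) \<le> norm x * K"
  shows "bounded_clinear A"
  unfolding bounded_clinear_def
  using assms by (auto intro!: bounded_linear_intro[where K=K] simp: scaleR_scaleC)

lemma bounded_clinear_add: "bounded_clinear A \<Longrightarrow> A (x + y) = A x + A y"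
  by (simp add: bounded_clinear_def linear_add bounded_linear.linear)

lemma bounded_clinear_diff: "bounded_clinear A \<Longrightarrow> A (x - y) = A x - A y"
  by (simp add: bounded_clinear_def linear_diff bounded_linear.linear)

lemma bounded_clinear_scaleC: "bounded_clinear A \<Longrightarrow> A (c *\<^sub>C x) = c *\<^sub>C A x"
  by (simp add: bounded_clinear_def)

lemma bounded_clinear_scaleR: "bounded_clinear A \<Longrightarrow> A (c *\<^sub>R x) = c *\<^sub>R A x"
  by (simp add: bounded_clinear_def linear_scale bounded_linear.linear)

lemma bounded_clinear_zero: "bounded_clinear A \<Longrightarrow> A 0 = 0"
  by (simp add: bounded_clinear_def linear_0 bounded_linear.linear)

lemma bounded_clinear_sum: "bounded_clinear A \<Longrightarrow> A (sum f I) = (\<Sum>i\<in>I. A (f i))"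
  by (simp add: bounded_clinear_def linear_sum bounded_linear.linear)

lemma scaleC_diff_right: "a *\<^sub>C (x - y) = a *\<^sub>C x - a *\<^sub>C (y::'a::complex_inner)"
  by (rule bounded_bilinear.diff_right[OF bounded_bilinear_scaleC])

lemma scaleC_one [simp]: "1 *\<^sub>C x = (x :: 'a::complex_inner)"
  using scaleR_scaleC[of 1 x] by simp

lemma scaleC_zero_left [simp]: "0 *\<^sub>C x = (0 :: 'a::complex_inner)"
  by (rule bounded_bilinear.zero_left[OF bounded_bilinear_scaleC])

lemma scaleC_zero_right [simp]: "a *\<^sub>C 0 = (0 :: 'a::complex_inner)"
  by (rule bounded_bilinear.zero_right[OF bounded_bilinear_scaleC])

lemma cinner_zero_left [simp]: "cinner 0 (y::'a::complex_inner) = 0"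
  by (rule bounded_bilinear.zero_left[OF bounded_bilinear_cinner])

lemma cinner_zero_right [simp]: "cinner (x::'a::complex_inner) 0 = 0"
  by (rule bounded_bilinear.zero_right[OF bounded_bilinear_cinner])

lemma cinner_diff_left: "cinner (x - y) (z::'a::complex_inner) = cinner x z - cinner y z"
  by (rule bounded_bilinear.diff_left[OF bounded_bilinear_cinner])

lemma cinner_diff_right: "cinner z (x - y::'a::complex_inner) = cinner z x - cinner z y"
  by (rule bounded_bilinear.diff_right[OF bounded_bilinear_cinner])

lemma cinner_sum_right: "cinner z (sum f A :: 'a::complex_inner) = (\<Sum>i\<in>A. cinner z (f i))"
  by (rule bounded_bilinear.sum_right[OF bounded_bilinear_cinner])

lemma cinner_scaleC_right: "cinner x (a *\<^sub>C y) = cnj a * cinner x y"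
  by (metis cinner_commute cinner_scaleC_left complex_cnj_cnj complex_cnj_mult)

lemma inner_scaleC_left: "inner (a *\<^sub>C u) v = inner u (cnj a *\<^sub>C (v::'a::complex_inner))"
  by (metis Re_cinner cinner_scaleC_left cinner_scaleC_right complex_cnj_cnj)

lemma bounded_clinear_compose: "bounded_clinear A \<Longrightarrow> bounded_clinear B \<Longrightarrow> bounded_clinear (\<lambda>x. A (B x))"
  by (auto simp: bounded_clinear_def bounded_linear_compose)

lemma bounded_clinear_sub: "bounded_clinear A \<Longrightarrow> bounded_clinear B \<Longrightarrow> bounded_clinear (\<lambda>f. A f - B f)"
  by (simp add: bounded_clinear_def bounded_linear_sub scaleC_diff_right)

section \<open>Convex minimisation in Hilbert spaces\<close>

text \<open>
Almost minimal elements of the sets form a Cauchy sequence by the parallelogram law, since midpoints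
stay in the larger set. This replaces weak compactness of bounded sets.
\<close>
lemma nested_closed_convex_Inter_nonempty:
  fixes C :: "nat \<Rightarrow> 'a::{real_inner, complete_space} set"
  assumes cl: "\<And>n. closed (C n)" and cv: "\<And>n. convex (C n)" and ne: "\<And>n. C n \<noteq> {}"
    and bd: "bounded (C 0)" and dec: "\<And>m n. m \<le> n \<Longrightarrow> C n \<subseteq> C m"
  shows "(\<Inter>n. C n) \<noteq> {}"
proof -
  define d where "d n = (INF x\<in>C n. (norm x)\<^sup>2)" for n
  have bb: "bdd_below ((\<lambda>x. (norm x)\<^sup>2) ` X)" for X :: "'a set"
    by (rule bdd_belowI2[where m=0]) simp
  have dle: "d n \<le> (norm x)\<^sup>2" if "x \<in> C n" for n x
    unfolding d_def using that by (intro cINF_lower bb)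
  have dmono: "d m \<le> d n" if "m \<le> n" for m n
    unfolding d_def using ne dec[OF that] by (intro cINF_superset_mono bb) auto
  obtain K where K: "\<And>x. x \<in> C 0 \<Longrightarrow> norm x \<le> K"
    using bd by (auto simp: bounded_iff)
  have dK: "d n \<le> K\<^sup>2" for n
  proof -
    obtain x where x: "x \<in> C n" using ne by blast
    then have "norm x \<le> K" using K dec[of 0 n] by auto
    then have "(norm x)\<^sup>2 \<le> K\<^sup>2" by (simp add: power_mono)
    then show ?thesis using dle[OF x] by linarith
  qed
  have "\<exists>x\<in>C n. (norm x)\<^sup>2 < d n + inverse (Suc n)" for n
    using cINF_less_iff[OF ne bb, of n "d n + inverse (Suc n)"] unfolding d_def by simp
  then obtain x where xC: "\<And>n. x n \<in> C n" and xd: "\<And>n. (norm (x n))\<^sup>2 < d n + inverse (Suc n)"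
    by metis
  obtain L where "d \<longlonglongrightarrow> L"
    using incseq_convergent[of d "K\<^sup>2"] dK dmono unfolding incseq_def by metis
  then have "Cauchy (\<lambda>n. 2 * d n)"
    by (intro LIMSEQ_imp_Cauchy[of _ "2 * L"] tendsto_intros)
  have inv: "(\<lambda>n. inverse (real (Suc n))) \<longlonglongrightarrow> 0" by (rule LIMSEQ_inverse_real_of_nat)
  have dist_le: "(norm (x m - x n))\<^sup>2 \<le> 2 * (d n - d m) + 4 * inverse (Suc m)" if "m \<le> n" for m n
  proof -
    have "(1/2) *\<^sub>R x m + (1/2) *\<^sub>R x n \<in> C m"
      using xC[of m] xC[of n] dec[OF that] by (intro convexD[OF cv]) auto
    then have "d m \<le> (norm ((1/2) *\<^sub>R x m + (1/2) *\<^sub>R x n))\<^sup>2" by (rule dle)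
    also have "\<dots> = (norm (x m + x n))\<^sup>2 / 4"
      by (simp flip: scaleR_add_right add: power_mult_distrib power2_eq_square)
    finally have *: "4 * d m \<le> (norm (x m + x n))\<^sup>2" by simp
    have par: "(norm (x m - x n))\<^sup>2 + (norm (x m + x n))\<^sup>2 = 2 * (norm (x m))\<^sup>2 + 2 * (norm (x n))\<^sup>2"
      by (simp add: power2_norm_eq_inner inner_add inner_diff inner_commute)
    have "inverse (Suc n) \<le> (inverse (Suc m) :: real)" using that by simp
    with * par xd[of m] xd[of n] show ?thesis by argo
  qed
  have "Cauchy x"
  proof (rule metric_CauchyI)
    fix e :: real assume e: "0 < e"
    have "eventually (\<lambda>n. inverse (real (Suc n)) < e\<^sup>2/8) sequentially"
      using order_tendstoD(2)[OF inv, of "e\<^sup>2/8"] e by simp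
    then obtain N1 where N1: "\<And>n. n \<ge> N1 \<Longrightarrow> inverse (real (Suc n)) < e\<^sup>2/8"
      by (auto simp: eventually_sequentially)
    obtain N2 where N2: "\<And>m n. m \<ge> N2 \<Longrightarrow> n \<ge> N2 \<Longrightarrow> \<bar>2 * d m - 2 * d n\<bar> < e\<^sup>2/2"
      using \<open>Cauchy (\<lambda>n. 2 * d n)\<close> e unfolding Cauchy_def dist_real_def
      by (metis half_gt_zero zero_less_power)
    have main: "norm (x m - x n) < e" if "m \<le> n" "m \<ge> max N1 N2" for m n
    proof -
      have "(norm (x m - x n))\<^sup>2 < e\<^sup>2"
        using dist_le[OF that(1)] N1[of m] N2[of m n] that by (simp add: abs_if split: if_splits)
      then show ?thesis using e by (simp add: power2_less_imp_less)
    qed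
    show "\<exists>M. \<forall>m\<ge>M. \<forall>n\<ge>M. dist (x m) (x n) < e"
    proof (intro exI allI impI)
      fix m n assume "max N1 N2 \<le> m" "max N1 N2 \<le> n"
      then show "dist (x m) (x n) < e"
        using main[of m n] main[of n m] by (cases "m \<le> n") (auto simp: dist_norm norm_minus_commute)
    qed
  qed
  then obtain l where l: "x \<longlonglongrightarrow> l"
    using Cauchy_convergent[OF \<open>Cauchy x\<close>] unfolding convergent_def by blast
  have "l \<in> C n" for n
  proof (rule Lim_in_closed_set[OF cl _ _ l])
    show "eventually (\<lambda>k. x k \<in> C n) sequentially"
      using xC dec by (auto simp: eventually_sequentially intro!: exI[of _ n])
  qed simp
  then show ?thesis by blast
qed

text \<open>
Minimise \<open>b f f - 2 * \<phi> f\<close>: its sublevel sets are closed, convex and bounded, and the derivative at a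
minimiser vanishes.
\<close>
lemma coercive_form_represents:
  fixes b :: "'a::{real_inner, complete_space} \<Rightarrow> 'a \<Rightarrow> real"
  assumes b: "bounded_bilinear b" and sym: "\<And>u v. b u v = b v u"
    and coer: "\<And>u. k * (norm u)\<^sup>2 \<le> b u u" and k: "0 < k" and phi: "bounded_linear \<phi>"
  shows "\<exists>f. \<forall>h. b f h = \<phi> h"
proof -
  interpret b: bounded_bilinear b by (rule b)
  interpret phi: bounded_linear \<phi> by (rule phi)
  define J where "J f = b f f - 2 * \<phi> f" for f
  have contJ: "continuous_on UNIV J"
    unfolding J_def by (intro continuous_intros b.continuous_on phi.continuous_on)
  have Jmid: "J ((1 - t) *\<^sub>R x + t *\<^sub>R y) \<le> (1 - t) * J x + t * J y" if "0 \<le> t" "t \<le> 1" for t x y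
  proof -
    have "(1 - t) * J x + t * J y - J ((1 - t) *\<^sub>R x + t *\<^sub>R y) = t * (1 - t) * b (x - y) (x - y)"
      unfolding J_def using sym[of x y]
      by (simp add: b.add_left b.add_right b.diff_left b.diff_right b.scaleR_left b.scaleR_right
          phi.add phi.scaleR)
        (simp add: algebra_simps)
    moreover have "0 \<le> b (x - y) (x - y)"
      using coer[of "x - y"] k by (meson less_imp_le mult_nonneg_nonneg order_trans zero_le_power2)
    ultimately show ?thesis using that by (smt (verit) mult_nonneg_nonneg)
  qed
  obtain K where K0: "0 < K" and K: "\<And>x. \<bar>\<phi> x\<bar> \<le> norm x * K"
    using phi.pos_bounded by (auto simp: real_norm_def)
  have low: "J f \<ge> k * (norm f)\<^sup>2 - 2 * K * norm f" for f
    using coer[of f] K[of f] by (simp add: J_def abs_le_iff mult.commute mult.left_commute)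
  have sq: "k * s\<^sup>2 - 2 * K * s \<ge> - (K\<^sup>2 / k)" for s :: real
  proof -
    have "k * s\<^sup>2 - 2 * K * s + K\<^sup>2 / k = k * (s - K / k)\<^sup>2"
      using k by (simp add: field_simps power2_eq_square)
    then show ?thesis using k by (smt (verit) mult_nonneg_nonneg zero_le_power2)
  qed
  have bb: "bdd_below (range J)"
    by (rule bdd_belowI2[where m="- (K\<^sup>2 / k)"]) (use low sq in \<open>meson order_trans\<close>)
  define I where "I = (INF f. J f)"
  have IJ: "I \<le> J f" for f unfolding I_def by (rule cINF_lower[OF bb]) simp
  define C where "C n = {f. J f \<le> I + inverse (Suc n)}" for n
  have "(\<Inter>n. C n) \<noteq> {}"
  proof (rule nested_closed_convex_Inter_nonempty)
    show "closed (C n)" for n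
      unfolding C_def using contJ by (intro closed_Collect_le continuous_on_const)
    show "convex (C n)" for n
    proof (rule convexI)
      fix x y u v assume *: "x \<in> C n" "y \<in> C n" "0 \<le> (u::real)" "0 \<le> v" "u + v = 1"
      then have u: "u = 1 - v" by simp
      have "J (u *\<^sub>R x + v *\<^sub>R y) \<le> (1 - v) * J x + v * J y"
        using Jmid[of v x y] * by (simp add: u)
      also have "\<dots> \<le> (1 - v) * (I + inverse (Suc n)) + v * (I + inverse (Suc n))"
        using * by (intro add_mono mult_left_mono) (auto simp: C_def)
      finally show "u *\<^sub>R x + v *\<^sub>R y \<in> C n" by (simp add: C_def algebra_simps)
    qed
    show "C n \<noteq> {}" for n
    proof -
      have "\<exists>x\<in>UNIV. J x < I + inverse (Suc n)"
        using cINF_less_iff[OF _ bb, of "I + inverse (Suc n)"] unfolding I_def by auto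
      then show ?thesis unfolding C_def by (auto intro: less_imp_le)
    qed
    show "C n \<subseteq> C m" if "m \<le> n" for m n
    proof -
      have "inverse (Suc n) \<le> (inverse (Suc m) :: real)" using that by simp
      then show ?thesis unfolding C_def by (auto intro: order_trans)
    qed
    show "bounded (C 0)"
      unfolding bounded_iff
    proof (intro exI ballI)
      fix f assume "f \<in> C 0"
      then have "k * (norm f)\<^sup>2 - 2 * K * norm f \<le> I + 1" using low[of f] by (simp add: C_def)
      then have *: "norm f * (k * norm f - 2 * K) \<le> \<bar>I + 1\<bar>"
        by (simp add: algebra_simps power2_eq_square)
      show "norm f \<le> (2 * K + \<bar>I + 1\<bar>) / k + 1"
      proof (rule ccontr)
        assume "\<not> ?thesis"
        then have big: "(2 * K + \<bar>I + 1\<bar>) / k + 1 < norm f" by simp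
        then have "(2 * K + \<bar>I + 1\<bar>) + k < k * norm f" using k by (simp add: field_simps)
        then have "k * norm f - 2 * K > \<bar>I + 1\<bar>" using k by linarith
        moreover have "norm f > 1" using big K0 k
          by (smt (verit) divide_nonneg_nonneg)
        ultimately show False using *
          by (smt (verit) mult_less_cancel_right1 mult_less_cancel_right2 mult_le_cancel_right1)
      qed
    qed
  qed
  then obtain f where f: "\<And>n. J f \<le> I + inverse (Suc n)" by (auto simp: C_def)
  have "J f \<le> I"
  proof (rule LIMSEQ_le_const)
    show "(\<lambda>n. I + inverse (real (Suc n))) \<longlonglongrightarrow> I"
      using tendsto_add[OF tendsto_const LIMSEQ_inverse_real_of_nat, of I] by simp
  qed (use f in auto)
  then have min: "J f \<le> J g" for g using IJ[of g] by linarith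
  have "b f h = \<phi> h" for h
  proof -
    have q: "0 \<le> 2 * t * (b f h - \<phi> h) + t\<^sup>2 * b h h" for t :: real
      using min[of "f + t *\<^sub>R h"] sym[of f h]
      by (simp add: J_def b.add_left b.add_right b.scaleR_left b.scaleR_right phi.add phi.scaleR
          power2_eq_square algebra_simps)
    define e where "e = b f h - \<phi> h"
    define B where "B = \<bar>b h h\<bar> + 1"
    have B: "B > 0" "b h h \<le> B" by (auto simp: B_def)
    \<comment> \<open>the minimiser of \<open>2 * t * e + t\<^sup>2 * B\<close>\<close>
    have "0 \<le> 2 * (- e / B) * e + (- e / B)\<^sup>2 * b h h" using q[of "- e / B"] by (simp add: e_def)
    also have "\<dots> \<le> 2 * (- e / B) * e + (- e / B)\<^sup>2 * B"
      using B by (intro add_left_mono mult_left_mono) auto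
    also have "\<dots> = - (e\<^sup>2 / B)" using B by (simp add: field_simps power2_eq_square)
    finally have "e\<^sup>2 \<le> 0" using B by (simp add: divide_le_0_iff)
    then show ?thesis by (simp add: e_def)
  qed
  then show ?thesis by blast
qed

section \<open>Operators intertwining a pure isometry\<close>

text \<open>
The unilateral shift enters the operator theory only through these properties. The operator \<open>S'\<close> is
the adjoint of \<open>S\<close>, and the last property says that \<open>S\<close> has no unitary part.
\<close>
locale pure_isometry =
  fixes S S' :: "'a::{complex_inner, complete_space} \<Rightarrow> 'a"
  assumes S: "bounded_clinear S" and S': "bounded_clinear S'"
    and S'_S [simp]: "S' (S x) = x"
    and cinner_S: "cinner (S x) y = cinner x (S' y)"
    and pure: "(\<lambda>n. (S' ^^ n) x) \<longlonglongrightarrow> 0"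
begin

lemma inner_S: "inner (S x) y = inner x (S' y)"
  by (simp flip: Re_cinner add: cinner_S)

lemma norm_S [simp]: "norm (S x) = norm x"
  by (simp add: norm_eq_sqrt_inner inner_S)

lemma norm_square_split: "(norm y)\<^sup>2 = (norm (S' y))\<^sup>2 + (norm (y - S (S' y)))\<^sup>2"
proof -
  have "inner y (S (S' y)) = inner (S' y) (S' y)"
    using inner_S[of "S' y" y] by (simp add: inner_commute)
  then show ?thesis
    by (simp add: power2_norm_eq_inner inner_diff inner_commute inner_S)
qed

lemma norm_S': "norm (S' y) \<le> norm y"
  using norm_square_split[of y] by (smt (verit) norm_ge_zero power2_le_imp_le zero_le_power2)

text \<open>
In matrix terms, \<open>H'\<close> prepends one coefficient to a Hankel matrix, which is a Parrott completion problem. As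
\<open>S' H' = H\<close> is prescribed, \<open>H' = S H + L\<close> with \<open>L\<close> taking values in the kernel of \<open>S'\<close>, and \<open>H' S = H\<close>
prescribes \<open>L\<close> on the range of \<open>S\<close>. The norm bound says that \<open>norm (L g)\<^sup>2 \<le> B g g\<close> for the form
\<open>B u v = c'\<^sup>2 * inner u v - inner (H u) (H v)\<close>; this holds on the range of \<open>S\<close>, and composing with
the \<open>B\<close>-orthogonal projection onto that range extends \<open>L\<close> without increasing the bound. The strict inequality
\<open>c < c'\<close> makes \<open>B\<close> coercive, so that this projection exists.
\<close>
lemma extend_hankel_one_step:
  assumes H: "bounded_clinear H" and inter: "\<And>x. S' (H x) = H (S x)"
    and bound: "\<And>x. norm (H x) \<le> c * norm x" and c: "0 \<le> c" "c < c'"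
  shows "\<exists>H'. bounded_clinear H' \<and> (\<forall>x. H' (S x) = H x) \<and> (\<forall>x. S' (H' x) = H x)
    \<and> (\<forall>x. norm (H' x) \<le> c' * norm x)"
proof -
  note H_simps = bounded_clinear_add[OF H] bounded_clinear_diff[OF H] bounded_clinear_scaleC[OF H]
    bounded_clinear_scaleR[OF H]
  note S_simps = bounded_clinear_add[OF S] bounded_clinear_diff[OF S] bounded_clinear_scaleC[OF S]
    bounded_clinear_scaleR[OF S]
  note S'_simps = bounded_clinear_add[OF S'] bounded_clinear_diff[OF S'] bounded_clinear_scaleC[OF S']
  define B where "B u v = c'\<^sup>2 * inner u v - inner (H u) (H v)" for u v
  have B_add: "B (u + v) w = B u w + B v w" and B_diff: "B (u - v) w = B u w - B v w"
    and B_add': "B w (u + v) = B w u + B w v"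
    and B_diff': "B w (u - v) = B w u - B w v"
    and B_sym: "B u v = B v u" and B_scaleR: "B (r *\<^sub>R u) w = r * B u w" "B w (r *\<^sub>R u) = r * B w u"
    for u v w r
    by (simp_all add: B_def H_simps inner_add inner_diff inner_commute algebra_simps)
  have B_scaleC: "B (a *\<^sub>C u) w = B u (cnj a *\<^sub>C w)" for a u w
    by (simp add: B_def H_simps inner_scaleC_left)
  have HB: "\<bar>inner (H u) (H v)\<bar> \<le> c\<^sup>2 * (norm u * norm v)" for u v
  proof -
    have "\<bar>inner (H u) (H v)\<bar> \<le> norm (H u) * norm (H v)" by (rule Cauchy_Schwarz_ineq2)
    also have "\<dots> \<le> (c * norm u) * (c * norm v)" using c by (intro mult_mono bound) auto
    finally show ?thesis by (simp add: power2_eq_square mult_ac)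
  qed
  have B_low: "(c'\<^sup>2 - c\<^sup>2) * (norm u)\<^sup>2 \<le> B u u" for u
    using HB[of u u] by (simp add: B_def left_diff_distrib flip: power2_eq_square power2_norm_eq_inner)
  have c2: "c\<^sup>2 < c'\<^sup>2" using c by (simp add: power_strict_mono)
  then have B_nonneg: "0 \<le> B u u" for u
    using B_low[of u] by (meson diff_ge_0_iff_ge less_imp_le mult_nonneg_nonneg order_trans zero_le_power2)
  have B_bil: "bounded_bilinear B"
  proof
    show "\<exists>K. \<forall>a b. norm (B a b) \<le> norm a * norm b * K"
    proof (intro exI allI)
      fix a b :: 'a
      have "\<bar>c'\<^sup>2 * inner a b\<bar> \<le> c'\<^sup>2 * (norm a * norm b)"
        by (simp add: abs_mult Cauchy_Schwarz_ineq2 mult_left_mono)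
      then show "norm (B a b) \<le> norm a * norm b * (c'\<^sup>2 + c\<^sup>2)"
        using HB[of a b] by (simp add: B_def algebra_simps)
    qed
  qed (simp_all add: B_add B_add' B_scaleR)
  \<comment> \<open>\<open>S (p g)\<close> is going to be the \<open>B\<close>-orthogonal projection of \<open>g\<close> onto the range of \<open>S\<close>\<close>
  have "\<exists>f. \<forall>h. B (S f) (S h) = B g (S h)" for g
  proof (rule coercive_form_represents[of "\<lambda>f h. B (S f) (S h)"])
    show "bounded_bilinear (\<lambda>f h. B (S f) (S h))"
      using bounded_bilinear.comp[OF B_bil] S by (auto simp: bounded_clinear_def)
    show "bounded_linear (\<lambda>h. B g (S h))"
      using bounded_linear_compose[OF bounded_bilinear.bounded_linear_right[OF B_bil]] S
      by (auto simp: bounded_clinear_def)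
    show "0 < c'\<^sup>2 - c\<^sup>2" using c2 by simp
    show "(c'\<^sup>2 - c\<^sup>2) * (norm u)\<^sup>2 \<le> B (S u) (S u)" for u using B_low[of "S u"] by simp
  qed (rule B_sym)
  then obtain p where p: "\<And>g h. B (S (p g)) (S h) = B g (S h)" by metis
  have p_unique: "f = p g" if "\<And>h. B (S f) (S h) = B g (S h)" for f g
  proof -
    have "B (S (f - p g)) (S (f - p g)) = 0"
      using that[of "f - p g"] p[of g "f - p g"] by (simp add: S_simps B_diff)
    then have "norm (f - p g) = 0"
      using B_low[of "S (f - p g)"] c2 by (simp add: mult_le_0_iff)
    then show ?thesis by simp
  qed
  have p_add: "p (g + h) = p g + p h" for g h
    by (rule p_unique[symmetric]) (simp add: S_simps B_add p)
  have p_scaleC: "p (a *\<^sub>C g) = a *\<^sub>C p g" for a g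
  proof (rule p_unique[symmetric])
    fix h show "B (S (a *\<^sub>C p g)) (S h) = B (a *\<^sub>C g) (S h)"
      using p[of g "cnj a *\<^sub>C h"] by (simp add: S_simps B_scaleC)
  qed
  have p_S: "p (S f) = f" for f by (rule p_unique[symmetric]) simp
  define L where "L g = H (p g) - S (S' (H (p g)))" for g
  define H' where "H' g = S (H g) + L g" for g
  have S'L: "S' (L g) = 0" for g by (simp add: L_def S'_simps)
  have normL: "(norm (L g))\<^sup>2 \<le> B g g" for g
  proof -
    have "(norm (L g))\<^sup>2 = (norm (H (p g)))\<^sup>2 - (norm (H (S (p g))))\<^sup>2"
      using norm_square_split[of "H (p g)"] by (simp add: L_def inter)
    also have "\<dots> \<le> c'\<^sup>2 * (norm (p g))\<^sup>2 - (norm (H (S (p g))))\<^sup>2"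
    proof -
      have "norm (H (p g)) \<le> c' * norm (p g)"
        using bound[of "p g"] c by (meson less_imp_le mult_right_mono norm_ge_zero order_trans)
      then show ?thesis by (simp add: power_mono flip: power_mult_distrib)
    qed
    also have "\<dots> = B (S (p g)) (S (p g))" by (simp add: B_def flip: power2_norm_eq_inner)
    also have "\<dots> = B g g - B (g - S (p g)) (g - S (p g))"
      using p[of g "p g"] B_sym[of g "S (p g)"]
      by (simp add: B_diff B_diff')
    also have "\<dots> \<le> B g g" using B_nonneg by simp
    finally show ?thesis .
  qed
  have norm_H': "norm (H' g) \<le> c' * norm g" for g
  proof (rule power2_le_imp_le)
    have "(norm (H' g))\<^sup>2 = (norm (H g))\<^sup>2 + (norm (L g))\<^sup>2"
      using norm_square_split[of "H' g"] by (simp add: H'_def S'_simps S'L)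
    also have "\<dots> \<le> (c' * norm g)\<^sup>2"
      using normL[of g] by (simp add: B_def power_mult_distrib power2_norm_eq_inner)
    finally show "(norm (H' g))\<^sup>2 \<le> (c' * norm g)\<^sup>2" .
    show "0 \<le> c' * norm g" using c by simp
  qed
  have "bounded_clinear H'"
  proof (rule bounded_clinearI)
    show "norm (H' x) \<le> norm x * c'" for x using norm_H'[of x] by (simp add: mult.commute)
  qed (simp_all add: H'_def L_def p_add p_scaleC H_simps S_simps S'_simps scaleC_add_right
      scaleC_diff_right)
  moreover have "H' (S x) = H x" for x by (simp add: H'_def L_def p_S flip: inter)
  moreover have "S' (H' x) = H x" for x by (simp add: H'_def S'_simps S'L)
  ultimately show ?thesis using norm_H' by blast
qed

text \<open>
Iterate the one-step extension. The bounds \<open>c + 1 - 1 / (n + 1)\<close> increase strictly, as each step requires, and stay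
below \<open>c + 1\<close>.
\<close>
lemma extend_hankel:
  assumes H: "bounded_clinear H" and inter: "\<And>x. S' (H x) = H (S x)"
  shows "\<exists>G K. G 0 = H \<and> (\<forall>n. bounded_clinear (G n)) \<and> (\<forall>n x. G (Suc n) (S x) = G n x)
    \<and> (\<forall>n x. S' (G (Suc n) x) = G n x) \<and> (\<forall>n x. norm (G n x) \<le> K * norm x)"
proof -
  obtain c where c: "0 < c" "\<And>x. norm (H x) \<le> norm x * c"
    using H bounded_linear.pos_bounded unfolding bounded_clinear_def by blast
  define P where "P n G \<longleftrightarrow> bounded_clinear G \<and> (\<forall>x. S' (G x) = G (S x))
      \<and> (\<forall>x. norm (G x) \<le> (c + 1 - inverse (real (Suc n))) * norm x) \<and> (n = 0 \<longrightarrow> G = H)"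
    for n G
  have "\<exists>f. \<forall>n. P n (f n) \<and> (\<forall>x. f (Suc n) (S x) = f n x \<and> S' (f (Suc n) x) = f n x)"
  proof (rule dependent_nat_choice)
    show "\<exists>G. P 0 G" using H inter c by (auto simp: P_def mult.commute)
  next
    fix G n assume P: "P n G"
    have i: "inverse (real (Suc n)) \<le> 1" "inverse (real (Suc (Suc n))) < inverse (real (Suc n))"
      by (simp_all add: divide_simps)
    have "\<exists>G'. bounded_clinear G' \<and> (\<forall>x. G' (S x) = G x) \<and> (\<forall>x. S' (G' x) = G x)
      \<and> (\<forall>x. norm (G' x) \<le> (c + 1 - inverse (real (Suc (Suc n)))) * norm x)"
      by (rule extend_hankel_one_step[where c = "c + 1 - inverse (real (Suc n))"])
        (use P i c(1) in \<open>auto simp: P_def simp del: of_nat_Suc\<close>)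
    then show "\<exists>G'. P (Suc n) G' \<and> (\<forall>x. G' (S x) = G x \<and> S' (G' x) = G x)"
      unfolding P_def by auto
  qed
  then obtain G where G: "\<And>n. P n (G n)" "\<And>n x. G (Suc n) (S x) = G n x"
    "\<And>n x. S' (G (Suc n) x) = G n x" by blast
  have "norm (G n x) \<le> (c + 1) * norm x" for n x
  proof -
    have "norm (G n x) \<le> (c + 1 - inverse (real (Suc n))) * norm x" using G(1)[of n] by (auto simp: P_def)
    also have "\<dots> \<le> (c + 1) * norm x" by (intro mult_right_mono) auto
    finally show ?thesis .
  qed
  moreover have "G 0 = H" "\<And>n. bounded_clinear (G n)" using G(1) by (auto simp: P_def)
  ultimately show ?thesis using G by blast
qed

text \<open>
With \<open>W = S'\<^sup>2\<close> the sequence is \<open>v n = (\<Sum>i<n. W\<^sup>i u)\<close>, so \<open>v n - W (v n) = u - W\<^sup>n u\<close> tends to \<open>u\<close>. A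
weak limit point \<open>w\<close> of the bounded sequence therefore solves \<open>w - W w = u\<close>; then \<open>v n = w - W\<^sup>n w\<close>,
which converges because the powers of \<open>W\<close> tend to \<open>0\<close> strongly. The weak limit point is found in the
intersection of the closed convex hulls of the tails.
\<close>
lemma ergodic_limit:
  assumes v0: "v 0 = 0" and step: "\<And>n. v (Suc n) = u + S' (S' (v n))" and bd: "\<And>n. norm (v n) \<le> K"
  shows "convergent v"
proof -
  define W where "W = S' \<circ> S'"
  have W: "bounded_clinear W"
    using S' bounded_linear_compose[of S' S'] by (auto simp: W_def bounded_clinear_def comp_def)
  note W_simps = bounded_clinear_add[OF W] bounded_clinear_diff[OF W] bounded_clinear_scaleR[OF W]
    bounded_clinear_zero[OF W]
  have W0: "(\<lambda>n. (W ^^ n) x) \<longlonglongrightarrow> 0" for x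
  proof -
    have "(W ^^ n) y = (S' ^^ (2 * n)) y" for n y
      by (induction n) (simp_all add: W_def)
    then show ?thesis
      using LIMSEQ_subseq_LIMSEQ[OF pure[of x], of "\<lambda>n. 2 * n"] by (simp add: strict_mono_def comp_def)
  qed
  have step: "v (Suc n) = u + W (v n)" for n using step by (simp add: W_def)
  have diff: "v (Suc n) = v n + (W ^^ n) u" for n
    by (induction n) (simp_all add: step v0 W_simps)
  have "(\<Inter>k. closure (convex hull (v ` {k..}))) \<noteq> {}"
  proof (rule nested_closed_convex_Inter_nonempty)
    have "closure (convex hull (v ` {0..})) \<subseteq> cball 0 K"
      using bd by (intro closure_minimal hull_minimal) auto
    then show "bounded (closure (convex hull (v ` {0..})))" by (rule bounded_subset[OF bounded_cball])
    show "closure (convex hull (v ` {n..})) \<subseteq> closure (convex hull (v ` {m..}))" if "m \<le> n" for m n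
      using that by (intro closure_mono hull_mono) auto
  qed (auto intro: convex_closure)
  then obtain w where w: "\<And>k. w \<in> closure (convex hull (v ` {k..}))" by blast
  have "norm (w - W w - u) \<le> e" if e: "0 < e" for e
  proof -
    obtain k where k: "\<And>n. n \<ge> k \<Longrightarrow> norm ((W ^^ n) u) < e"
      using W0[of u] e by (auto simp: LIMSEQ_iff)
    define Z where "Z = (\<lambda>x. x - W x) -` cball u e"
    have lin: "bounded_linear (\<lambda>x. x - W x)"
      using W by (intro bounded_linear_sub bounded_linear_ident) (simp add: bounded_clinear_def)
    have "closed Z"
      unfolding Z_def by (intro closed_vimage closed_cball linear_continuous_on lin)
    moreover have "convex Z"
      unfolding Z_def by (intro convex_linear_vimage convex_cball bounded_linear.linear lin)
    moreover have "v ` {k..} \<subseteq> Z"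
    proof clarify
      fix n assume "n \<ge> k"
      moreover have "v n - W (v n) - u = - (W ^^ n) u" using step[of n] diff[of n] by (simp add: algebra_simps)
      ultimately show "v n \<in> Z" using k[of n] by (simp add: Z_def dist_norm norm_minus_commute[of u])
    qed
    ultimately have "closure (convex hull (v ` {k..})) \<subseteq> Z"
      by (intro closure_minimal hull_minimal) auto
    then show ?thesis using w[of k] by (auto simp: Z_def dist_norm norm_minus_commute[of u])
  qed
  then have "norm (w - W w - u) \<le> 0" by (meson field_le_epsilon less_eq_real_def add_0 dense_ge)
  then have fix_w: "W w = w - u" by (simp add: algebra_simps)
  have "(W ^^ n) w = w - v n" for n
  proof (induction n)
    case (Suc n)
    have "(W ^^ Suc n) w = W (w - v n)" using Suc by simp
    then show ?case by (simp add: W_simps fix_w step)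
  qed (simp add: v0)
  then have "v = (\<lambda>n. w - (W ^^ n) w)" by (simp add: fun_eq_iff)
  then show ?thesis
    using tendsto_diff[OF tendsto_const W0[of w], of w] by (auto simp: convergent_def)
qed

text \<open>
\<open>T\<close> is the strong limit of \<open>a n = S'\<^sup>n A S\<^sup>n\<close>. The hypothesis also says that \<open>A S - S' A\<close> is unchanged by
\<open>X \<mapsto> S' X S\<close>, hence equals \<open>a n S - S' a n\<close> for all \<open>n\<close> and \<open>T S - S' T\<close> in the limit; this is
the Hankel relation for \<open>A - T\<close>.
\<close>
lemma toeplitz_hankel_decomposition:
  assumes A: "bounded_clinear A"
    and eq: "\<And>f. A (S f) + S' (S' (A (S f))) = S' (A f) + S' (A (S (S f)))"
  shows "\<exists>T H. bounded_clinear T \<and> bounded_clinear H \<and> (\<forall>f. A f = T f + H f)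
    \<and> (\<forall>f. S' (T (S f)) = T f) \<and> (\<forall>f. S' (H f) = H (S f))"
proof -
  note A_simps = bounded_clinear_add[OF A] bounded_clinear_diff[OF A] bounded_clinear_scaleC[OF A]
  note S_simps = bounded_clinear_add[OF S] bounded_clinear_diff[OF S] bounded_clinear_scaleC[OF S]
  note S'_simps = bounded_clinear_add[OF S'] bounded_clinear_diff[OF S'] bounded_clinear_scaleC[OF S']
  define a where "a n f = (S' ^^ n) (A ((S ^^ n) f))" for n f
  have S'n_add: "(S' ^^ n) (x + y) = (S' ^^ n) x + (S' ^^ n) y"
    and S'n_diff: "(S' ^^ n) (x - y) = (S' ^^ n) x - (S' ^^ n) y"
    and S'n_scaleC: "(S' ^^ n) (c *\<^sub>C x) = c *\<^sub>C (S' ^^ n) x" for n x y c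
    by (induction n) (simp_all add: S'_simps)
  have Sn_add: "(S ^^ n) (x + y) = (S ^^ n) x + (S ^^ n) y"
    and Sn_scaleC: "(S ^^ n) (c *\<^sub>C x) = c *\<^sub>C (S ^^ n) x" for n x y c
    by (induction n) (simp_all add: S_simps)
  have norm_Sn: "norm ((S ^^ n) x) = norm x" for n x by (induction n) simp_all
  have norm_S'n: "norm ((S' ^^ n) x) \<le> norm x" for n x
    by (induction n) (auto intro: order_trans[OF norm_S'])
  obtain c where c: "0 < c" "\<And>x. norm (A x) \<le> norm x * c"
    using A bounded_linear.pos_bounded unfolding bounded_clinear_def by blast
  have norm_a: "norm (a n f) \<le> norm f * c" for n f
    unfolding a_def using norm_S'n c(2)[of "(S ^^ n) f"] by (auto simp: norm_Sn intro: order_trans)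
  have a_add: "a n (f + g) = a n f + a n g" and a_scaleC: "a n (b *\<^sub>C f) = b *\<^sub>C a n f" for n f g b
    by (simp_all add: a_def Sn_add Sn_scaleC A_simps S'n_add S'n_scaleC)
  have a_Suc: "a (Suc n) f = S' (a n (S f))" for n f by (simp add: a_def funpow_swap1)
  define k where "k f = S' (A (S f)) - A f" for f
  have k_hankel: "S' (k f) = k (S f)" for f
    using eq[of f] by (simp add: k_def S'_simps algebra_simps)
  have a_diff: "a (Suc n) f - a n f = (S' ^^ (2 * n)) (k f)" for n f
  proof -
    have "k ((S ^^ n) f) = (S' ^^ n) (k f)" for n by (induction n) (simp_all flip: k_hankel)
    moreover have "a (Suc n) f - a n f = (S' ^^ n) (k ((S ^^ n) f))"
      by (simp add: a_def k_def S'n_diff funpow_swap1)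
    ultimately show ?thesis by (simp add: mult_2 funpow_add)
  qed
  have conv: "convergent (\<lambda>n. a n f)" for f
  proof -
    have "convergent (\<lambda>n. a n f - A f)"
    proof (rule ergodic_limit)
      show "a 0 f - A f = 0" by (simp add: a_def)
      show "norm (a n f - A f) \<le> norm f * c + norm f * c" for n
        using norm_triangle_ineq4[of "a n f" "A f"] norm_a[of n f] c(2)[of f] by linarith
      show "a (Suc n) f - A f = k f + S' (S' (a n f - A f))" for n
      proof (induction n)
        case 0
        show ?case by (simp add: a_def k_def bounded_clinear_zero[OF S'])
      next
        case (Suc n)
        have "S' (S' (a (Suc n) f - A f)) = S' (S' (a n f - A f)) + S' (S' (a (Suc n) f - a n f))"
          by (simp add: S'_simps)
        also have "S' (S' (a (Suc n) f - a n f)) = a (Suc (Suc n)) f - a (Suc n) f"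
          by (simp only: a_diff) simp
        also have "S' (S' (a n f - A f)) = a (Suc n) f - A f - k f" using Suc by simp
        finally show ?case by simp
      qed
    qed
    then show ?thesis using convergent_diff_const_right_iff by blast
  qed
  define T where "T f = lim (\<lambda>n. a n f)" for f
  have lim: "(\<lambda>n. a n f) \<longlonglongrightarrow> T f" for f
    using conv unfolding T_def by (simp add: convergent_LIMSEQ_iff)
  define H where "H = (\<lambda>f. A f - T f)"
  have limS': "(\<lambda>n. S' (a n f)) \<longlonglongrightarrow> S' (T f)" for f
    using bounded_linear.tendsto[OF bounded_clinear_imp_bounded_linear[OF S'] lim] .
  have T: "bounded_clinear T"
  proof (rule bounded_clinearI)
    show "T (f + g) = T f + T g" for f g
      by (rule LIMSEQ_unique[OF lim]) (auto simp: a_add intro: tendsto_add lim)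
    show "T (b *\<^sub>C f) = b *\<^sub>C T f" for b f
      by (rule LIMSEQ_unique[OF lim])
        (simp add: a_scaleC bounded_linear.tendsto[OF bounded_bilinear.bounded_linear_right[OF bounded_bilinear_scaleC] lim])
    show "norm (T f) \<le> norm f * c" for f
      by (rule LIMSEQ_le_const2[OF tendsto_norm[OF lim]]) (use norm_a in auto)
  qed
  have H: "bounded_clinear H"
    using A T bounded_linear_sub[of A T] by (auto simp: H_def bounded_clinear_def scaleC_diff_right)
  have T_toep: "S' (T (S f)) = T f" for f
    using LIMSEQ_unique[OF limS'[of "S f"]] LIMSEQ_Suc[OF lim[of f]] by (simp add: a_Suc)
  have B: "a n (S f) - S' (a n f) = A (S f) - S' (A f)" for n f
  proof (induction n arbitrary: f)
    case (Suc n)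
    have "a (Suc n) (S f) - S' (a (Suc n) f) = S' (a n (S (S f)) - S' (a n (S f)))"
      by (simp add: a_Suc S'_simps)
    also have "\<dots> = A (S f) - S' (A f)"
      using eq[of f] by (simp add: Suc S'_simps algebra_simps)
    finally show ?case .
  qed (simp add: a_def)
  have "T (S f) - S' (T f) = A (S f) - S' (A f)" for f
    using LIMSEQ_unique[OF tendsto_diff[OF lim[of "S f"] limS'[of f]]] by (simp add: B)
  then have "S' (H f) = H (S f)" for f by (simp add: H_def S'_simps algebra_simps)
  then show ?thesis using T H T_toep by (intro exI[of _ T] exI[of _ H]) (auto simp: H_def)
qed

end

section \<open>Completeness of the Lebesgue-Bochner space\<close>

lemma square_integrable_measurable: "square_integrable f \<Longrightarrow> f \<in> borel_measurable circle"
  by (simp add: square_integrable_def)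

lemma square_integrable_norm: "square_integrable f \<Longrightarrow> integrable circle (\<lambda>z. (norm (f z))\<^sup>2)"
  by (simp add: square_integrable_def)

text \<open>
On a probability space the \<open>L\<^sup>1\<close> norm is controlled by the \<open>L\<^sup>2\<close> norm, so the increments are summable
almost everywhere.
\<close>
lemma AE_convergent_of_summable_norms:
  fixes f :: "nat \<Rightarrow> complex \<Rightarrow> 'e::separable_complex_hilbert"
  assumes f: "\<And>n. square_integrable (f n)"
    and le: "\<And>n. (LINT z|circle. (norm (f (Suc n) z - f n z))\<^sup>2) \<le> (1/4)^n"
  shows "AE z in circle. convergent (\<lambda>n. f n z)"
proof -
  interpret finite_measure circle by (rule finite_measure_circle)
  have m [measurable]: "f n \<in> borel_measurable circle" for n using f by (rule square_integrable_measurable)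
  define h where "h n z = norm (f (Suc n) z - f n z)" for n z
  have [measurable]: "h n \<in> borel_measurable circle" for n unfolding h_def by measurable
  have i2: "integrable circle (\<lambda>z. (h n z)\<^sup>2)" for n
    unfolding h_def by (intro square_integrable_norm square_integrable_diff f)
  have mc: "measure circle (space circle) = 1"
    by (simp add: measure_def emeasure_circle_space)
  have nn: "(\<integral>\<^sup>+z. ennreal (h n z) \<partial>circle) \<le> ennreal (2 * (1/2)^n)" for n
  proof -
    \<comment> \<open>the weight matches the bound \<open>(1/4)\<^sup>n\<close> for the integral of the square\<close>
    have "h n z \<le> 2^n * (h n z)\<^sup>2 + (1/2)^n" for z
    proof -
      have "0 \<le> (2^n * h n z - 1/2)\<^sup>2 + 3/4" by simp
      also have "\<dots> = 2^n * (2^n * (h n z)\<^sup>2 - h n z) + 1"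
        by (simp add: power2_eq_square algebra_simps)
      finally have "0 \<le> (1/2)^n * (2^n * (2^n * (h n z)\<^sup>2 - h n z) + 1)" by simp
      also have "\<dots> = 2^n * (h n z)\<^sup>2 - h n z + (1/2)^n"
        by (simp add: algebra_simps power_one_over)
      finally show ?thesis by simp
    qed
    then have "(\<integral>\<^sup>+z. ennreal (h n z) \<partial>circle) \<le> (\<integral>\<^sup>+z. ennreal (2^n * (h n z)\<^sup>2 + (1/2)^n) \<partial>circle)"
      by (intro nn_integral_mono ennreal_leI)
    also have "\<dots> = ennreal (LINT z|circle. 2^n * (h n z)\<^sup>2 + (1/2)^n)"
      using i2 by (intro nn_integral_eq_integral) auto
    also have "(LINT z|circle. 2^n * (h n z)\<^sup>2 + (1/2)^n) = 2^n * (LINT z|circle. (h n z)\<^sup>2) + (1/2)^n"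
      using i2[of n] mc by simp
    also have "\<dots> \<le> 2^n * (1/4)^n + (1/2)^n"
      using le[of n] by (intro add_mono mult_left_mono) (auto simp: h_def)
    also have "(2::real)^n * (1/4)^n = (1/2)^n"
      by (simp flip: power_mult_distrib)
    finally show ?thesis by (simp add: ennreal_leI)
  qed
  have "(\<integral>\<^sup>+z. (\<Sum>n. ennreal (h n z)) \<partial>circle) = (\<Sum>n. \<integral>\<^sup>+z. ennreal (h n z) \<partial>circle)"
    by (rule nn_integral_suminf) measurable
  also have "\<dots> \<le> (\<Sum>n. ennreal (2 * (1/2)^n))"
    by (intro suminf_le nn) auto
  also have "\<dots> = ennreal (\<Sum>n. 2 * (1/2)^n)"
    by (intro suminf_ennreal_eq) (auto intro!: summable_mult summable_sums)
  also have "\<dots> < \<infinity>" by simp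
  finally have "AE z in circle. (\<Sum>n. ennreal (h n z)) \<noteq> \<infinity>"
    by (intro nn_integral_noteq_infinite) auto
  then show ?thesis
  proof eventually_elim
    case (elim z)
    have "summable (\<lambda>n. h n z)"
      using elim by (intro summable_suminf_not_top) (auto simp: h_def)
    then have "summable (\<lambda>n. f (Suc n) z - f n z)"
      unfolding h_def by (rule summable_norm_cancel)
    then have "convergent (\<lambda>N. \<Sum>n<N. (f (Suc n) z - f n z))"
      by (simp add: summable_iff_convergent)
    moreover have "(\<Sum>n<N. (f (Suc n) z - f n z)) = f N z - f 0 z" for N
      by (induction N) simp_all
    ultimately have "convergent (\<lambda>N. f N z - f 0 z)" by simp
    then show ?case using convergent_diff_const_right_iff by blast
  qed
qed

text \<open>
The limit of a rapidly converging subsequence exists almost everywhere, and by Fatou's lemma it is also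
the limit in norm of the whole sequence.
\<close>
lemma L2_complete_fun:
  fixes f :: "nat \<Rightarrow> complex \<Rightarrow> 'e::separable_complex_hilbert"
  assumes f: "\<And>n. square_integrable (f n)"
    and cauchy: "\<And>e. e > 0 \<Longrightarrow> \<exists>N. \<forall>m\<ge>N. \<forall>n\<ge>N. (LINT z|circle. (norm (f m z - f n z))\<^sup>2) \<le> e"
  shows "\<exists>g. square_integrable g \<and>
    (\<forall>e>0. \<exists>N. \<forall>n\<ge>N. (LINT z|circle. (norm (g z - f n z))\<^sup>2) \<le> e)"
proof -
  have m [measurable]: "f n \<in> borel_measurable circle" for n using f by (rule square_integrable_measurable)
  have "\<forall>k. \<exists>N. \<forall>m\<ge>N. \<forall>n\<ge>N. (LINT z|circle. (norm (f m z - f n z))\<^sup>2) \<le> (1/4)^k"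
    using cauchy by simp
  then obtain N where N: "\<And>k m n. m \<ge> N k \<Longrightarrow> n \<ge> N k \<Longrightarrow>
      (LINT z|circle. (norm (f m z - f n z))\<^sup>2) \<le> (1/4)^k"
    by metis
  define r where "r k = k + (\<Sum>i\<le>k. N i)" for k
  have rN: "N k \<le> r k" for k
    unfolding r_def using member_le_sum[of k "{..k}" N] by simp
  have rk: "k \<le> r k" for k unfolding r_def by simp
  have rSuc: "r k \<le> r (Suc k)" for k unfolding r_def by simp
  have conv: "AE z in circle. convergent (\<lambda>k. f (r k) z)"
    using AE_convergent_of_summable_norms[of "\<lambda>k. f (r k)"] N rN rSuc order_trans f by blast
  define g where "g z = lim (\<lambda>k. f (r k) z)" for z
  have [measurable]: "g \<in> borel_measurable circle"
    unfolding g_def by (rule borel_measurable_lim_metric) (rule m)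
  have fatou: "square_integrable (\<lambda>z. g z - f n z) \<and> (LINT z|circle. (norm (g z - f n z))\<^sup>2) \<le> e"
    if e: "0 < e" and M: "\<And>m. m \<ge> M \<Longrightarrow> (LINT z|circle. (norm (f m z - f n z))\<^sup>2) \<le> e" for n M e
  proof -
    have "AE z in circle. ennreal ((norm (g z - f n z))\<^sup>2) = liminf (\<lambda>k. ennreal ((norm (f (r k) z - f n z))\<^sup>2))"
      using conv
    proof eventually_elim
      case (elim z)
      then have "(\<lambda>k. f (r k) z) \<longlonglongrightarrow> g z" unfolding g_def by (simp add: convergent_LIMSEQ_iff)
      then have "(\<lambda>k. ennreal ((norm (f (r k) z - f n z))\<^sup>2)) \<longlonglongrightarrow> ennreal ((norm (g z - f n z))\<^sup>2)"
        by (intro tendsto_intros tendsto_ennrealI)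
      then show ?case using lim_imp_Liminf[OF sequentially_bot, of _ "ennreal ((norm (g z - f n z))\<^sup>2)"] by metis
    qed
    then have "(\<integral>\<^sup>+z. ennreal ((norm (g z - f n z))\<^sup>2) \<partial>circle)
        = (\<integral>\<^sup>+z. liminf (\<lambda>k. ennreal ((norm (f (r k) z - f n z))\<^sup>2)) \<partial>circle)"
      by (rule nn_integral_cong_AE)
    also have "\<dots> \<le> liminf (\<lambda>k. \<integral>\<^sup>+z. ennreal ((norm (f (r k) z - f n z))\<^sup>2) \<partial>circle)"
      by (rule nn_integral_liminf) measurable
    also have "\<dots> \<le> ennreal e"
    proof (rule Liminf_le)
      have "(\<integral>\<^sup>+z. ennreal ((norm (f (r k) z - f n z))\<^sup>2) \<partial>circle) \<le> ennreal e" if "k \<ge> M" for k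
      proof -
        have "(\<integral>\<^sup>+z. ennreal ((norm (f (r k) z - f n z))\<^sup>2) \<partial>circle)
            = ennreal (LINT z|circle. (norm (f (r k) z - f n z))\<^sup>2)"
          by (intro nn_integral_eq_integral square_integrable_norm square_integrable_diff f) auto
        then show ?thesis using M[of "r k"] rk[of k] that by (simp add: ennreal_leI)
      qed
      then show "\<forall>\<^sub>F k in sequentially. (\<integral>\<^sup>+z. ennreal ((norm (f (r k) z - f n z))\<^sup>2) \<partial>circle) \<le> ennreal e"
        by (auto simp: eventually_sequentially)
    qed simp
    finally have *: "(\<integral>\<^sup>+z. ennreal ((norm (g z - f n z))\<^sup>2) \<partial>circle) \<le> ennreal e" .
    then have int: "integrable circle (\<lambda>z. (norm (g z - f n z))\<^sup>2)"
      by (intro integrableI_nonneg) (auto intro: le_less_trans)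
    then have "ennreal (LINT z|circle. (norm (g z - f n z))\<^sup>2) \<le> ennreal e"
      using * by (subst (asm) nn_integral_eq_integral) auto
    then show ?thesis using int e by (auto simp: square_integrable_def)
  qed
  have ex: "\<exists>N. \<forall>n\<ge>N. square_integrable (\<lambda>z. g z - f n z) \<and> (LINT z|circle. (norm (g z - f n z))\<^sup>2) \<le> e"
    if "e > 0" for e
    using cauchy[OF that] fatou[OF that] by metis
  obtain n where "square_integrable (\<lambda>z. g z - f n z)" using ex[of 1] by auto
  from square_integrable_add[OF this f[of n]] have "square_integrable g" by simp
  then show ?thesis using ex by blast
qed

lemma square_integrable_rep: "square_integrable (rep_L2 f)"
  by (metis L2_rel_self Quotient_L2 Quotient_rep_reflp)

lemma abs_rep_L2 [simp]: "abs_L2 (rep_L2 f) = f"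
  by (rule Quotient_abs_rep[OF Quotient_L2])

lemma rep_abs_L2: "square_integrable g \<Longrightarrow> AE z in circle. rep_L2 (abs_L2 g) z = g z"
  using Quotient_rep_abs[OF Quotient_L2, of g] by (simp add: L2_rel_def)

lemma L2_cases [case_names abs]:
  obtains g where "f = abs_L2 g" "square_integrable g"
  using square_integrable_rep abs_rep_L2 by metis

lemma norm_abs_L2:
  assumes "square_integrable g"
  shows "(norm (abs_L2 g))\<^sup>2 = (LINT z|circle. (norm (g z))\<^sup>2)"
proof -
  have "cinner (abs_L2 g) (abs_L2 g) = (LINT z|circle. cinner (g z) (g z))"
    using assms by (simp add: cinner_L2.abs_eq L2_rel_self)
  also have "\<dots> = complex_of_real (LINT z|circle. (norm (g z))\<^sup>2)"
    by (simp add: cinner_self del: of_real_power)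
  finally show ?thesis by (metis cinner_self of_real_eq_iff)
qed

lemma diff_abs_L2:
  "square_integrable f \<Longrightarrow> square_integrable g \<Longrightarrow> abs_L2 f - abs_L2 g = abs_L2 (\<lambda>z. f z - g z)"
  by (simp add: minus_L2.abs_eq L2_rel_self)

instance L2 :: (separable_complex_hilbert) complete_space
proof
  fix X :: "nat \<Rightarrow> 'a L2"
  assume X: "Cauchy X"
  define f where "f n = rep_L2 (X n)" for n
  have f: "square_integrable (f n)" and Xf: "X n = abs_L2 (f n)" for n
    by (simp_all add: f_def square_integrable_rep)
  have "\<exists>g. square_integrable g \<and>
    (\<forall>e>0. \<exists>N. \<forall>n\<ge>N. (LINT z|circle. (norm (g z - f n z))\<^sup>2) \<le> e)"
  proof (rule L2_complete_fun[OF f])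
    fix e :: real assume "e > 0"
    then obtain N where N: "\<And>m n. m \<ge> N \<Longrightarrow> n \<ge> N \<Longrightarrow> norm (X m - X n) < sqrt e"
      using X unfolding Cauchy_def dist_norm by (metis real_sqrt_gt_zero)
    have "(norm (X m - X n))\<^sup>2 \<le> e" if "m \<ge> N" "n \<ge> N" for m n
      using N[OF that] \<open>e > 0\<close> by (metis less_imp_le norm_ge_zero power_mono real_sqrt_pow2)
    then show "\<exists>N. \<forall>m\<ge>N. \<forall>n\<ge>N. (LINT z|circle. (norm (f m z - f n z))\<^sup>2) \<le> e"
      using f by (auto simp: Xf diff_abs_L2 norm_abs_L2 square_integrable_diff)
  qed
  then obtain g where g: "square_integrable g"
    and lim: "\<And>e. e > 0 \<Longrightarrow> \<exists>N. \<forall>n\<ge>N. (LINT z|circle. (norm (g z - f n z))\<^sup>2) \<le> e"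
    by blast
  have "X \<longlonglongrightarrow> abs_L2 g"
  proof (rule metric_LIMSEQ_I)
    fix e :: real assume e: "e > 0"
    then obtain N where N: "\<And>n. n \<ge> N \<Longrightarrow> (LINT z|circle. (norm (g z - f n z))\<^sup>2) \<le> (e/2)\<^sup>2"
      using lim[of "(e/2)\<^sup>2"] by auto
    have "dist (X n) (abs_L2 g) < e" if "n \<ge> N" for n
    proof -
      have "(norm (abs_L2 g - X n))\<^sup>2 \<le> (e/2)\<^sup>2"
        unfolding Xf diff_abs_L2[OF g f] norm_abs_L2[OF square_integrable_diff[OF g f]]
        by (rule N[OF that])
      then have "norm (abs_L2 g - X n) \<le> e/2"
        by (rule power2_le_imp_le) (use e in simp)
      then show ?thesis using e by (simp add: dist_norm norm_minus_commute)
    qed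
    then show "\<exists>N. \<forall>n\<ge>N. dist (X n) (abs_L2 g) < e" by blast
  qed
  then show "convergent X" by (auto simp: convergent_def)
qed

section \<open>Testing the sign of a function with polynomials\<close>

text \<open>
Real trigonometric polynomials, with the negative powers collected in a denominator so that their sums
and products are computed with ordinary polynomials.
\<close>
definition trig_real :: "(complex \<Rightarrow> real) \<Rightarrow> bool"
  where "trig_real g \<longleftrightarrow> (\<exists>p n. \<forall>z\<in>sphere 0 1. complex_of_real (g z) = poly p z / z ^ n)"

lemma trig_real_dense:
  assumes "continuous_on (sphere 0 1) f" "0 < e"
  shows "\<exists>g. trig_real g \<and> (\<forall>z\<in>sphere 0 1. \<bar>f z - g z\<bar> < e)"
proof (rule Stone_Weierstrass_HOL[OF _ _ _ _ _ _ assms])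
  show "trig_real (\<lambda>_. c)" for c
    unfolding trig_real_def by (rule exI[of _ "[:of_real c:]"], rule exI[of _ 0]) simp
  show "continuous_on (sphere 0 1) g" if g: "trig_real g" for g
  proof -
    obtain p n where p: "\<And>z. z \<in> sphere 0 1 \<Longrightarrow> complex_of_real (g z) = poly p z / z ^ n"
      using g unfolding trig_real_def by blast
    have "continuous_on (sphere 0 1) (\<lambda>z. Re (poly p z / z ^ n))"
      by (intro continuous_intros) auto
    then show ?thesis
      by (rule continuous_on_eq) (simp add: p[symmetric])
  qed
  show "trig_real (\<lambda>z. f z + g z)" if fg: "trig_real f \<and> trig_real g" for f g
  proof -
    obtain p n q m where *: "\<And>z. z \<in> sphere 0 1 \<Longrightarrow> complex_of_real (f z) = poly p z / z ^ n"
      "\<And>z. z \<in> sphere 0 1 \<Longrightarrow> complex_of_real (g z) = poly q z / z ^ m"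
      using fg unfolding trig_real_def by blast
    show ?thesis unfolding trig_real_def
    proof (intro exI ballI)
      fix z :: complex assume z: "z \<in> sphere 0 1"
      then have "z \<noteq> 0" by auto
      then show "complex_of_real (f z + g z) = poly (p * monom 1 m + q * monom 1 n) z / z ^ (n + m)"
        using * z by (simp add: poly_monom power_add field_simps)
    qed
  qed
  show "trig_real (\<lambda>z. f z * g z)" if fg: "trig_real f \<and> trig_real g" for f g
  proof -
    obtain p n q m where *: "\<And>z. z \<in> sphere 0 1 \<Longrightarrow> complex_of_real (f z) = poly p z / z ^ n"
      "\<And>z. z \<in> sphere 0 1 \<Longrightarrow> complex_of_real (g z) = poly q z / z ^ m"
      using fg unfolding trig_real_def by blast
    show ?thesis unfolding trig_real_def
      by (rule exI[of _ "p * q"], rule exI[of _ "n + m"]) (simp add: * power_add)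
  qed
  have zz: "z * cnj z = 1" if "z \<in> sphere 0 1" for z
    using that by (simp add: flip: complex_norm_square)
  have Re: "trig_real Re" unfolding trig_real_def
  proof (rule exI[of _ "[:1/2, 0, 1/2:]"], rule exI[of _ 1], intro ballI)
    fix z :: complex assume z: "z \<in> sphere 0 1"
    then have nz: "z \<noteq> 0" by auto
    have "2 * (complex_of_real (Re z) * z) = z * z + z * cnj z"
      by (simp add: complex_eq_iff algebra_simps)
    then show "complex_of_real (Re z) = poly [:1/2, 0, 1/2:] z / z ^ 1"
      using nz by (simp add: zz[OF z] field_simps)
  qed
  have Im: "trig_real Im" unfolding trig_real_def
  proof (rule exI[of _ "[:\<i>/2, 0, -\<i>/2:]"], rule exI[of _ 1], intro ballI)
    fix z :: complex assume z: "z \<in> sphere 0 1"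
    then have nz: "z \<noteq> 0" by auto
    have "2 * (complex_of_real (Im z) * z) = \<i> * (z * cnj z - z * z)"
      by (simp add: complex_eq_iff algebra_simps)
    then show "complex_of_real (Im z) = poly [:\<i>/2, 0, -\<i>/2:] z / z ^ 1"
      using nz by (simp add: zz[OF z] field_simps)
  qed
  show "\<exists>f. trig_real f \<and> f x \<noteq> f y" if "x \<in> sphere 0 1 \<and> y \<in> sphere 0 1 \<and> x \<noteq> y" for x y
    using that Re Im by (metis complex_eqI)
qed simp

text \<open>
Continuous functions decrease to the indicator of a compact set, so the integral of \<open>h\<close> over each compact
set is at most \<open>0\<close>. If \<open>h\<close> were positive on a set of positive measure, inner regularity would give
a compact subset of positive measure, on which the integral is positive.
\<close>
lemma AE_nonpos_of_continuous:
  assumes h: "integrable circle h"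
    and le: "\<And>\<phi>. continuous_on (sphere 0 1) \<phi> \<Longrightarrow> (\<And>z. z \<in> sphere 0 1 \<Longrightarrow> 0 \<le> \<phi> z) \<Longrightarrow>
      (LINT z|circle. \<phi> z * h z) \<le> (0::real)"
  shows "AE z in circle. h z \<le> 0"
proof -
  have hm [measurable]: "h \<in> borel_measurable circle" using h by auto
  define A where "A = {z \<in> space circle. 0 < h z}"
  have A: "A \<in> sets circle" unfolding A_def by measurable
  define M where "M = distr circle borel (\<lambda>z. z)"
  have id: "(\<lambda>z. z) \<in> circle \<rightarrow>\<^sub>M borel"
    by (rule borel_measurable_circle_continuous) (rule continuous_on_id)
  have AB: "A \<in> sets borel" "A \<subseteq> sphere 0 1"
  proof -
    show "A \<subseteq> sphere 0 1" by (auto simp: A_def)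
    show "A \<in> sets borel" using A by (auto simp: sets_circle sets_restrict_space)
  qed
  have eM: "emeasure M B = emeasure circle B" if "B \<in> sets borel" "B \<subseteq> sphere 0 1" for B
    using that unfolding M_def by (subst emeasure_distr[OF id]) (auto simp: Int_absorb2)
  have K0: "emeasure M K = 0" if K: "K \<subseteq> A" "compact K" for K
  proof (cases "K = {}")
    case False
    have Kc: "K \<in> sets circle"
      using K AB by (auto simp: sets_circle sets_restrict_space compact_imp_closed intro!: image_eqI[of _ _ K])
    define \<phi> where "\<phi> n z = max 0 (1 - real n * infdist z K)" for n z
    have lim: "(\<lambda>n. \<phi> n z) \<longlonglongrightarrow> indicator K z" for z
    proof (cases "z \<in> K")
      case True
      then show ?thesis by (simp add: \<phi>_def)
    next
      case nK: False
      then have pos: "infdist z K > 0"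
        using in_closed_iff_infdist_zero[OF compact_imp_closed[OF K(2)] False] infdist_nonneg[of z K]
        by (simp add: less_le)
      obtain N where N: "1 / infdist z K < real N" using reals_Archimedean2 by blast
      have "\<phi> n z = 0" if "n \<ge> N" for n
      proof -
        have "1 / infdist z K < real n" using N that by linarith
        then show ?thesis using pos by (simp add: \<phi>_def field_simps)
      qed
      then have "eventually (\<lambda>n. \<phi> n z = indicator K z) sequentially"
        using nK by (auto simp: eventually_sequentially)
      then show ?thesis by (rule tendsto_eventually)
    qed
    have cont: "continuous_on (sphere 0 1) (\<phi> n)" for n
      unfolding \<phi>_def by (intro continuous_intros)
    have [measurable]: "\<phi> n \<in> borel_measurable circle" for n
      using cont by (rule borel_measurable_circle_continuous)
    have ind [measurable]: "indicator K \<in> borel_measurable circle" using Kc by simp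
    have "(\<lambda>n. LINT z|circle. \<phi> n z * h z) \<longlonglongrightarrow> (LINT z|circle. indicator K z * h z)"
    proof (rule integral_dominated_convergence[where w = "\<lambda>z. \<bar>h z\<bar>"])
      show "AE z in circle. (\<lambda>n. \<phi> n z * h z) \<longlonglongrightarrow> indicator K z * h z"
        by (intro AE_I2 tendsto_intros lim)
      show "AE z in circle. norm (\<phi> n z * h z) \<le> \<bar>h z\<bar>" for n
      proof (intro AE_I2)
        fix z
        have "\<bar>\<phi> n z\<bar> \<le> 1" using infdist_nonneg[of z K] by (simp add: \<phi>_def)
        then show "norm (\<phi> n z * h z) \<le> \<bar>h z\<bar>" by (simp add: abs_mult mult_left_le_one_le)
      qed
    qed (use h in auto)
    moreover have "(LINT z|circle. \<phi> n z * h z) \<le> 0" for n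
      by (rule le[OF cont]) (simp add: \<phi>_def)
    ultimately have le0: "(LINT z|circle. indicator K z * h z) \<le> 0" by (intro LIMSEQ_le_const2) auto
    have nn: "0 \<le> indicator K z * h z" for z using K(1) by (auto simp: indicator_def A_def)
    have int: "integrable circle (\<lambda>z. indicator K z * h z)"
      using integrable_mult_indicator[OF Kc h] by simp
    have "(LINT z|circle. indicator K z * h z) = 0"
      using le0 Bochner_Integration.integral_nonneg[of circle "\<lambda>z. indicator K z * h z"] nn by (simp add: antisym)
    then have "AE z in circle. indicator K z * h z = 0"
      using integral_nonneg_eq_0_iff_AE[OF int] nn by simp
    then have "AE z in circle. z \<notin> K"
    proof eventually_elim
      case (elim z)
      then show ?case using K(1) by (auto simp: indicator_def A_def split: if_splits)
    qed
    then have "emeasure circle K = 0"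
      using sets.sets_into_space[OF Kc] by (subst (asm) AE_iff_measurable[OF Kc]) auto
    then show ?thesis using K AB by (simp add: eM compact_imp_closed)
  qed simp
  have "emeasure M A = (SUP K \<in> {K. K \<subseteq> A \<and> compact K}. emeasure M K)"
  proof (rule inner_regular)
    have "emeasure M (space M) = emeasure circle (space circle)"
      unfolding M_def by (subst emeasure_distr[OF id]) auto
    then show "emeasure M (space M) \<noteq> \<infinity>" by (simp add: emeasure_circle_space)
  qed (auto simp: M_def AB)
  also have "\<dots> \<le> 0" by (rule SUP_least) (simp add: K0)
  finally have "emeasure circle A = 0" using AB by (simp add: eM)
  then show ?thesis
    using A by (subst AE_iff_measurable[of A]) (auto simp: A_def not_le)
qed

text \<open>
Approximate the square root of a nonnegative continuous function by a real trigonometric polynomial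
\<open>p z / z\<^sup>n\<close>; on the circle the square of the latter is the square of \<open>cmod (p z)\<close>, so testing with
analytic polynomials suffices.
\<close>
lemma AE_nonpos_of_poly:
  assumes h: "integrable circle h"
    and le: "\<And>p. (LINT z|circle. (cmod (poly p z))\<^sup>2 * h z) \<le> (0::real)"
  shows "AE z in circle. h z \<le> 0"
proof (rule AE_nonpos_of_continuous[OF h])
  fix \<phi> :: "complex \<Rightarrow> real"
  assume c: "continuous_on (sphere 0 1) \<phi>" and nn: "\<And>z. z \<in> sphere 0 1 \<Longrightarrow> 0 \<le> \<phi> z"
  have hm [measurable]: "h \<in> borel_measurable circle" using h by auto
  have [measurable]: "\<phi> \<in> borel_measurable circle" using c by (rule borel_measurable_circle_continuous)
  have cs: "continuous_on (sphere 0 1) (\<lambda>z. sqrt (\<phi> z))" using c by (intro continuous_intros)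
  have "\<forall>n. \<exists>g. trig_real g \<and> (\<forall>z\<in>sphere 0 1. \<bar>sqrt (\<phi> z) - g z\<bar> < inverse (Suc n))"
    by (intro allI trig_real_dense[OF cs]) simp
  then obtain g where g: "\<And>n. trig_real (g n)"
      "\<And>n z. z \<in> sphere 0 1 \<Longrightarrow> \<bar>sqrt (\<phi> z) - g n z\<bar> < inverse (Suc n)" by metis
  have "\<forall>n. \<exists>p. \<forall>z\<in>sphere 0 1. (g n z)\<^sup>2 = (cmod (poly p z))\<^sup>2"
  proof
    fix n
    obtain p m where p: "\<And>z. z \<in> sphere 0 1 \<Longrightarrow> complex_of_real (g n z) = poly p z / z ^ m"
      using g(1)[of n] unfolding trig_real_def by blast
    have "\<bar>g n z\<bar> = cmod (poly p z)" if "z \<in> sphere 0 1" for z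
    proof -
      have "\<bar>g n z\<bar> = cmod (complex_of_real (g n z))" by simp
      also have "\<dots> = cmod (poly p z)" using that by (simp add: p norm_divide norm_power del: norm_of_real)
      finally show ?thesis .
    qed
    then show "\<exists>p. \<forall>z\<in>sphere 0 1. (g n z)\<^sup>2 = (cmod (poly p z))\<^sup>2" by (metis power2_abs)
  qed
  then obtain p where p: "\<And>n z. z \<in> sphere 0 1 \<Longrightarrow> (cmod (poly (p n) z))\<^sup>2 = (g n z)\<^sup>2" by metis
  have "bounded ((\<lambda>z. sqrt (\<phi> z)) ` sphere 0 1)"
    by (intro compact_imp_bounded compact_continuous_image cs compact_sphere)
  then obtain B where "\<forall>x\<in>(\<lambda>z. sqrt (\<phi> z)) ` sphere 0 1. norm x \<le> B" unfolding bounded_iff by blast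
  then have B: "\<And>z. z \<in> sphere 0 1 \<Longrightarrow> \<bar>sqrt (\<phi> z)\<bar> \<le> B" by simp
  have mp [measurable]: "(\<lambda>z. (cmod (poly (p n) z))\<^sup>2) \<in> borel_measurable circle" for n
    by (intro borel_measurable_circle_continuous continuous_intros)
  have gb: "(cmod (poly (p n) z))\<^sup>2 \<le> (B + 1)\<^sup>2" if z: "z \<in> sphere 0 1" for n z
  proof -
    have "inverse (real (Suc n)) \<le> 1" by (simp add: divide_simps)
    then have "\<bar>g n z\<bar> \<le> B + 1" using g(2)[OF z, of n] B[OF z] by linarith
    then show ?thesis unfolding p[OF z] by (metis abs_ge_zero power2_abs power_mono)
  qed
  have "(\<lambda>n. LINT z|circle. (cmod (poly (p n) z))\<^sup>2 * h z) \<longlonglongrightarrow> (LINT z|circle. \<phi> z * h z)"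
  proof (rule integral_dominated_convergence[where w = "\<lambda>z. (B + 1)\<^sup>2 * \<bar>h z\<bar>"])
    show "AE z in circle. (\<lambda>n. (cmod (poly (p n) z))\<^sup>2 * h z) \<longlonglongrightarrow> \<phi> z * h z"
    proof (intro AE_I2)
      fix z assume "z \<in> space circle"
      then have z: "z \<in> sphere 0 1" by simp
      have "(\<lambda>n. sqrt (\<phi> z) - g n z) \<longlonglongrightarrow> 0"
        by (rule Lim_null_comparison[OF _ LIMSEQ_inverse_real_of_nat])
          (use g(2)[OF z] in \<open>auto intro!: always_eventually less_imp_le\<close>)
      then have "(\<lambda>n. sqrt (\<phi> z) - (sqrt (\<phi> z) - g n z)) \<longlonglongrightarrow> sqrt (\<phi> z) - 0"
        by (intro tendsto_diff tendsto_const)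
      then have "(\<lambda>n. (g n z)\<^sup>2 * h z) \<longlonglongrightarrow> (sqrt (\<phi> z))\<^sup>2 * h z"
        by (intro tendsto_intros) simp
      then show "(\<lambda>n. (cmod (poly (p n) z))\<^sup>2 * h z) \<longlonglongrightarrow> \<phi> z * h z"
        using nn[OF z] by (simp add: p[OF z])
    qed
    show "AE z in circle. norm ((cmod (poly (p n) z))\<^sup>2 * h z) \<le> (B + 1)\<^sup>2 * \<bar>h z\<bar>" for n
      by (intro AE_I2) (simp add: abs_mult gb mult_right_mono)
  qed (use h in auto)
  then show "(LINT z|circle. \<phi> z * h z) \<le> 0"
    using le by (intro LIMSEQ_le_const2) auto
qed

section \<open>Fourier series in the Lebesgue-Bochner space\<close>

lemma measurable_zpow [measurable]: "(\<lambda>z::complex. z powi n) \<in> borel_measurable circle"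
  by (rule borel_measurable_circle_continuous) (auto intro!: continuous_intros)

lemma square_integrable_zpow:
  assumes "square_integrable f"
  shows "square_integrable (\<lambda>z. z powi k *\<^sub>C f z)"
proof (rule square_integrable_bounded_pointwise[OF assms, where M = 1])
  have [measurable]: "f \<in> borel_measurable circle"
    using assms by (rule square_integrable_measurable)
  show "(\<lambda>z. z powi k *\<^sub>C f z) \<in> borel_measurable circle"
    by (intro borel_measurable_bilinear[OF bounded_bilinear_scaleC]) measurable
  show "AE z in circle. norm (z powi k *\<^sub>C f z) \<le> 1 * norm (f z)"
    by (intro AE_I2) (simp add: norm_scaleC norm_power_int)
qed

lemma square_integrable_const: "square_integrable (\<lambda>_. x)"
proof -
  interpret finite_measure circle by (rule finite_measure_circle)
  show ?thesis by (simp add: square_integrable_def)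
qed

lift_definition zmul :: "int \<Rightarrow> 'e::separable_complex_hilbert L2 \<Rightarrow> 'e L2"
  is "\<lambda>k f z. z powi k *\<^sub>C f z"
  by (auto simp: L2_rel_def square_integrable_zpow)

lift_definition zmono :: "int \<Rightarrow> 'e::separable_complex_hilbert \<Rightarrow> 'e L2"
  is "\<lambda>k x z. z powi k *\<^sub>C x"
  by (auto simp: L2_rel_def square_integrable_zpow square_integrable_const)

lemma zmul_abs: "square_integrable f \<Longrightarrow> zmul k (abs_L2 f) = abs_L2 (\<lambda>z. z powi k *\<^sub>C f z)"
  by (simp add: zmul.abs_eq L2_rel_self)

lemma fourier_abs:
  "square_integrable f \<Longrightarrow> fourier (abs_L2 f) n = (LINT z|circle. z powi (- n) *\<^sub>C f z)"
  by (simp add: fourier.abs_eq L2_rel_self)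

lemma zpow_add_scaleC:
  "z \<in> sphere 0 1 \<Longrightarrow> z powi k *\<^sub>C z powi l *\<^sub>C x = z powi (k + l) *\<^sub>C (x :: 'a::complex_inner)"
  by (cases "z = 0") (simp_all add: scaleC_scaleC power_int_add)

lemma abs_L2_cong:
  assumes "\<And>z. z \<in> sphere 0 1 \<Longrightarrow> f z = g z" "square_integrable f" "square_integrable g"
  shows "abs_L2 f = abs_L2 g"
  using assms by (intro Quotient_rel_abs[OF Quotient_L2]) (auto simp: L2_rel_def intro: AE_I2)

lemma zmul_mono: "zmul k (zmono l x) = zmono (k + l) x"
  by (simp add: zmono_def zmul_abs square_integrable_zpow square_integrable_const, rule abs_L2_cong,
      auto simp: zpow_add_scaleC square_integrable_zpow square_integrable_const)

lemma fourier_zmul: "fourier (zmul k f) n = fourier f (n - k)"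
proof (cases f rule: L2_cases)
  case (abs g)
  have "(LINT z|circle. z powi (- n) *\<^sub>C z powi k *\<^sub>C g z) = (LINT z|circle. z powi (- (n - k)) *\<^sub>C g z)"
    by (intro Bochner_Integration.integral_cong) (auto simp: zpow_add_scaleC)
  then show ?thesis using abs by (simp add: zmul_abs fourier_abs square_integrable_zpow)
qed

lemma norm_zmul [simp]: "norm (zmul k f) = norm f"
proof (cases f rule: L2_cases)
  case (abs g)
  have "(LINT z|circle. (norm (z powi k *\<^sub>C g z))\<^sup>2) = (LINT z|circle. (norm (g z))\<^sup>2)"
    by (intro Bochner_Integration.integral_cong) (auto simp: norm_scaleC norm_power_int)
  then have "(norm (zmul k f))\<^sup>2 = (norm f)\<^sup>2"
    using abs by (simp add: zmul_abs norm_abs_L2 square_integrable_zpow)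
  then show ?thesis by simp
qed

lemma bounded_clinear_zmul: "bounded_clinear (zmul k)"
proof (rule bounded_clinearI)
  show "zmul k (f + g) = zmul k f + zmul k g" for f g :: "'a L2"
    by transfer (auto simp: L2_rel_def scaleC_add_right square_integrable_zpow square_integrable_add)
  show "zmul k (c *\<^sub>C f) = c *\<^sub>C zmul k f" for c and f :: "'a L2"
  proof (cases f rule: L2_cases)
    case (abs g)
    then show ?thesis
      by (simp add: zmul_abs scaleC_L2.abs_eq L2_rel_self square_integrable_zpow square_integrable_scaleC)
        (simp add: scaleC_scaleC mult.commute)
  qed
  show "norm (zmul k f) \<le> norm f * 1" for f :: "'a L2" by simp
qed

lemma integral_circle_zpow: "(LINT z|circle. z powi n) = (if n = 0 then 1 else 0)"
proof (cases "n = 0")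
  case True
  then show ?thesis by (simp add: measure_def emeasure_circle_space)
next
  case False
  define F where "F t = cis (of_int n * t) / (\<i> * of_int n)" for t :: real
  have "(LINT z|circle. z powi n) = (LINT t|uniform_measure lborel {0..2*pi}. cis t powi n)"
    unfolding circle_def
  proof (subst integral_distr)
    show "cis \<in> uniform_measure lborel {0..2 * pi} \<rightarrow>\<^sub>M restrict_space borel (sphere 0 1)"
      by (rule measurable_cis_sphere)
    show "(\<lambda>z::complex. z powi n) \<in> borel_measurable (restrict_space borel (sphere 0 1))"
      using measurable_zpow[of n] by (simp add: measurable_cong_sets[OF sets_circle refl])
  qed simp
  also have "\<dots> = (LINT t|density lborel (\<lambda>t. ennreal (indicator {0..2*pi} t / (2*pi))). cis t powi n)"
  proof -
    have "indicator {0..2*pi} t / emeasure lborel {0..2*pi} = ennreal (indicator {0..2*pi} t / (2*pi))"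
      for t :: real
      by (auto simp: indicator_def divide_ennreal[symmetric] ennreal_1)
    then show ?thesis by (simp add: uniform_measure_def)
  qed
  also have "\<dots> = (LINT t|lborel. (indicator {0..2*pi} t / (2*pi)) *\<^sub>R (cis t powi n))"
    by (subst integral_density) (auto simp: cis_power_int intro!: borel_measurable_continuous_onI continuous_intros)
  also have "\<dots> = (LINT t|lborel. (1 / (2*pi)) *\<^sub>R (indicator {0..2*pi} t *\<^sub>R cis (of_int n * t)))"
    by (intro Bochner_Integration.integral_cong) (simp_all add: cis_power_int)
  also have "\<dots> = (1 / (2*pi)) *\<^sub>R (LINT t|lborel. indicator {0..2*pi} t *\<^sub>R cis (of_int n * t))"
    by (rule integral_scaleR_right)
  also have "(LINT t|lborel. indicator {0..2*pi} t *\<^sub>R cis (of_int n * t)) = F (2*pi) - F 0"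
  proof (rule integral_FTC_Icc)
    fix t :: real
    have "((\<lambda>t. cis (of_int n * t)) has_vector_derivative (of_int n * (\<i> * cis (of_int n * t)))) (at t within {0..2*pi})"
      unfolding has_vector_derivative_def
      by (auto intro!: derivative_eq_intros simp: scaleR_conv_of_real algebra_simps)
    then have "((\<lambda>t. cis (of_int n * t) / (\<i> * of_int n)) has_vector_derivative
        (of_int n * (\<i> * cis (of_int n * t))) / (\<i> * of_int n)) (at t within {0..2*pi})"
      by (rule has_vector_derivative_divide)
    then show "(F has_vector_derivative cis (of_int n * t)) (at t within {0..2*pi})"
      using False by (simp add: F_def[abs_def])
  qed (auto intro!: continuous_intros)
  also have "F (2*pi) - F 0 = 0"
  proof -
    have "cis (of_int n * (2*pi)) = 1" using cis_multiple_2pi[of "of_int n"] by (simp add: mult.commute)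
    then show ?thesis by (simp add: F_def)
  qed
  finally show ?thesis using False by simp
qed

lemma fourier_mono: "fourier (zmono k x) n = (if n = k then x else 0)"
proof -
  interpret finite_measure circle by (rule finite_measure_circle)
  have int: "integrable circle (\<lambda>z. z powi m)" for m
    by (rule integrable_const_bound[where B = 1]) (auto simp: norm_power_int intro: AE_I2)
  have "fourier (zmono k x) n = (LINT z|circle. z powi (- n) *\<^sub>C z powi k *\<^sub>C x)"
    by (simp add: zmono_def fourier_abs square_integrable_zpow square_integrable_const)
  also have "\<dots> = (LINT z|circle. z powi (k - n) *\<^sub>C x)"
    by (intro Bochner_Integration.integral_cong) (auto simp: zpow_add_scaleC)
  also have "\<dots> = (LINT z|circle. z powi (k - n)) *\<^sub>C x"
    by (rule integral_bounded_linear[OF _ int])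
      (rule bounded_bilinear.bounded_linear_left[OF bounded_bilinear_scaleC])
  finally show ?thesis by (auto simp: integral_circle_zpow)
qed

lemma cnj_zpow: "z \<in> sphere 0 1 \<Longrightarrow> cnj z powi k = z powi (- k)"
proof -
  assume "z \<in> sphere 0 1"
  then have "z * cnj z = 1" by (simp flip: complex_norm_square)
  then have "cnj z = inverse z" by (metis inverse_unique)
  then show ?thesis by (simp add: power_int_inverse power_int_minus)
qed

lemma cinner_mono: "cinner f (zmono k y) = cinner (fourier f k) y"
proof (cases f rule: L2_cases)
  case (abs g)
  have "cinner f (zmono k y) = (LINT z|circle. cinner (g z) (z powi k *\<^sub>C y))"
    using abs by (simp add: zmono_def cinner_L2.abs_eq L2_rel_self square_integrable_zpow square_integrable_const)
  also have "\<dots> = (LINT z|circle. cinner (z powi (- k) *\<^sub>C g z) y)"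
    by (intro Bochner_Integration.integral_cong) (auto simp: cinner_scaleC_left cinner_scaleC_right cnj_zpow)
  also have "\<dots> = cinner (LINT z|circle. z powi (- k) *\<^sub>C g z) y"
    by (rule integral_bounded_linear)
      (auto intro: bounded_bilinear.bounded_linear_left[OF bounded_bilinear_cinner] integrable_fourier abs)
  finally show ?thesis using abs by (simp add: fourier_abs)
qed

lemma cmod_poly_sq:
  assumes "z \<in> sphere 0 1"
  shows "complex_of_real ((cmod (poly p z))\<^sup>2)
    = (\<Sum>i\<le>degree p. \<Sum>j\<le>degree p. coeff p i * cnj (coeff p j) * z powi (int i - int j))"
proof -
  have "complex_of_real ((cmod (poly p z))\<^sup>2) = poly p z * cnj (poly p z)"
    by (rule complex_norm_square)
  also have "\<dots> = (\<Sum>i\<le>degree p. coeff p i * z ^ i) * (\<Sum>j\<le>degree p. cnj (coeff p j) * cnj (z ^ j))"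
    by (simp add: poly_altdef)
  also have "\<dots> = (\<Sum>i\<le>degree p. \<Sum>j\<le>degree p. (coeff p i * z ^ i) * (cnj (coeff p j) * cnj (z ^ j)))"
    by (rule sum_product)
  also have "\<dots> = (\<Sum>i\<le>degree p. \<Sum>j\<le>degree p. coeff p i * cnj (coeff p j) * z powi (int i - int j))"
  proof (intro sum.cong refl)
    fix i j
    have "z \<noteq> 0" using assms by auto
    then have "z powi (int i - int j) = z ^ i * z powi (- int j)"
      using power_int_add[of z "int i" "- int j"] by simp
    then show "(coeff p i * z ^ i) * (cnj (coeff p j) * cnj (z ^ j))
        = coeff p i * cnj (coeff p j) * z powi (int i - int j)"
      using cnj_zpow[OF assms, of "int j"] by simp
  qed
  finally show ?thesis .
qed

lemma countable_dense_zero: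
  fixes v :: "'e::separable_complex_hilbert"
  assumes D: "\<And>U. open U \<Longrightarrow> U \<noteq> {} \<Longrightarrow> \<exists>d\<in>D. d \<in> U" and le: "\<And>d. d \<in> D \<Longrightarrow> inner v d \<le> 0"
  shows "v = 0"
proof -
  have "(norm v)\<^sup>2 \<le> norm v * e" if "0 < e" for e
  proof -
    have "\<exists>d\<in>D. d \<in> ball v e" using that by (intro D) auto
    then obtain d where d: "d \<in> D" "dist v d < e" by auto
    have "(norm v)\<^sup>2 = inner v (v - d) + inner v d" by (simp add: power2_norm_eq_inner inner_diff_right)
    also have "\<dots> \<le> norm v * norm (v - d) + 0"
      by (intro add_mono norm_cauchy_schwarz le d)
    also have "\<dots> \<le> norm v * e" using d by (simp add: dist_norm mult_left_mono)
    finally show ?thesis .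
  qed
  then have "norm v \<le> e" if "0 < e" for e
    using that by (cases "v = 0") (auto simp: power2_eq_square)
  then show ?thesis by (metis field_le_epsilon add_0 norm_le_zero_iff)
qed

text \<open>
For a fixed vector \<open>y\<close>, the integral of \<open>cmod (p z)\<^sup>2 * inner (f z) y\<close> is a combination of Fourier coefficients, hence
\<open>0\<close>. So \<open>inner (f z) y \<le> 0\<close> almost everywhere, simultaneously for all \<open>y\<close> of a countable dense set.
\<close>
lemma fourier_eq_0_imp_eq_0:
  fixes f :: "'e::separable_complex_hilbert L2"
  assumes f: "\<And>n. fourier f n = 0"
  shows "f = 0"
proof (cases f rule: L2_cases)
  case (abs g)
  have zero: "(LINT z|circle. z powi n *\<^sub>C g z) = 0" for n
    using f[of "- n"] abs by (simp add: fourier_abs)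
  have le: "AE z in circle. inner (g z) y \<le> 0" for y
  proof (rule AE_nonpos_of_poly)
    show "integrable circle (\<lambda>z. inner (g z) y)"
      by (rule integrable_inner[OF abs(2) square_integrable_const])
    fix p
    have int: "integrable circle (\<lambda>z. cinner (z powi n *\<^sub>C g z) y)" for n
      by (rule integrable_cinner[OF square_integrable_zpow[OF abs(2)] square_integrable_const])
    have "(LINT z|circle. (cmod (poly p z))\<^sup>2 * inner (g z) y)
        = (LINT z|circle. Re (\<Sum>i\<le>degree p. \<Sum>j\<le>degree p.
            coeff p i * cnj (coeff p j) * cinner (z powi (int i - int j) *\<^sub>C g z) y))"
    proof (intro Bochner_Integration.integral_cong refl)
      fix z assume "z \<in> space circle"
      then have z: "z \<in> sphere 0 1" by simp
      have "(cmod (poly p z))\<^sup>2 * inner (g z) y = Re (complex_of_real ((cmod (poly p z))\<^sup>2) * cinner (g z) y)"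
        by (simp add: Re_cinner del: of_real_power)
      also have "\<dots> = Re (\<Sum>i\<le>degree p. \<Sum>j\<le>degree p.
            coeff p i * cnj (coeff p j) * cinner (z powi (int i - int j) *\<^sub>C g z) y)"
        unfolding cmod_poly_sq[OF z] by (simp only: sum_distrib_right cinner_scaleC_left mult.assoc)
      finally show "(cmod (poly p z))\<^sup>2 * inner (g z) y = Re (\<Sum>i\<le>degree p. \<Sum>j\<le>degree p.
            coeff p i * cnj (coeff p j) * cinner (z powi (int i - int j) *\<^sub>C g z) y)" .
    qed
    also have "\<dots> = Re (LINT z|circle. (\<Sum>i\<le>degree p. \<Sum>j\<le>degree p.
            coeff p i * cnj (coeff p j) * cinner (z powi (int i - int j) *\<^sub>C g z) y))"
      by (intro integral_Re Bochner_Integration.integrable_sum integrable_mult_right int)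
    also have "\<dots> = Re (\<Sum>i\<le>degree p. \<Sum>j\<le>degree p.
            coeff p i * cnj (coeff p j) * (LINT z|circle. cinner (z powi (int i - int j) *\<^sub>C g z) y))"
      by (simp add: Bochner_Integration.integral_sum Bochner_Integration.integrable_sum int)
    also have "\<dots> = 0"
    proof -
      have "(LINT z|circle. cinner (z powi n *\<^sub>C g z) y) = cinner (LINT z|circle. z powi n *\<^sub>C g z) y" for n
        by (rule integral_bounded_linear)
          (auto intro: bounded_bilinear.bounded_linear_left[OF bounded_bilinear_cinner] integrable_fourier abs)
      then show ?thesis by (simp add: zero)
    qed
    finally show "(LINT z|circle. (cmod (poly p z))\<^sup>2 * inner (g z) y) \<le> 0" by simp
  qed
  obtain D :: "'e set" where D: "countable D" "\<And>U. open U \<Longrightarrow> U \<noteq> {} \<Longrightarrow> \<exists>d\<in>D. d \<in> U"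
    using countable_dense_exists by metis
  have "AE z in circle. \<forall>d\<in>D. inner (g z) d \<le> 0"
    using le D(1) by (simp add: AE_ball_countable)
  then have "AE z in circle. g z = 0"
    by eventually_elim (rule countable_dense_zero[OF D(2)], auto)
  then have "abs_L2 g = abs_L2 (\<lambda>_. 0)"
    using abs by (intro Quotient_rel_abs[OF Quotient_L2]) (auto simp: L2_rel_def)
  then show ?thesis using abs by (simp add: zero_L2_def)
qed

lemma fourier_eqI: "(\<And>n. fourier f n = fourier g n) \<Longrightarrow> f = g"
  using fourier_eq_0_imp_eq_0[of "f - g"] by (simp add: fourier_diff)

lemma norm_zmono [simp]: "norm (zmono k x) = norm x"
proof -
  have "cinner (zmono k x) (zmono k x) = cinner x x" by (simp add: cinner_mono fourier_mono)
  then have "(norm (zmono k x))\<^sup>2 = (norm x)\<^sup>2" by (metis cinner_self of_real_eq_iff)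
  then show ?thesis by simp
qed

lemma norm_fourier_le: "norm (fourier f n) \<le> norm f"
proof -
  have "complex_of_real ((norm (fourier f n))\<^sup>2) = cinner f (zmono n (fourier f n))"
    by (simp add: cinner_mono cinner_self)
  then have "(norm (fourier f n))\<^sup>2 \<le> norm f * norm (fourier f n)"
    using norm_cinner_le[of f "zmono n (fourier f n)"] by (metis norm_of_real abs_power2 power2_abs norm_zmono real_norm_def abs_of_nonneg zero_le_power2)
  then show ?thesis by (cases "fourier f n = 0") (auto simp: power2_eq_square)
qed

lemma bounded_clinear_fourier: "bounded_clinear (\<lambda>f. fourier f n)"
  by (rule bounded_clinearI[where K = 1]) (simp_all add: fourier_add fourier_scaleC norm_fourier_le)

lemma fourier_sum: "fourier (sum f A) n = (\<Sum>i\<in>A. fourier (f i) n)"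
  by (rule bounded_clinear_sum[OF bounded_clinear_fourier])

lemma tendsto_fourier: "X \<longlonglongrightarrow> f \<Longrightarrow> (\<lambda>N. fourier (X N) n) \<longlonglongrightarrow> fourier f n"
  by (rule bounded_linear.tendsto[OF bounded_clinear_imp_bounded_linear[OF bounded_clinear_fourier]])

lemma fourier_sum_zmono:
  "finite A \<Longrightarrow> fourier (\<Sum>k\<in>A. zmono k (a k)) n = (if n \<in> A then a n else 0)"
  by (simp add: fourier_sum fourier_mono)

lemma norm_sum_zmono:
  assumes "finite A"
  shows "(norm (\<Sum>k\<in>A. zmono k (a k)))\<^sup>2 = (\<Sum>k\<in>A. (norm (a k))\<^sup>2)"
proof -
  define s where "s = (\<Sum>k\<in>A. zmono k (a k))"
  have "cinner s s = (\<Sum>k\<in>A. cinner (fourier s k) (a k))"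
    by (subst (2) s_def) (simp add: cinner_sum_right cinner_mono)
  also have "\<dots> = (\<Sum>k\<in>A. cinner (a k) (a k))"
    using assms by (intro sum.cong) (simp_all add: s_def fourier_sum_zmono)
  also have "\<dots> = complex_of_real (\<Sum>k\<in>A. (norm (a k))\<^sup>2)" by (simp add: cinner_self)
  finally show ?thesis by (metis cinner_self of_real_eq_iff s_def)
qed

lemma Bessel:
  assumes "finite A"
  shows "(\<Sum>k\<in>A. (norm (fourier f k))\<^sup>2) \<le> (norm f)\<^sup>2"
proof -
  define s where "s = (\<Sum>k\<in>A. zmono k (fourier f k))"
  have "cinner f s = complex_of_real (\<Sum>k\<in>A. (norm (fourier f k))\<^sup>2)"
    by (simp add: s_def cinner_sum_right cinner_mono cinner_self)
  then have "inner f s = (\<Sum>k\<in>A. (norm (fourier f k))\<^sup>2)" by (metis Re_cinner Re_complex_of_real)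
  moreover have "inner s s = (\<Sum>k\<in>A. (norm (fourier f k))\<^sup>2)"
    using norm_sum_zmono[OF assms, of "fourier f"] by (simp add: s_def power2_norm_eq_inner)
  moreover have "0 \<le> inner (f - s) (f - s)" by simp
  ultimately show ?thesis
    by (simp add: inner_diff inner_commute power2_norm_eq_inner)
qed

lemma Riesz_Fischer:
  assumes K: "\<And>N. (\<Sum>k\<in>{-int N..int N}. (norm (a k))\<^sup>2) \<le> K"
  shows "\<exists>f. (\<forall>k. fourier f k = a k) \<and> (norm f)\<^sup>2 \<le> K
    \<and> (\<lambda>N. \<Sum>k\<in>{-int N..int N}. zmono k (a k)) \<longlonglongrightarrow> f"
proof -
  define b where "b N = (\<Sum>k\<in>{-int N..int N}. (norm (a k))\<^sup>2)" for N
  define s where "s N = (\<Sum>k\<in>{-int N..int N}. zmono k (a k))" for N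
  have diff: "(norm (s M - s N))\<^sup>2 = b M - b N" if "N \<le> M" for M N
  proof -
    have sub: "{-int N..int N} \<subseteq> {-int M..int M}" using that by auto
    have "s M - s N = (\<Sum>k\<in>{-int M..int M} - {-int N..int N}. zmono k (a k))"
      unfolding s_def by (subst sum_diff[OF _ sub]) auto
    then have "(norm (s M - s N))\<^sup>2 = (\<Sum>k\<in>{-int M..int M} - {-int N..int N}. (norm (a k))\<^sup>2)"
      by (simp add: norm_sum_zmono)
    also have "\<dots> = b M - b N" unfolding b_def by (subst sum_diff[OF _ sub]) auto
    finally show ?thesis .
  qed
  have "incseq b"
  proof (rule incseq_SucI)
    show "b n \<le> b (Suc n)" for n using diff[of n "Suc n"] by (metis diff_ge_0_iff_ge le_SucI order_refl zero_le_power2)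
  qed
  then obtain L where L: "b \<longlonglongrightarrow> L" using incseq_convergent[of b K] K unfolding b_def by metis
  then have cb: "Cauchy b" by (rule LIMSEQ_imp_Cauchy)
  have "Cauchy s"
  proof (rule metric_CauchyI)
    fix e :: real assume e: "e > 0"
    then have "0 < e\<^sup>2" by simp
    then obtain N where N: "\<And>m n. m \<ge> N \<Longrightarrow> n \<ge> N \<Longrightarrow> \<bar>b m - b n\<bar> < e\<^sup>2"
      using cb unfolding Cauchy_def dist_real_def by blast
    have main: "norm (s m - s n) < e" if "n \<le> m" "n \<ge> N" for m n
    proof (rule power2_less_imp_less)
      show "(norm (s m - s n))\<^sup>2 < e\<^sup>2" using diff[OF that(1)] N[of m n] that by simp
    qed (use e in simp)
    show "\<exists>M. \<forall>m\<ge>M. \<forall>n\<ge>M. dist (s m) (s n) < e"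
    proof (intro exI allI impI)
      fix m n assume "m \<ge> N" "n \<ge> N"
      then show "dist (s m) (s n) < e"
        using main[of n m] main[of m n] by (cases "n \<le> m") (auto simp: dist_norm norm_minus_commute)
    qed
  qed
  then obtain f where f: "s \<longlonglongrightarrow> f" using Cauchy_convergent unfolding convergent_def by blast
  have "fourier f k = a k" for k
  proof -
    have "eventually (\<lambda>N. fourier (s N) k = a k) sequentially"
      unfolding eventually_sequentially
      by (rule exI[of _ "nat \<bar>k\<bar>"]) (auto simp: s_def fourier_sum_zmono)
    then have "(\<lambda>N. fourier (s N) k) \<longlonglongrightarrow> a k" by (rule tendsto_eventually)
    then show ?thesis using tendsto_fourier[OF f, of k] LIMSEQ_unique by blast
  qed
  moreover have "(norm f)\<^sup>2 \<le> K"
    by (rule LIMSEQ_le_const2[OF tendsto_power[OF tendsto_norm[OF f]]])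
      (use K in \<open>auto simp: s_def norm_sum_zmono\<close>)
  ultimately show ?thesis using f unfolding s_def by blast
qed

lemma fourier_series_LIMSEQ: "(\<lambda>N. \<Sum>k\<in>{-int N..int N}. zmono k (fourier f k)) \<longlonglongrightarrow> f"
proof -
  obtain g where "\<And>k. fourier g k = fourier f k"
    "(\<lambda>N. \<Sum>k\<in>{-int N..int N}. zmono k (fourier f k)) \<longlonglongrightarrow> g"
    using Riesz_Fischer[of "fourier f" "(norm f)\<^sup>2"] Bessel by blast
  then show ?thesis using fourier_eqI by blast
qed

lemma norm_L2_le:
  assumes "\<And>N. (\<Sum>k\<in>{-int N..int N}. (norm (fourier f k))\<^sup>2) \<le> K"
  shows "(norm f)\<^sup>2 \<le> K"
  by (rule LIMSEQ_le_const2[OF tendsto_power[OF tendsto_norm[OF fourier_series_LIMSEQ]]])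
    (use assms in \<open>auto simp: norm_sum_zmono\<close>)

lemma cinner_eq_0_of_fourier:
  assumes "\<And>k. fourier f k = 0 \<or> fourier g k = 0"
  shows "cinner f g = 0"
proof -
  have "(\<lambda>N. cinner f (\<Sum>k\<in>{-int N..int N}. zmono k (fourier g k))) \<longlonglongrightarrow> cinner f g"
    by (intro bounded_bilinear.tendsto[OF bounded_bilinear_cinner] tendsto_const fourier_series_LIMSEQ)
  moreover have "cinner f (\<Sum>k\<in>{-int N..int N}. zmono k (fourier g k)) = 0" for N
  proof -
    have "cinner (fourier f k) (fourier g k) = 0" for k using assms[of k] by auto
    then show ?thesis by (simp add: cinner_sum_right cinner_mono)
  qed
  ultimately show ?thesis by (simp add: LIMSEQ_const_iff)
qed

section \<open>The Hardy space and the shift\<close>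

definition hcoef :: "'e::separable_complex_hilbert hardy \<Rightarrow> nat \<Rightarrow> 'e"
  where "hcoef f n = fourier (Rep_hardy f) (int n)"

lemma fourier_Rep_hardy: "fourier (Rep_hardy f) k = (if k < 0 then 0 else hcoef f (nat k))"
  using Rep_hardy[of f] by (simp add: hcoef_def)

lemma hardy_eqI: "(\<And>n. hcoef f n = hcoef g n) \<Longrightarrow> f = g"
  by (rule Rep_hardy_inject[THEN iffD1], rule fourier_eqI) (simp add: fourier_Rep_hardy)

lemma hcoef_add: "hcoef (f + g) n = hcoef f n + hcoef g n"
  by (simp add: hcoef_def plus_hardy.rep_eq fourier_add)
lemma hcoef_diff: "hcoef (f - g) n = hcoef f n - hcoef g n"
  by (simp add: hcoef_def minus_hardy.rep_eq fourier_diff)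
lemma hcoef_scaleC: "hcoef (c *\<^sub>C f) n = c *\<^sub>C hcoef f n"
  by (simp add: hcoef_def scaleC_hardy.rep_eq fourier_scaleC)

text \<open>
Truncating the Fourier series gives an element of the Hardy space by Riesz-Fischer, and it has the property
that defines \<open>hardy_proj f\<close> uniquely.
\<close>
lemma hardy_proj_works:
  "fourier (Rep_hardy (hardy_proj f)) k = (if k < 0 then 0 else fourier f k)"
  and cinner_hardy_proj: "cinner f (Rep_hardy h) = cinner (hardy_proj f) h"
proof -
  define a where "a k = (if k < 0 then 0 else fourier f k)" for k
  have "(\<Sum>k\<in>{-int N..int N}. (norm (a k))\<^sup>2) \<le> (norm f)\<^sup>2" for N
    by (rule order_trans[OF sum_mono Bessel[of "{-int N..int N}" f]]) (auto simp: a_def)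
  then obtain F where F: "\<And>k. fourier F k = a k" using Riesz_Fischer by blast
  define g where "g = Abs_hardy F"
  have g: "Rep_hardy g = F" unfolding g_def by (rule Abs_hardy_inverse) (simp add: F a_def)
  have orth: "cinner (f - Rep_hardy g) (Rep_hardy h) = 0" for h
    by (rule cinner_eq_0_of_fourier) (simp add: fourier_diff g F a_def fourier_Rep_hardy)
  have "hardy_proj f = g"
    unfolding hardy_proj_def
  proof (rule the_equality)
    show "\<forall>h. cinner (f - Rep_hardy g) (Rep_hardy h) = 0" using orth by blast
    fix g' assume g': "\<forall>h. cinner (f - Rep_hardy g') (Rep_hardy h) = 0"
    have "cinner (g - g') (g - g') = cinner (Rep_hardy g - Rep_hardy g') (Rep_hardy (g - g'))"
      by (simp add: cinner_hardy.rep_eq minus_hardy.rep_eq)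
    also have "\<dots> = cinner (f - Rep_hardy g') (Rep_hardy (g - g')) - cinner (f - Rep_hardy g) (Rep_hardy (g - g'))"
      by (simp flip: cinner_diff_left)
    also have "\<dots> = 0" using orth g' by simp
    finally show "g' = g" by (simp add: cinner_self)
  qed
  then show "fourier (Rep_hardy (hardy_proj f)) k = (if k < 0 then 0 else fourier f k)"
    and "cinner f (Rep_hardy h) = cinner (hardy_proj f) h"
    using orth[of h] by (simp_all add: g F a_def cinner_hardy.rep_eq cinner_diff_left)
qed

lemma hcoef_hardy_proj: "hcoef (hardy_proj f) n = fourier f (int n)"
  by (simp add: hcoef_def hardy_proj_works)

lemma hardy_proj_Rep [simp]: "hardy_proj (Rep_hardy f) = f"
  by (rule hardy_eqI) (simp add: hcoef_def hardy_proj_works)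

lemma norm_hardy_proj_le: "norm (hardy_proj f) \<le> norm f"
proof -
  have "complex_of_real ((norm (hardy_proj f))\<^sup>2) = cinner f (Rep_hardy (hardy_proj f))"
    by (simp add: cinner_hardy_proj cinner_self)
  then have "(norm (hardy_proj f))\<^sup>2 \<le> norm f * norm (hardy_proj f)"
    using norm_cinner_le[of f "Rep_hardy (hardy_proj f)"]
    by (metis norm_of_real abs_of_nonneg zero_le_power2 norm_hardy.rep_eq)
  then show ?thesis by (cases "hardy_proj f = 0") (auto simp: power2_eq_square)
qed

lemma bounded_clinear_hardy_proj: "bounded_clinear hardy_proj"
  by (rule bounded_clinearI[where K = 1])
    (auto intro!: hardy_eqI simp: hcoef_hardy_proj hcoef_add hcoef_scaleC fourier_add fourier_scaleC
      norm_hardy_proj_le)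

lemma bounded_clinear_Rep_hardy: "bounded_clinear Rep_hardy"
  by (rule bounded_clinearI[where K = 1])
    (simp_all add: plus_hardy.rep_eq scaleC_hardy.rep_eq norm_hardy.rep_eq)

instance hardy :: (separable_complex_hilbert) complete_space
proof
  fix X :: "nat \<Rightarrow> 'a hardy"
  assume "Cauchy X"
  then have "Cauchy (\<lambda>n. Rep_hardy (X n))" by (simp add: Cauchy_def dist_hardy.rep_eq)
  then obtain f where "(\<lambda>n. Rep_hardy (X n)) \<longlonglongrightarrow> f" using Cauchy_convergent unfolding convergent_def by blast
  from bounded_linear.tendsto[OF bounded_clinear_imp_bounded_linear[OF bounded_clinear_hardy_proj] this]
  show "convergent X" by (auto simp: convergent_def)
qed

lemma mult_op_z_symbol: "mult_op z_symbol f = zmul 1 f"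
  by transfer (simp add: L2_rel_self L2_rel_def, use square_integrable_zpow[of _ 1] in simp)

lemma hcoef_shift: "hcoef (shift f) n = (case n of 0 \<Rightarrow> 0 | Suc m \<Rightarrow> hcoef f m)"
  by (cases n) (simp_all add: shift_def toeplitz_op_def mult_op_z_symbol hcoef_hardy_proj fourier_zmul
      fourier_Rep_hardy)

lemma Rep_hardy_shift: "Rep_hardy (shift f) = zmul 1 (Rep_hardy f)"
  by (rule fourier_eqI)
    (auto simp: fourier_zmul fourier_Rep_hardy hcoef_shift nat_diff_distrib split: nat.split)

definition backshift :: "'e::separable_complex_hilbert hardy \<Rightarrow> 'e hardy"
  where "backshift f = hardy_proj (zmul (-1) (Rep_hardy f))"

lemma hcoef_backshift: "hcoef (backshift f) n = hcoef f (Suc n)"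
  by (simp add: backshift_def hcoef_hardy_proj fourier_zmul fourier_Rep_hardy nat_add_distrib)

lemma cinner_zmul: "cinner (zmul k f) g = cinner f (zmul (- k) g)"
proof (cases f rule: L2_cases)
  case f: (abs f')
  show ?thesis
  proof (cases g rule: L2_cases)
    case g: (abs g')
    have "(LINT z|circle. cinner (z powi k *\<^sub>C f' z) (g' z)) = (LINT z|circle. cinner (f' z) (z powi (- k) *\<^sub>C g' z))"
      by (intro Bochner_Integration.integral_cong) (auto simp: cinner_scaleC_left cinner_scaleC_right cnj_zpow)
    then show ?thesis using f g
      by (simp add: zmul_abs cinner_L2.abs_eq L2_rel_self square_integrable_zpow)
  qed
qed

lemma cinner_shift: "cinner (shift f) g = cinner f (backshift g)"
proof -
  have "cinner (shift f) g = cinner (Rep_hardy f) (zmul (-1) (Rep_hardy g))"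
    by (simp add: cinner_hardy.rep_eq Rep_hardy_shift cinner_zmul)
  also have "\<dots> = cnj (cinner (zmul (-1) (Rep_hardy g)) (Rep_hardy f))" by (rule cinner_commute)
  also have "\<dots> = cnj (cinner (backshift g) f)" by (simp only: cinner_hardy_proj backshift_def)
  also have "\<dots> = cinner f (backshift g)" by (rule cinner_commute[symmetric])
  finally show ?thesis .
qed

lemma cadjoint_shift: "cadjoint shift = backshift"
  unfolding cadjoint_def
proof (rule the_equality)
  show "\<forall>x y. cinner (shift x) y = cinner x (backshift y)" by (simp add: cinner_shift)
  fix B :: "'a hardy \<Rightarrow> 'a hardy" assume B: "\<forall>x y. cinner (shift x) y = cinner x (B y)"
  have "B y = backshift y" for y
  proof -
    have "cinner (B y - backshift y) (B y - backshift y) = 0"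
      using B by (simp add: cinner_diff_right cinner_shift[symmetric])
    then show ?thesis by (simp add: cinner_self)
  qed
  then show "B = backshift" by blast
qed

lemma bounded_clinear_shift: "bounded_clinear shift"
proof -
  have eq: "shift = (\<lambda>f. hardy_proj (zmul 1 (Rep_hardy f)))"
    by (simp add: fun_eq_iff shift_def toeplitz_op_def mult_op_z_symbol)
  show ?thesis
    unfolding eq
    by (rule bounded_clinear_compose[OF bounded_clinear_hardy_proj
        bounded_clinear_compose[OF bounded_clinear_zmul bounded_clinear_Rep_hardy]])
qed

lemma bounded_clinear_backshift: "bounded_clinear backshift"
  unfolding backshift_def[abs_def]
  by (rule bounded_clinear_compose[OF bounded_clinear_hardy_proj
        bounded_clinear_compose[OF bounded_clinear_zmul bounded_clinear_Rep_hardy]])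

definition hmono :: "nat \<Rightarrow> 'e::separable_complex_hilbert \<Rightarrow> 'e hardy"
  where "hmono n x = hardy_proj (zmono (int n) x)"

lemma Rep_hmono: "Rep_hardy (hmono n x) = zmono (int n) x"
  by (rule fourier_eqI) (auto simp: hmono_def hardy_proj_works fourier_mono)

lemma hcoef_hmono: "hcoef (hmono n x) m = (if m = n then x else 0)"
  by (auto simp: hcoef_def Rep_hmono fourier_mono)

lemma shift_hmono: "shift (hmono n x) = hmono (Suc n) x"
  by (rule hardy_eqI) (auto simp: hcoef_shift hcoef_hmono split: nat.split)

lemma hardy_proj_zmono: "hardy_proj (zmono k x) = (if k < 0 then 0 else hmono (nat k) x)"
proof -
  have "hcoef 0 n = 0" for n using hcoef_diff[of 0 0 n] by simp
  then show ?thesis by (auto intro!: hardy_eqI simp: hcoef_hardy_proj fourier_mono hcoef_hmono)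
qed

text \<open>
The partial sums of the Taylor series; they show that the elements \<open>hmono n x\<close> span a dense subspace.
\<close>
definition hsection :: "nat \<Rightarrow> 'e::separable_complex_hilbert hardy \<Rightarrow> 'e hardy"
  where "hsection N f = (\<Sum>k\<in>{-int N..int N}. hardy_proj (zmono k (fourier (Rep_hardy f) k)))"

lemma hsection_LIMSEQ: "(\<lambda>N. hsection N f) \<longlonglongrightarrow> f"
  using bounded_linear.tendsto[OF bounded_clinear_imp_bounded_linear[OF bounded_clinear_hardy_proj]
      fourier_series_LIMSEQ[of "Rep_hardy f"]]
  by (simp add: hsection_def bounded_clinear_sum[OF bounded_clinear_hardy_proj])

lemma hcoef_hsection: "hcoef (hsection N f) n = (if n \<le> N then hcoef f n else 0)"
proof -
  have "hsection N f = hardy_proj (\<Sum>k\<in>{-int N..int N}. zmono k (fourier (Rep_hardy f) k))"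
    by (simp add: hsection_def bounded_clinear_sum[OF bounded_clinear_hardy_proj])
  then show ?thesis by (simp add: hcoef_def hardy_proj_works fourier_sum_zmono)
qed

lemma bounded_clinear_eqI_hmono:
  assumes A: "bounded_clinear A" and B: "bounded_clinear B" and eq: "\<And>n x. A (hmono n x) = B (hmono n x)"
  shows "A = B"
proof
  fix f
  have "A (hardy_proj (zmono k x)) = B (hardy_proj (zmono k x))" for k x
    by (simp add: hardy_proj_zmono eq bounded_clinear_zero[OF A] bounded_clinear_zero[OF B])
  then have "A (hsection N f) = B (hsection N f)" for N
    by (simp add: hsection_def bounded_clinear_sum[OF A] bounded_clinear_sum[OF B])
  then show "A f = B f"
    using bounded_linear.tendsto[OF bounded_clinear_imp_bounded_linear[OF A] hsection_LIMSEQ[of f]]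
      bounded_linear.tendsto[OF bounded_clinear_imp_bounded_linear[OF B] hsection_LIMSEQ[of f]]
    by (simp add: LIMSEQ_unique)
qed

lemma hcoef_backshift_pow: "hcoef ((backshift ^^ n) f) m = hcoef f (m + n)"
  by (induction n arbitrary: m) (simp_all add: hcoef_backshift)

lemma norm_backshift_le: "norm (backshift f) \<le> norm f"
  using norm_hardy_proj_le[of "zmul (-1) (Rep_hardy f)"] by (simp add: backshift_def norm_hardy.rep_eq)

interpretation shift: pure_isometry shift backshift
proof
  show "backshift (shift f) = f" for f :: "'a hardy"
    by (rule hardy_eqI) (simp add: hcoef_backshift hcoef_shift)
  show "(\<lambda>n. (backshift ^^ n) f) \<longlonglongrightarrow> 0" for f :: "'a hardy"
  proof (rule LIMSEQ_imp_Suc, rule Lim_null_comparison)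
    have pow_le: "norm ((backshift ^^ n) g) \<le> norm g" for n and g :: "'a hardy"
      by (induction n) (auto intro: order_trans[OF norm_backshift_le])
    \<comment> \<open>\<open>hsection n f\<close> has degree at most \<open>n\<close>, so \<open>n + 1\<close> backward shifts annihilate it\<close>
    have "(backshift ^^ Suc n) f = (backshift ^^ Suc n) (f - hsection n f)" for n
      by (rule hardy_eqI) (simp add: hcoef_backshift_pow hcoef_diff hcoef_hsection del: funpow.simps)
    then have "norm ((backshift ^^ Suc n) f) \<le> norm (f - hsection n f)" for n
      using pow_le[of "Suc n" "f - hsection n f"] by simp
    then show "\<forall>\<^sub>F n in sequentially. norm ((backshift ^^ Suc n) f) \<le> norm (f - hsection n f)" by simp
    show "(\<lambda>n. norm (f - hsection n f)) \<longlonglongrightarrow> 0"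
      using tendsto_norm[OF tendsto_diff[OF tendsto_const hsection_LIMSEQ[of f], of f]] by simp
  qed
qed (simp_all add: bounded_clinear_shift bounded_clinear_backshift cinner_shift)

section \<open>Bounded symbols from Fourier coefficients\<close>

lemma dense_approximation:
  fixes D :: "'a::metric_space set"
  assumes "\<And>U. open U \<Longrightarrow> U \<noteq> {} \<Longrightarrow> \<exists>d\<in>D. d \<in> U"
  shows "\<exists>d. (\<forall>n x. d n x \<in> D) \<and> (\<forall>x. (\<lambda>n. d n x) \<longlonglongrightarrow> x)"
proof -
  have "\<forall>n x. \<exists>y. y \<in> D \<and> y \<in> ball x (inverse (real (Suc n)))"
  proof (intro allI)
    fix n :: nat and x :: 'a
    have "ball x (inverse (real (Suc n))) \<noteq> {}" by simp
    then show "\<exists>y. y \<in> D \<and> y \<in> ball x (inverse (real (Suc n)))"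
      using assms[of "ball x (inverse (real (Suc n)))"] by blast
  qed
  then obtain d where d: "\<And>n x. d n x \<in> D" "\<And>n x. d n x \<in> ball x (inverse (real (Suc n)))"
    by metis
  have "(\<lambda>n. d n x) \<longlonglongrightarrow> x" for x
  proof (rule tendsto_dist_iff[THEN iffD2], rule Lim_null_comparison[OF _ LIMSEQ_inverse_real_of_nat])
    show "\<forall>\<^sub>F n in sequentially. norm (dist (d n x) x) \<le> inverse (real (Suc n))"
      using d(2)[of _ x] by (auto simp: dist_commute less_imp_le simp del: of_nat_Suc)
  qed
  then show ?thesis using d by blast
qed

text \<open>
A single inequality on dense sets of scalars and vectors encodes linearity and boundedness together:
by continuity it extends to all \<open>a\<close>, \<open>x\<close>, \<open>y\<close>, \<open>w\<close>, and then \<open>w = a *\<^sub>C x + y\<close> gives linearity.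
\<close>
lemma clinear_extension_of_dense:
  fixes g :: "'e::separable_complex_hilbert \<Rightarrow> 'e"
  assumes ineq: "\<And>a x y w. a \<in> B \<Longrightarrow> x \<in> D \<Longrightarrow> y \<in> D \<Longrightarrow> w \<in> D \<Longrightarrow>
      norm (a *\<^sub>C g x + g y - g w) \<le> C * norm (a *\<^sub>C x + y - w)"
    and d: "\<And>n x. d n x \<in> D" "\<And>x. (\<lambda>n. d n x) \<longlonglongrightarrow> x"
    and e: "\<And>n a. e n a \<in> B" "\<And>a. (\<lambda>n. e n a) \<longlonglongrightarrow> a"
    and C: "0 \<le> C"
  shows "(\<lambda>n. g (d n x)) \<longlonglongrightarrow> lim (\<lambda>n. g (d n x))"
    and "bounded_clinear (\<lambda>x. lim (\<lambda>n. g (d n x)))"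
    and "norm (lim (\<lambda>n. g (d n x))) \<le> C * norm x"
proof -
  note scaleC_tendsto = bounded_bilinear.tendsto[OF bounded_bilinear_scaleC]
  have ineq_a: "norm (a *\<^sub>C g x + g y - g w) \<le> C * norm (a *\<^sub>C x + y - w)"
    if "x \<in> D" "y \<in> D" "w \<in> D" for a x y w
  proof (rule LIMSEQ_le)
    show "(\<lambda>n. norm (e n a *\<^sub>C g x + g y - g w)) \<longlonglongrightarrow> norm (a *\<^sub>C g x + g y - g w)"
      by (intro tendsto_intros scaleC_tendsto e)
    show "(\<lambda>n. C * norm (e n a *\<^sub>C x + y - w)) \<longlonglongrightarrow> C * norm (a *\<^sub>C x + y - w)"
      by (intro tendsto_intros scaleC_tendsto e)
    show "\<exists>N. \<forall>n\<ge>N. norm (e n a *\<^sub>C g x + g y - g w) \<le> C * norm (e n a *\<^sub>C x + y - w)"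
      using ineq e(1) that by blast
  qed
  have lipschitz: "norm (g y - g w) \<le> C * norm (y - w)" if "y \<in> D" "w \<in> D" for y w
    using ineq_a[of y y w 0] that by simp
  have "Cauchy (\<lambda>n. g (d n x))" for x
  proof (rule metric_CauchyI)
    fix r :: real assume r: "r > 0"
    have "Cauchy (\<lambda>n. d n x)" using d(2) by (rule LIMSEQ_imp_Cauchy)
    then obtain M where M: "\<And>m n. m \<ge> M \<Longrightarrow> n \<ge> M \<Longrightarrow> dist (d m x) (d n x) < r / (C + 1)"
      unfolding Cauchy_def using r C by (metis add_nonneg_pos divide_pos_pos zero_less_one)
    have "dist (g (d m x)) (g (d n x)) < r" if "m \<ge> M" "n \<ge> M" for m n
    proof -
      have "dist (g (d m x)) (g (d n x)) \<le> C * dist (d m x) (d n x)"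
        using lipschitz[OF d(1) d(1)] by (simp add: dist_norm)
      also have "\<dots> \<le> (C + 1) * dist (d m x) (d n x)" by (simp add: mult_right_mono)
      also have "\<dots> < r" using M[OF that] C by (simp add: pos_less_divide_eq mult.commute)
      finally show ?thesis .
    qed
    then show "\<exists>M. \<forall>m\<ge>M. \<forall>n\<ge>M. dist (g (d m x)) (g (d n x)) < r" by blast
  qed
  then show lim: "(\<lambda>n. g (d n x)) \<longlonglongrightarrow> lim (\<lambda>n. g (d n x))" for x
    using Cauchy_convergent convergent_LIMSEQ_iff by blast
  define L where "L x = lim (\<lambda>n. g (d n x))" for x
  have limL: "(\<lambda>n. g (d n x)) \<longlonglongrightarrow> L x" for x using lim by (simp add: L_def)
  have L_ineq: "norm (a *\<^sub>C L x + L y - L w) \<le> C * norm (a *\<^sub>C x + y - w)" for a x y w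
  proof (rule LIMSEQ_le)
    show "(\<lambda>n. norm (a *\<^sub>C g (d n x) + g (d n y) - g (d n w))) \<longlonglongrightarrow> norm (a *\<^sub>C L x + L y - L w)"
      by (intro tendsto_intros scaleC_tendsto limL)
    show "(\<lambda>n. C * norm (a *\<^sub>C d n x + d n y - d n w)) \<longlonglongrightarrow> C * norm (a *\<^sub>C x + y - w)"
      by (intro tendsto_intros scaleC_tendsto d)
    show "\<exists>N. \<forall>n\<ge>N. norm (a *\<^sub>C g (d n x) + g (d n y) - g (d n w))
        \<le> C * norm (a *\<^sub>C d n x + d n y - d n w)"
      using ineq_a d(1) by blast
  qed
  have L_lin: "L (a *\<^sub>C x + y) = a *\<^sub>C L x + L y" for a x y
    using L_ineq[of a x y "a *\<^sub>C x + y"] by simp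
  have L_0: "L 0 = 0" using L_lin[of 1 0 0] by simp
  have L_norm: "norm (L x) \<le> C * norm x" for x using L_ineq[of 0 x x 0] by (simp add: L_0)
  then show "norm (lim (\<lambda>n. g (d n x))) \<le> C * norm x" by (simp add: L_def)
  have "bounded_clinear L"
  proof (rule bounded_clinearI)
    show "L (x + y) = L x + L y" for x y using L_lin[of 1 x y] by simp
    show "L (c *\<^sub>C x) = c *\<^sub>C L x" for c x using L_lin[of c x 0] by (simp add: L_0)
    show "norm (L x) \<le> norm x * C" for x using L_norm[of x] by (simp add: mult.commute)
  qed
  then show "bounded_clinear (\<lambda>x. lim (\<lambda>n. g (d n x)))" by (simp add: L_def[abs_def])
qed

lemma integral_cmod_poly_sq:
  "(LINT z|circle. (cmod (poly p z))\<^sup>2) = (\<Sum>j\<le>degree p. (cmod (coeff p j))\<^sup>2)"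
proof -
  interpret finite_measure circle by (rule finite_measure_circle)
  have int: "integrable circle (\<lambda>z::complex. z powi m)" for m
    by (rule integrable_const_bound[where B = 1]) (auto simp: norm_power_int intro: AE_I2)
  have "complex_of_real (LINT z|circle. (cmod (poly p z))\<^sup>2)
      = (LINT z|circle. complex_of_real ((cmod (poly p z))\<^sup>2))"
    by (rule integral_complex_of_real[symmetric])
  also have "\<dots> = (LINT z|circle. (\<Sum>i\<le>degree p. \<Sum>j\<le>degree p.
      coeff p i * cnj (coeff p j) * z powi (int i - int j)))"
    by (intro Bochner_Integration.integral_cong) (auto simp: cmod_poly_sq simp del: of_real_power)
  also have "\<dots> = (\<Sum>i\<le>degree p. \<Sum>j\<le>degree p.
      coeff p i * cnj (coeff p j) * (LINT z|circle. z powi (int i - int j)))"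
    by (simp add: Bochner_Integration.integral_sum Bochner_Integration.integrable_sum int)
  also have "\<dots> = (\<Sum>i\<le>degree p. coeff p i * cnj (coeff p i))"
    by (simp add: integral_circle_zpow sum.delta if_distrib[of "\<lambda>x. _ * x"] cong: if_cong)
  also have "\<dots> = complex_of_real (\<Sum>j\<le>degree p. (cmod (coeff p j))\<^sup>2)"
    by (simp add: complex_norm_square del: of_real_power)
  finally show ?thesis by (simp only: of_real_eq_iff)
qed

lemma poly_scaleC_L2:
  assumes f: "square_integrable f"
  shows "square_integrable (\<lambda>z. poly p z *\<^sub>C f z)"
    and "fourier (abs_L2 (\<lambda>z. poly p z *\<^sub>C f z)) k
      = (\<Sum>j\<le>degree p. coeff p j *\<^sub>C fourier (abs_L2 f) (k - int j))"
proof -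
  have cont: "continuous_on (sphere 0 1) (poly p)" by (intro continuous_intros)
  then have [measurable]: "poly p \<in> borel_measurable circle" by (rule borel_measurable_circle_continuous)
  have [measurable]: "f \<in> borel_measurable circle" using f by (rule square_integrable_measurable)
  have "bounded (poly p ` sphere 0 1)"
    by (intro compact_imp_bounded compact_continuous_image cont compact_sphere)
  then obtain M where M: "\<forall>x\<in>poly p ` sphere 0 1. norm x \<le> M" unfolding bounded_iff by blast
  show si: "square_integrable (\<lambda>z. poly p z *\<^sub>C f z)"
  proof (rule square_integrable_bounded_pointwise[OF f, where M = M])
    show "(\<lambda>z. poly p z *\<^sub>C f z) \<in> borel_measurable circle"
      by (intro borel_measurable_bilinear[OF bounded_bilinear_scaleC]) measurable
    show "AE z in circle. norm (poly p z *\<^sub>C f z) \<le> M * norm (f z)"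
      using M by (intro AE_I2) (simp add: norm_scaleC mult_right_mono)
  qed
  have scaleC_sum: "sum h A *\<^sub>C x = (\<Sum>j\<in>A. h j *\<^sub>C x)" for h :: "nat \<Rightarrow> complex" and A and x :: 'a
    by (rule bounded_bilinear.sum_left[OF bounded_bilinear_scaleC])
  have scaleC_sum': "c *\<^sub>C sum h A = (\<Sum>j\<in>A. c *\<^sub>C h j)" for c and A and h :: "nat \<Rightarrow> 'a"
    by (rule bounded_bilinear.sum_right[OF bounded_bilinear_scaleC])
  have bl: "bounded_linear (\<lambda>x::'a. c *\<^sub>C x)" for c
    by (rule bounded_bilinear.bounded_linear_right[OF bounded_bilinear_scaleC])
  have "fourier (abs_L2 (\<lambda>z. poly p z *\<^sub>C f z)) k = (LINT z|circle. z powi (- k) *\<^sub>C poly p z *\<^sub>C f z)"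
    by (rule fourier_abs[OF si])
  also have "\<dots> = (LINT z|circle. (\<Sum>j\<le>degree p. coeff p j *\<^sub>C z powi (- (k - int j)) *\<^sub>C f z))"
  proof (intro Bochner_Integration.integral_cong refl)
    fix z :: complex assume "z \<in> space circle"
    then have "z \<noteq> 0" by auto
    then have zp: "z powi (- (k - int j)) = z powi (- k) * z ^ j" for j
      using power_int_add[of z "- k" "int j"] by simp
    show "z powi (- k) *\<^sub>C poly p z *\<^sub>C f z = (\<Sum>j\<le>degree p. coeff p j *\<^sub>C z powi (- (k - int j)) *\<^sub>C f z)"
      unfolding poly_altdef scaleC_sum scaleC_sum' scaleC_scaleC zp
      by (intro sum.cong refl) (simp add: mult.left_commute)
  qed
  also have "\<dots> = (\<Sum>j\<le>degree p. LINT z|circle. coeff p j *\<^sub>C z powi (- (k - int j)) *\<^sub>C f z)"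
    by (intro Bochner_Integration.integral_sum integrable_bounded_linear[OF bl] integrable_fourier f)
  also have "\<dots> = (\<Sum>j\<le>degree p. coeff p j *\<^sub>C fourier (abs_L2 f) (k - int j))"
    unfolding fourier_abs[OF f]
    by (intro sum.cong refl integral_bounded_linear[OF bl] integrable_fourier f)
  finally show "fourier (abs_L2 (\<lambda>z. poly p z *\<^sub>C f z)) k
      = (\<Sum>j\<le>degree p. coeff p j *\<^sub>C fourier (abs_L2 f) (k - int j))" .
qed

text \<open>
The \<open>k\<close>-th coefficient of \<open>p f\<close> is the sum inside the norm, so by Parseval the hypothesis says that \<open>p f\<close> has norm at
most \<open>K\<close> times the norm of \<open>p\<close>. Hence \<open>norm (f z)\<^sup>2 - K\<^sup>2\<close> has a nonpositive integral against
\<open>cmod (p z)\<^sup>2\<close>.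
\<close>
lemma AE_norm_le_of_poly_bound:
  assumes f: "square_integrable f"
    and bound: "\<And>p N. (\<Sum>k\<in>{-int N..int N}. (norm (\<Sum>j\<le>degree p. coeff p j *\<^sub>C fourier (abs_L2 f) (k - int j)))\<^sup>2)
      \<le> K\<^sup>2 * (\<Sum>j\<le>degree p. (cmod (coeff p j))\<^sup>2)"
    and K: "0 \<le> K"
  shows "AE z in circle. norm (f z) \<le> K"
proof -
  interpret finite_measure circle by (rule finite_measure_circle)
  have "AE z in circle. (norm (f z))\<^sup>2 - K\<^sup>2 \<le> 0"
  proof (rule AE_nonpos_of_poly)
    show "integrable circle (\<lambda>z. (norm (f z))\<^sup>2 - K\<^sup>2)"
      using square_integrable_norm[OF f] by simp
    fix p
    define P where "P = abs_L2 (\<lambda>z. poly p z *\<^sub>C f z)"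
    have pint: "integrable circle (\<lambda>z. (cmod (poly p z))\<^sup>2)"
      using square_integrable_norm[OF poly_scaleC_L2(1)[OF square_integrable_const[of "1::complex"], of p]]
      by (simp add: norm_scaleC)
    have "(LINT z|circle. (cmod (poly p z))\<^sup>2 * ((norm (f z))\<^sup>2 - K\<^sup>2))
        = (LINT z|circle. (norm (poly p z *\<^sub>C f z))\<^sup>2 - (cmod (poly p z))\<^sup>2 * K\<^sup>2)"
      by (simp add: norm_scaleC power_mult_distrib right_diff_distrib)
    also have "\<dots> = (LINT z|circle. (norm (poly p z *\<^sub>C f z))\<^sup>2) - (LINT z|circle. (cmod (poly p z))\<^sup>2) * K\<^sup>2"
      using square_integrable_norm[OF poly_scaleC_L2(1)[OF f, of p]] pint by simp
    also have "(LINT z|circle. (norm (poly p z *\<^sub>C f z))\<^sup>2) = (norm P)\<^sup>2"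
      unfolding P_def by (rule norm_abs_L2[symmetric], rule poly_scaleC_L2(1)[OF f])
    also have "(norm P)\<^sup>2 \<le> K\<^sup>2 * (\<Sum>j\<le>degree p. (cmod (coeff p j))\<^sup>2)"
      using bound by (intro norm_L2_le) (simp add: P_def poly_scaleC_L2(2)[OF f])
    finally show "(LINT z|circle. (cmod (poly p z))\<^sup>2 * ((norm (f z))\<^sup>2 - K\<^sup>2)) \<le> 0"
      by (simp add: integral_cmod_poly_sq mult.commute)
  qed
  then show ?thesis
    by eventually_elim (use K in \<open>auto intro: power2_le_imp_le\<close>)
qed

text \<open>
The hypothesis bounds multiplication of scalar polynomials by \<open>F x = \<Sum> \<Gamma> k x z\<^sup>k\<close>, hence \<open>F x\<close> itself
almost everywhere. Applied to \<open>a *\<^sub>C x + y - w\<close> in place of \<open>x\<close>, this is the inequality of lemma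
\<open>clinear_extension_of_dense\<close> for almost every \<open>z\<close>, and countably many such inequalities
define the symbol at \<open>z\<close>.
\<close>
lemma symbol_exists:
  fixes \<Gamma> :: "int \<Rightarrow> 'e \<Rightarrow> 'e::separable_complex_hilbert"
  assumes \<Gamma>: "\<And>k x y. \<Gamma> k (x + y) = \<Gamma> k x + \<Gamma> k y" "\<And>k c x. \<Gamma> k (c *\<^sub>C x) = c *\<^sub>C \<Gamma> k x"
    and bound: "\<And>p x N. (\<Sum>k\<in>{-int N..int N}. (norm (\<Sum>j\<le>degree p. coeff p j *\<^sub>C \<Gamma> (k - int j) x))\<^sup>2)
      \<le> (C * norm x)\<^sup>2 * (\<Sum>j\<le>degree p. (cmod (coeff p j))\<^sup>2)"
    and C: "0 \<le> C"
  shows "\<exists>\<Phi>. \<forall>x k. fourier (mult_op \<Phi> (zmono 0 x)) k = \<Gamma> k x"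
proof -
  have "\<exists>F. \<forall>k. fourier F k = \<Gamma> k x" for x
  proof -
    have "(\<Sum>k\<in>{-int N..int N}. (norm (\<Gamma> k x))\<^sup>2) \<le> (C * norm x)\<^sup>2" for N
      using bound[where p = 1 and N = N and x = x] by simp
    from Riesz_Fischer[where a = "\<lambda>k. \<Gamma> k x", OF this] show ?thesis by blast
  qed
  then obtain F where F: "\<And>x k. fourier (F x) k = \<Gamma> k x" by metis
  define f where "f x = rep_L2 (F x)" for x
  have f: "square_integrable (f x)" and Ff: "abs_L2 (f x) = F x" for x
    by (simp_all add: f_def square_integrable_rep)
  have f_bound: "AE z in circle. norm (f x z) \<le> C * norm x" for x
    by (rule AE_norm_le_of_poly_bound[OF f]) (use bound C in \<open>auto simp: Ff F\<close>)
  have \<Gamma>_diff: "\<Gamma> k (x - y) = \<Gamma> k x - \<Gamma> k y" for k x y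
    using \<Gamma>(1)[of k "x - y" y] by (simp add: algebra_simps)
  have f_lin: "AE z in circle. norm (a *\<^sub>C f x z + f y z - f w z) \<le> C * norm (a *\<^sub>C x + y - w)"
    for a x y w
  proof -
    have si: "square_integrable (\<lambda>z. a *\<^sub>C f x z + f y z - f w z)"
      by (intro square_integrable_diff square_integrable_add square_integrable_scaleC f)
    have "abs_L2 (\<lambda>z. a *\<^sub>C f x z + f y z - f w z) = a *\<^sub>C F x + F y - F w"
      by (simp add: scaleC_L2.abs_eq plus_L2.abs_eq minus_L2.abs_eq L2_rel_self f Ff[symmetric]
          square_integrable_add square_integrable_scaleC)
    also have "\<dots> = F (a *\<^sub>C x + y - w)"
      by (rule fourier_eqI) (simp add: F fourier_diff fourier_add fourier_scaleC \<Gamma> \<Gamma>_diff)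
    finally have "AE z in circle. f (a *\<^sub>C x + y - w) z = a *\<^sub>C f x z + f y z - f w z"
      using rep_abs_L2[OF si] by (simp add: f_def)
    with f_bound[of "a *\<^sub>C x + y - w"] show ?thesis by eventually_elim simp
  qed
  obtain D :: "'e set" where D: "countable D" "\<And>U. open U \<Longrightarrow> U \<noteq> {} \<Longrightarrow> \<exists>d\<in>D. d \<in> U"
    using countable_dense_exists by metis
  obtain B :: "complex set" where B: "countable B" "\<And>U. open U \<Longrightarrow> U \<noteq> {} \<Longrightarrow> \<exists>d\<in>B. d \<in> U"
    using countable_dense_exists by metis
  obtain d where d: "\<And>n x. d n x \<in> D" "\<And>x. (\<lambda>n. d n x) \<longlonglongrightarrow> x"
    using dense_approximation[OF D(2)] by metis
  obtain e where e: "\<And>n a. e n a \<in> B" "\<And>a. (\<lambda>n. e n a) \<longlonglongrightarrow> a"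
    using dense_approximation[OF B(2)] by metis
  have "AE z in circle. \<forall>a\<in>B. \<forall>x\<in>D. \<forall>y\<in>D. \<forall>w\<in>D.
      norm (a *\<^sub>C f x z + f y z - f w z) \<le> C * norm (a *\<^sub>C x + y - w)"
    using B(1) D(1) f_lin by (simp add: AE_ball_countable)
  then obtain N where N: "N \<in> null_sets circle" "\<And>z a x y w. z \<in> space circle - N \<Longrightarrow>
      a \<in> B \<Longrightarrow> x \<in> D \<Longrightarrow> y \<in> D \<Longrightarrow> w \<in> D \<Longrightarrow>
      norm (a *\<^sub>C f x z + f y z - f w z) \<le> C * norm (a *\<^sub>C x + y - w)"
    by (elim AE_E3) blast
  \<comment> \<open>on the exceptional set the symbol is \<open>0\<close>\<close>
  define \<phi> where "\<phi> x z = (if z \<in> N then 0 else f x z)" for x z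
  define \<Phi> where "\<Phi> z x = lim (\<lambda>n. \<phi> (d n x) z)" for z x
  have \<phi>_ineq: "norm (a *\<^sub>C \<phi> x z + \<phi> y z - \<phi> w z) \<le> C * norm (a *\<^sub>C x + y - w)"
    if "z \<in> space circle" "a \<in> B" "x \<in> D" "y \<in> D" "w \<in> D" for z a x y w
    using N(2)[of z a x y w] that C by (simp add: \<phi>_def)
  have lim: "(\<lambda>n. \<phi> (d n x) z) \<longlonglongrightarrow> \<Phi> z x"
    and \<Phi>_lin: "bounded_clinear (\<Phi> z)" and \<Phi>_norm: "norm (\<Phi> z x) \<le> C * norm x"
    if z: "z \<in> space circle" for z x
    unfolding \<Phi>_def[abs_def]
    using clinear_extension_of_dense[where B = B and D = D and g = "\<lambda>x. \<phi> x z" and C = C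
        and d = d and e = e, OF \<phi>_ineq[OF z] d e C] by auto
  have [measurable]: "N \<in> sets circle" using N(1) by auto
  have [measurable]: "f x \<in> borel_measurable circle" for x using f by (rule square_integrable_measurable)
  have [measurable]: "\<phi> x \<in> borel_measurable circle" for x
    unfolding \<phi>_def by measurable
  have bs: "bounded_symbol \<Phi>"
    unfolding bounded_symbol_def
  proof (intro conjI ballI allI)
    show "bounded_clinear (\<Phi> z)" if "z \<in> sphere 0 1" for z using \<Phi>_lin that by simp
    show "(\<lambda>z. \<Phi> z x) \<in> borel_measurable circle" for x
      unfolding \<Phi>_def by (rule borel_measurable_lim_metric) measurable
    have "AE z in circle. onorm (\<Phi> z) \<le> C"
      using C \<Phi>_norm by (intro AE_I2 onorm_bound) auto
    then show "\<exists>M. AE z in circle. onorm (\<Phi> z) \<le> M" by blast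
  qed
  have \<Phi>_f: "AE z in circle. \<Phi> z x = f x z" for x
  proof -
    have "AE z in circle. \<forall>n. norm (f (d n x) z - f x z) \<le> C * norm (d n x - x)"
      using f_lin[of 0 x] by (simp add: AE_all_countable)
    moreover have "AE z in circle. z \<notin> N" using N(1) by (rule AE_not_in)
    moreover have "AE z in circle. z \<in> space circle" by (rule AE_space)
    ultimately show ?thesis
    proof eventually_elim
      case (elim z)
      have "(\<lambda>n. C * norm (d n x - x)) \<longlonglongrightarrow> C * norm (x - x)"
        by (rule tendsto_mult_left[OF tendsto_norm[OF tendsto_diff[OF d(2) tendsto_const]]])
      then have "(\<lambda>n. C * norm (d n x - x)) \<longlonglongrightarrow> 0" by simp
      then have "(\<lambda>n. f (d n x) z - f x z) \<longlonglongrightarrow> 0"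
        by (rule Lim_null_comparison[rotated]) (use elim(1) in simp)
      then have "(\<lambda>n. f (d n x) z) \<longlonglongrightarrow> f x z" by (rule LIM_zero_cancel)
      moreover have "(\<lambda>n. f (d n x) z) \<longlonglongrightarrow> \<Phi> z x"
        using lim[of z x] elim by (simp add: \<phi>_def)
      ultimately show ?case by (rule LIMSEQ_unique[symmetric])
    qed
  qed
  have "mult_op (abs_Linf \<Phi>) (zmono 0 x) = F x" for x
  proof -
    have si: "square_integrable (\<lambda>z. \<Phi> z x)"
      by (rule square_integrable_bounded_pointwise[OF f[of x], where M = 1])
        (use bs \<Phi>_f[of x] in \<open>auto simp: bounded_symbol_def elim: eventually_mono\<close>)
    have "mult_op (abs_Linf \<Phi>) (zmono 0 x) = abs_L2 (\<lambda>z. \<Phi> z x)"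
      using bs by (simp add: zmono_def mult_op.abs_eq Linf_rel_def L2_rel_self square_integrable_const)
    also have "\<dots> = abs_L2 (f x)"
      using si f \<Phi>_f by (intro Quotient_rel_abs[OF Quotient_L2]) (simp add: L2_rel_def)
    finally show ?thesis by (simp add: Ff)
  qed
  then show ?thesis using F by metis
qed

section \<open>Toeplitz and Hankel operators\<close>

lemma Linf_cases:
  obtains P where "\<Phi> = abs_Linf P" "bounded_symbol P"
  using Quotient_rep_reflp[OF Quotient_Linf, of \<Phi>] Quotient_abs_rep[OF Quotient_Linf, of \<Phi>]
  unfolding Linf_rel_def by metis

lemma mult_op_abs:
  "bounded_symbol P \<Longrightarrow> square_integrable f \<Longrightarrow> mult_op (abs_Linf P) (abs_L2 f) = abs_L2 (\<lambda>z. P z (f z))"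
  by (simp add: mult_op.abs_eq Linf_rel_def L2_rel_self)

lemma square_integrable_symbol_apply:
  assumes "bounded_symbol P" "square_integrable f"
  shows "square_integrable (\<lambda>z. P z (f z))"
  using mult_op.rsp[THEN rel_funD, THEN rel_funD, of P P f f] assms
  by (simp add: Linf_rel_def L2_rel_self)

lemma bounded_clinear_mult_op: "bounded_clinear (mult_op \<Phi>)"
proof -
  obtain P where \<Phi>: "\<Phi> = abs_Linf P" and P: "bounded_symbol P" by (rule Linf_cases)
  obtain M where "AE z in circle. onorm (P z) \<le> M" using P unfolding bounded_symbol_def by blast
  then have M: "AE z in circle. onorm (P z) \<le> max M 0" by eventually_elim simp
  have lin: "bounded_clinear (P z)" if "z \<in> sphere 0 1" for z
    using P that by (simp add: bounded_symbol_def)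
  have mult: "mult_op \<Phi> (abs_L2 f) = abs_L2 (\<lambda>z. P z (f z))" if "square_integrable f" for f
    using P that by (simp add: \<Phi> mult_op_abs)
  have le: "AE z in circle. norm (P z (f z)) \<le> max M 0 * norm (f z)" for f
    using M AE_space
  proof eventually_elim
    case (elim z)
    then have "bounded_linear (P z)" using lin by (simp add: bounded_clinear_imp_bounded_linear)
    from onorm[OF this, of "f z"] show ?case
      using mult_right_mono[OF elim(1) norm_ge_zero[of "f z"]] by linarith
  qed
  have si: "square_integrable (\<lambda>z. P z (f z))" if "square_integrable f" for f
    using P that by (rule square_integrable_symbol_apply)
  show ?thesis
  proof (rule bounded_clinearI)
    fix F G :: "'a L2" and c
    obtain f where f: "F = abs_L2 f" "square_integrable f" by (rule L2_cases)
    obtain g where g: "G = abs_L2 g" "square_integrable g" by (rule L2_cases)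
    have "F + G = abs_L2 (\<lambda>z. f z + g z)"
      using f g by (simp add: plus_L2.abs_eq L2_rel_self)
    then have "mult_op \<Phi> (F + G) = abs_L2 (\<lambda>z. P z (f z + g z))"
      using f g by (simp add: mult square_integrable_add)
    also have "\<dots> = abs_L2 (\<lambda>z. P z (f z) + P z (g z))"
      by (rule abs_L2_cong)
        (use f g in \<open>auto intro!: si square_integrable_add bounded_clinear_add[OF lin]\<close>)
    also have "\<dots> = mult_op \<Phi> F + mult_op \<Phi> G"
      using f g by (simp add: mult si plus_L2.abs_eq L2_rel_self)
    finally show "mult_op \<Phi> (F + G) = mult_op \<Phi> F + mult_op \<Phi> G" .
    have "c *\<^sub>C F = abs_L2 (\<lambda>z. c *\<^sub>C f z)"
      using f by (simp add: scaleC_L2.abs_eq L2_rel_self)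
    then have "mult_op \<Phi> (c *\<^sub>C F) = abs_L2 (\<lambda>z. P z (c *\<^sub>C f z))"
      using f by (simp add: mult square_integrable_scaleC)
    also have "\<dots> = abs_L2 (\<lambda>z. c *\<^sub>C P z (f z))"
      by (rule abs_L2_cong)
        (use f in \<open>auto intro!: si square_integrable_scaleC bounded_clinear_scaleC[OF lin]\<close>)
    also have "\<dots> = c *\<^sub>C mult_op \<Phi> F"
      using f by (simp add: mult si scaleC_L2.abs_eq L2_rel_self)
    finally show "mult_op \<Phi> (c *\<^sub>C F) = c *\<^sub>C mult_op \<Phi> F" .
    have "(norm (mult_op \<Phi> F))\<^sup>2 = (LINT z|circle. (norm (P z (f z)))\<^sup>2)"
      using f by (simp add: mult norm_abs_L2 si)
    also have "\<dots> \<le> (LINT z|circle. (max M 0)\<^sup>2 * (norm (f z))\<^sup>2)"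
    proof (rule integral_mono_AE)
      show "AE z in circle. (norm (P z (f z)))\<^sup>2 \<le> (max M 0)\<^sup>2 * (norm (f z))\<^sup>2"
        using le[of f] by eventually_elim (simp add: power_mono flip: power_mult_distrib)
    qed (use f si in \<open>auto intro: square_integrable_norm\<close>)
    also have "\<dots> = (norm F * max M 0)\<^sup>2"
      using f by (simp add: norm_abs_L2 power_mult_distrib)
    finally show "norm (mult_op \<Phi> F) \<le> norm F * max M 0"
      by (rule power2_le_imp_le) simp
  qed
qed

lemma mult_op_zmul: "mult_op \<Phi> (zmul k F) = zmul k (mult_op \<Phi> F)"
proof -
  obtain P where \<Phi>: "\<Phi> = abs_Linf P" and P: "bounded_symbol P" by (rule Linf_cases)
  show ?thesis
  proof (cases F rule: L2_cases)
    case (abs f)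
    note si = square_integrable_symbol_apply[OF P]
    have mult: "mult_op \<Phi> (abs_L2 f) = abs_L2 (\<lambda>z. P z (f z))" if "square_integrable f" for f
      using P that by (simp add: \<Phi> mult_op_abs)
    show ?thesis
      unfolding abs(1) zmul_abs[OF abs(2)] mult[OF abs(2)] mult[OF square_integrable_zpow[OF abs(2)]]
        zmul_abs[OF si[OF abs(2)]]
    proof (rule abs_L2_cong)
      fix z :: complex assume "z \<in> sphere 0 1"
      then show "P z (z powi k *\<^sub>C f z) = z powi k *\<^sub>C P z (f z)"
        using P by (intro bounded_clinear_scaleC) (simp add: bounded_symbol_def)
    qed (intro si square_integrable_zpow abs)+
  qed
qed

lemma flip_zmul: "flip (zmul k F) = zmul (- k) (flip F)"
proof (cases F rule: L2_cases)
  case (abs f)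
  show ?thesis
    unfolding abs(1) zmul_abs[OF abs(2)]
    using abs(2)
    by (simp add: flip.abs_eq L2_rel_self square_integrable_zpow zmul_abs square_integrable_cnj)
      (rule abs_L2_cong, auto simp: cnj_zpow intro: square_integrable_zpow square_integrable_cnj
        square_integrable_cnj[OF square_integrable_zpow])
qed

lemma flip_zmono: "flip (zmono k x) = zmono (- k) x"
proof -
  have "flip (zmono 0 x) = zmono 0 x"
    by (simp add: zmono_def flip.abs_eq L2_rel_self square_integrable_const)
  then show ?thesis
    using flip_zmul[of k "zmono 0 x"] by (simp add: zmul_mono)
qed

lemma bounded_clinear_flip: "bounded_clinear flip"
proof (rule bounded_clinearI)
  fix F G :: "'a L2" and c
  show "flip (F + G) = flip F + flip G"
    by transfer (auto simp: L2_rel_self intro: square_integrable_cnj square_integrable_add)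
  show "flip (c *\<^sub>C F) = c *\<^sub>C flip F"
    by transfer (auto simp: L2_rel_self intro: square_integrable_cnj square_integrable_scaleC)
  show "norm (flip F) \<le> norm F * 1"
  proof (cases F rule: L2_cases)
    case (abs f)
    have "(norm F)\<^sup>2 = (LINT z|circle. (norm (f z))\<^sup>2)"
      using abs by (simp add: norm_abs_L2)
    also have "\<dots> = (LINT z|distr circle circle cnj. (norm (f z))\<^sup>2)" by (simp add: distr_circle_cnj)
    also have "\<dots> = (LINT z|circle. (norm (f (cnj z)))\<^sup>2)"
      using square_integrable_norm[OF abs(2)] by (intro integral_distr) auto
    also have "\<dots> = (norm (flip F))\<^sup>2"
      using abs by (simp add: flip.abs_eq L2_rel_self norm_abs_L2 square_integrable_cnj)
    finally have "(norm (flip F))\<^sup>2 \<le> (norm F)\<^sup>2" by simp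
    then show ?thesis by simp
  qed
qed

lemma bounded_clinear_toeplitz_op: "bounded_clinear (toeplitz_op \<Phi>)"
  unfolding toeplitz_op_def[abs_def]
  by (rule bounded_clinear_compose[OF bounded_clinear_hardy_proj
        bounded_clinear_compose[OF bounded_clinear_mult_op bounded_clinear_Rep_hardy]])

lemma bounded_clinear_hankel_op: "bounded_clinear (hankel_op \<Phi>)"
  unfolding hankel_op_def[abs_def]
  by (rule bounded_clinear_compose[OF bounded_clinear_hardy_proj
        bounded_clinear_compose[OF bounded_clinear_mult_op
          bounded_clinear_compose[OF bounded_clinear_flip bounded_clinear_Rep_hardy]]])

lemma backshift_toeplitz_op_shift: "backshift (toeplitz_op \<Phi> (shift f)) = toeplitz_op \<Phi> f"
  by (rule hardy_eqI)
    (simp add: hcoef_backshift toeplitz_op_def hcoef_hardy_proj Rep_hardy_shift mult_op_zmul fourier_zmul)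

lemma backshift_hankel_op: "backshift (hankel_op \<Phi> f) = hankel_op \<Phi> (shift f)"
  by (rule hardy_eqI)
    (simp add: hcoef_backshift hankel_op_def hcoef_hardy_proj Rep_hardy_shift flip_zmul mult_op_zmul
      fourier_zmul add.commute)

lemma mult_op_zmono: "fourier (mult_op \<Phi> (zmono l x)) k = fourier (mult_op \<Phi> (zmono 0 x)) (k - l)"
  using mult_op_zmul[of \<Phi> l "zmono 0 x"] by (simp add: zmul_mono fourier_zmul)

lemma bounded_clinear_hmono: "bounded_clinear (hmono n)"
  by (rule bounded_clinearI[where K = 1])
    (auto intro!: hardy_eqI simp: hcoef_hmono hcoef_add hcoef_scaleC norm_hardy.rep_eq Rep_hmono)

lemma bounded_clinear_hcoef: "bounded_clinear (\<lambda>f. hcoef f n)"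
  unfolding hcoef_def[abs_def]
  by (rule bounded_clinear_compose[OF bounded_clinear_fourier bounded_clinear_Rep_hardy])

lemma norm_sum_hmono:
  assumes "finite A" "inj_on h A"
  shows "(norm (\<Sum>j\<in>A. hmono (h j) (a j)))\<^sup>2 = (\<Sum>j\<in>A. (norm (a j))\<^sup>2)"
proof -
  define s where "s = (\<Sum>j\<in>A. hmono (h j) (a j))"
  have coef: "hcoef s (h j) = a j" if "j \<in> A" for j
  proof -
    have "hcoef s (h j) = (\<Sum>i\<in>A. if i = j then a i else 0)"
      using that inj_onD[OF assms(2)]
      by (auto simp: s_def bounded_clinear_sum[OF bounded_clinear_hcoef] hcoef_hmono intro!: sum.cong)
    then show ?thesis using assms(1) that by simp
  qed
  have "cinner s s = (\<Sum>j\<in>A. cinner s (hmono (h j) (a j)))"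
    by (subst (2) s_def) (simp add: cinner_sum_right)
  also have "\<dots> = (\<Sum>j\<in>A. cinner (a j) (a j))"
    by (intro sum.cong) (simp_all add: cinner_hardy.rep_eq Rep_hmono cinner_mono hcoef_def[symmetric] coef)
  also have "\<dots> = complex_of_real (\<Sum>j\<in>A. (norm (a j))\<^sup>2)" by (simp add: cinner_self)
  finally show ?thesis by (metis cinner_self of_real_eq_iff s_def)
qed

text \<open>
The column \<open>h j\<close> of the operator \<open>T\<close> carries \<open>\<Gamma> (k - j)\<close> in row \<open>k + N\<close>, so the products that lemma \<open>symbol_exists\<close>
asks to be bounded are windows of \<open>T g\<close> for \<open>g = (\<Sum>j. hmono (h j) (coeff p j *\<^sub>C x))\<close>. The columns run forwards
for a Toeplitz operator and backwards for a Hankel operator.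
\<close>
lemma symbol_of_matrix:
  fixes \<Gamma> :: "int \<Rightarrow> 'e \<Rightarrow> 'e::separable_complex_hilbert"
  assumes \<Gamma>: "\<And>k. \<exists>T i j. bounded_clinear T \<and> \<Gamma> k = (\<lambda>x. hcoef (T (hmono j x)) i)"
    and T: "\<And>N d. \<exists>T h. bounded_clinear T \<and> (\<forall>f. norm (T f) \<le> C * norm f) \<and> inj_on h {..d}
      \<and> (\<forall>x. \<forall>k\<in>{-int N..int N}. \<forall>j\<in>{..d}. hcoef (T (hmono (h j) x)) (nat (k + int N)) = \<Gamma> (k - int j) x)"
    and C: "0 \<le> C"
  shows "\<exists>\<Phi>. \<forall>x k. fourier (mult_op \<Phi> (zmono 0 x)) k = \<Gamma> k x"
proof (rule symbol_exists[OF _ _ _ C])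
  have lin: "bounded_clinear (\<Gamma> k)" for k
  proof -
    obtain T i j where T: "bounded_clinear T" "\<Gamma> k = (\<lambda>x. hcoef (T (hmono j x)) i)"
      using \<Gamma> by blast
    show ?thesis
      unfolding T(2)
      by (rule bounded_clinear_compose[OF bounded_clinear_hcoef
            bounded_clinear_compose[OF T(1) bounded_clinear_hmono]])
  qed
  show "\<Gamma> k (x + y) = \<Gamma> k x + \<Gamma> k y" for k x y by (rule bounded_clinear_add[OF lin])
  show "\<Gamma> k (c *\<^sub>C x) = c *\<^sub>C \<Gamma> k x" for k c x by (rule bounded_clinear_scaleC[OF lin])
  fix p :: "complex poly" and x :: 'e and N :: nat
  obtain T h where T: "bounded_clinear T" "\<And>f. norm (T f) \<le> C * norm f" "inj_on h {..degree p}"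
    and coef: "\<And>x k j. k \<in> {-int N..int N} \<Longrightarrow> j \<in> {..degree p} \<Longrightarrow>
      hcoef (T (hmono (h j) x)) (nat (k + int N)) = \<Gamma> (k - int j) x"
    using assms(2)[of "degree p" N] by metis
  define g where "g = (\<Sum>j\<le>degree p. hmono (h j) (coeff p j *\<^sub>C x))"
  have "(\<Sum>k\<in>{-int N..int N}. (norm (\<Sum>j\<le>degree p. coeff p j *\<^sub>C \<Gamma> (k - int j) x))\<^sup>2)
      = (\<Sum>k\<in>{-int N..int N}. (norm (fourier (zmul (- int N) (Rep_hardy (T g))) k))\<^sup>2)"
  proof (intro sum.cong refl)
    fix k assume k: "k \<in> {-int N..int N}"
    have "fourier (zmul (- int N) (Rep_hardy (T g))) k = hcoef (T g) (nat (k + int N))"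
      using k by (simp add: fourier_zmul fourier_Rep_hardy)
    also have "\<dots> = (\<Sum>j\<le>degree p. coeff p j *\<^sub>C \<Gamma> (k - int j) x)"
      using k by (simp add: g_def bounded_clinear_sum[OF T(1)] bounded_clinear_sum[OF bounded_clinear_hcoef]
          bounded_clinear_scaleC[OF T(1)] bounded_clinear_scaleC[OF bounded_clinear_hmono] hcoef_scaleC coef)
    finally show "(norm (\<Sum>j\<le>degree p. coeff p j *\<^sub>C \<Gamma> (k - int j) x))\<^sup>2
        = (norm (fourier (zmul (- int N) (Rep_hardy (T g))) k))\<^sup>2" by simp
  qed
  also have "\<dots> \<le> (norm (zmul (- int N) (Rep_hardy (T g))))\<^sup>2" by (rule Bessel) simp
  also have "\<dots> \<le> (C * norm g)\<^sup>2"
    using T(2)[of g] by (intro power_mono) (simp_all add: norm_hardy.rep_eq)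
  also have "\<dots> = C\<^sup>2 * (\<Sum>j\<le>degree p. (norm (coeff p j *\<^sub>C x))\<^sup>2)"
    using norm_sum_hmono[OF _ T(3), of "\<lambda>j. coeff p j *\<^sub>C x"] by (simp add: g_def power_mult_distrib)
  also have "\<dots> = (C * norm x)\<^sup>2 * (\<Sum>j\<le>degree p. (cmod (coeff p j))\<^sup>2)"
    by (simp add: norm_scaleC power_mult_distrib sum_distrib_left sum_distrib_right mult_ac)
  finally show "(\<Sum>k\<in>{-int N..int N}. (norm (\<Sum>j\<le>degree p. coeff p j *\<^sub>C \<Gamma> (k - int j) x))\<^sup>2)
      \<le> (C * norm x)\<^sup>2 * (\<Sum>j\<le>degree p. (cmod (coeff p j))\<^sup>2)" .
qed

text \<open>
The hypothesis makes the matrix of \<open>T\<close> constant along diagonals; moving far down the diagonal gives room for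
the window \<open>{-N..N}\<close>.
\<close>
lemma Brown_Halmos:
  fixes T :: "'e::separable_complex_hilbert hardy \<Rightarrow> 'e hardy"
  assumes T: "bounded_clinear T" and eq: "\<And>f. backshift (T (shift f)) = T f"
  shows "is_toeplitz T"
proof -
  obtain C where C: "0 < C" "\<And>f. norm (T f) \<le> norm f * C"
    using bounded_linear.pos_bounded[OF bounded_clinear_imp_bounded_linear[OF T]] by blast
  define \<Gamma> where "\<Gamma> k x = hcoef (T (hmono (nat (- k)) x)) (nat k)" for k x
  have diag: "hcoef (T (hmono (j + m) x)) (i + m) = hcoef (T (hmono j x)) i" for i j m x
  proof (induction m)
    case (Suc m)
    have "hcoef (T (hmono (j + Suc m) x)) (i + Suc m) = hcoef (backshift (T (shift (hmono (j + m) x)))) (i + m)"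
      by (simp add: hcoef_backshift shift_hmono)
    then show ?case using Suc by (simp add: eq)
  qed simp
  have entry: "hcoef (T (hmono j x)) i = \<Gamma> (int i - int j) x" for i j x
  proof (cases "j \<le> i")
    case True
    then show ?thesis using diag[of 0 j x "i - j"] by (simp add: \<Gamma>_def nat_diff_distrib')
  next
    case False
    then show ?thesis using diag[of "j - i" i x 0] by (simp add: \<Gamma>_def nat_diff_distrib')
  qed
  have "\<exists>\<Phi>. \<forall>x k. fourier (mult_op \<Phi> (zmono 0 x)) k = \<Gamma> k x"
  proof (rule symbol_of_matrix[where C = C])
    show "\<exists>T i j. bounded_clinear T \<and> \<Gamma> k = (\<lambda>x. hcoef (T (hmono j x)) i)" for k
      using T \<Gamma>_def by blast
    show "\<exists>T h. bounded_clinear T \<and> (\<forall>f. norm (T f) \<le> C * norm f) \<and> inj_on h {..d}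
      \<and> (\<forall>x. \<forall>k\<in>{-int N..int N}. \<forall>j\<in>{..d}. hcoef (T (hmono (h j) x)) (nat (k + int N)) = \<Gamma> (k - int j) x)"
      for N d :: nat
      using T C(2) by (intro exI[of _ T] exI[of _ "\<lambda>j. j + N"])
        (auto simp: entry inj_on_def mult.commute algebra_simps)
  qed (use C in simp)
  then obtain \<Phi> where \<Phi>: "\<And>x k. fourier (mult_op \<Phi> (zmono 0 x)) k = \<Gamma> k x" by blast
  have "T = toeplitz_op \<Phi>"
  proof (rule bounded_clinear_eqI_hmono[OF T bounded_clinear_toeplitz_op])
    show "T (hmono n x) = toeplitz_op \<Phi> (hmono n x)" for n x
      by (rule hardy_eqI)
        (simp add: entry toeplitz_op_def hcoef_hardy_proj Rep_hmono mult_op_zmono[of \<Phi> "int n"] \<Phi>)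
  qed
  then show ?thesis by (auto simp: is_toeplitz_def)
qed

text \<open>
The chain of extensions \<open>G n\<close> supplies Fourier coefficients of negative index: the corner entry of \<open>G n\<close>
has index \<open>-n\<close>. Their uniform bound \<open>C\<close> becomes the bound of the symbol.
\<close>
lemma Nehari_Page:
  fixes H :: "'e::separable_complex_hilbert hardy \<Rightarrow> 'e hardy"
  assumes H: "bounded_clinear H" and eq: "\<And>f. backshift (H f) = H (shift f)"
  shows "is_hankel H"
proof -
  obtain G K where G0: "G 0 = H" and G: "\<And>n. bounded_clinear (G n)"
    and G_shift: "\<And>n f. G (Suc n) (shift f) = G n f"
    and shift_G: "\<And>n f. backshift (G (Suc n) f) = G n f" and K: "\<And>n f. norm (G n f) \<le> K * norm f"
    using shift.extend_hankel[OF H eq] by blast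
  define C where "C = max K 0"
  have C: "norm (G n f) \<le> C * norm f" for n f
    using K[of n f] by (smt (verit) C_def max.cobounded1 mult_right_mono norm_ge_zero)
  define \<Gamma> where "\<Gamma> k x = hcoef (G (nat (- k)) (hmono 0 x)) (nat k)" for k x
  have hankel: "backshift (G n f) = G n (shift f)" for n f
    using eq G0 G_shift shift_G by (cases n) simp_all
  have row: "hcoef (G n (hmono j x)) i = hcoef (G n (hmono 0 x)) (i + j)" for n i j x
  proof (induction j arbitrary: i)
    case (Suc j)
    have "hcoef (G n (hmono (Suc j) x)) i = hcoef (backshift (G n (hmono j x))) i"
      by (simp add: hankel shift_hmono)
    then show ?case using Suc[of "Suc i"] by (simp add: hcoef_backshift)
  qed simp
  have level: "hcoef (G (n + m) f) (i + m) = hcoef (G n f) i" for n m i f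
  proof (induction m)
    case (Suc m)
    have "hcoef (G (n + Suc m) f) (i + Suc m) = hcoef (backshift (G (Suc (n + m)) f)) (i + m)"
      by (simp add: hcoef_backshift)
    then show ?case using Suc by (simp add: shift_G)
  qed simp
  have entry: "hcoef (G n (hmono j x)) i = \<Gamma> (int i + int j - int n) x" for n i j x
  proof (cases "n \<le> i + j")
    case True
    then show ?thesis using level[of 0 n "hmono 0 x" "i + j - n"]
      by (simp add: row[of n j] \<Gamma>_def nat_diff_distrib' flip: of_nat_add)
  next
    case False
    then show ?thesis using level[of "n - (i + j)" "i + j" "hmono 0 x" 0]
      by (simp add: row[of n j] \<Gamma>_def nat_diff_distrib' flip: of_nat_add)
  qed
  have "\<exists>\<Phi>. \<forall>x k. fourier (mult_op \<Phi> (zmono 0 x)) k = \<Gamma> k x"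
  proof (rule symbol_of_matrix[where C = C])
    show "\<exists>T i j. bounded_clinear T \<and> \<Gamma> k = (\<lambda>x. hcoef (T (hmono j x)) i)" for k
      using G \<Gamma>_def by blast
    show "\<exists>T h. bounded_clinear T \<and> (\<forall>f. norm (T f) \<le> C * norm f) \<and> inj_on h {..d}
      \<and> (\<forall>x. \<forall>k\<in>{-int N..int N}. \<forall>j\<in>{..d}. hcoef (T (hmono (h j) x)) (nat (k + int N)) = \<Gamma> (k - int j) x)"
      for N d :: nat
      \<comment> \<open>row \<open>k + N\<close> and column \<open>d - j\<close> of \<open>G n\<close> have index \<open>k + N + d - j - n\<close>, which is \<open>k - j\<close>\<close>
      using G C by (intro exI[of _ "G (d + N)"] exI[of _ "\<lambda>j. d - j"])
        (auto simp: entry inj_on_def of_nat_diff algebra_simps)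
  qed (simp add: C_def)
  then obtain \<Phi> where \<Phi>: "\<And>x k. fourier (mult_op \<Phi> (zmono 0 x)) k = \<Gamma> k x" by blast
  have "H = hankel_op \<Phi>"
  proof (rule bounded_clinear_eqI_hmono[OF H bounded_clinear_hankel_op])
    show "H (hmono n x) = hankel_op \<Phi> (hmono n x)" for n x
      using entry[of 0 n x]
      by (intro hardy_eqI)
        (simp add: G0 hankel_op_def hcoef_hardy_proj Rep_hmono flip_zmono mult_op_zmono[of \<Phi> "- int n"] \<Phi>)
  qed
  then show ?thesis by (auto simp: is_hankel_def)
qed

section \<open>Intertwining relations and the equivalence\<close>

lemma is_toeplitz_iff:
  assumes "bounded_clinear T"
  shows "is_toeplitz T \<longleftrightarrow> (\<forall>f. backshift (T (shift f)) = T f)"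
  using Brown_Halmos[OF assms] by (auto simp: is_toeplitz_def backshift_toeplitz_op_shift)

lemma is_hankel_iff:
  assumes "bounded_clinear H"
  shows "is_hankel H \<longleftrightarrow> (\<forall>f. backshift (H f) = H (shift f))"
  using Nehari_Page[OF assms] by (auto simp: is_hankel_def backshift_hankel_op)

theorem theorem1p1:
  fixes A :: "'e::separable_complex_hilbert hardy \<Rightarrow> 'e hardy"
  assumes "bounded_clinear A"
  shows
    "((\<exists>\<Phi> \<Psi>. A = (\<lambda>f. toeplitz_op \<Phi> f + hankel_op \<Psi> f))
        \<longleftrightarrow> is_toeplitz (\<lambda>f. A (shift f) - cadjoint shift (A f)))
     \<and> (is_toeplitz (\<lambda>f. A (shift f) - cadjoint shift (A f))
        \<longleftrightarrow> is_hankel (\<lambda>f. cadjoint shift (A (shift f)) - A f))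
     \<and> (is_hankel (\<lambda>f. cadjoint shift (A (shift f)) - A f)
        \<longleftrightarrow> (\<lambda>f. A (shift f) + (cadjoint shift ^^ 2) (A (shift f)))
            = (\<lambda>f. cadjoint shift (A f) + cadjoint shift (A ((shift ^^ 2) f))))"
proof -
  define E where "E \<longleftrightarrow> (\<forall>f. A (shift f) + backshift (backshift (A (shift f)))
    = backshift (A f) + backshift (A (shift (shift f))))"
  note b = bounded_clinear_add[OF bounded_clinear_backshift] bounded_clinear_diff[OF bounded_clinear_backshift]
  have E: "((\<lambda>f. A (shift f) + (cadjoint shift ^^ 2) (A (shift f)))
            = (\<lambda>f. cadjoint shift (A f) + cadjoint shift (A ((shift ^^ 2) f)))) \<longleftrightarrow> E"
    by (simp add: E_def fun_eq_iff cadjoint_shift numeral_2_eq_2)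
  have AS: "bounded_clinear (\<lambda>f. A (shift f))"
    by (rule bounded_clinear_compose[OF assms bounded_clinear_shift])
  have T: "is_toeplitz (\<lambda>f. A (shift f) - cadjoint shift (A f)) \<longleftrightarrow> E"
  proof -
    have "bounded_clinear (\<lambda>f. A (shift f) - backshift (A f))"
      by (rule bounded_clinear_sub[OF AS bounded_clinear_compose[OF bounded_clinear_backshift assms]])
    from is_toeplitz_iff[OF this] show ?thesis
      unfolding cadjoint_shift E_def by (simp add: b algebra_simps eq_commute)
  qed
  have H: "is_hankel (\<lambda>f. cadjoint shift (A (shift f)) - A f) \<longleftrightarrow> E"
  proof -
    have "bounded_clinear (\<lambda>f. backshift (A (shift f)) - A f)"
      by (rule bounded_clinear_sub[OF bounded_clinear_compose[OF bounded_clinear_backshift AS] assms])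
    from is_hankel_iff[OF this] show ?thesis
      unfolding cadjoint_shift E_def by (simp add: b algebra_simps eq_commute)
  qed
  have S: "(\<exists>\<Phi> \<Psi>. A = (\<lambda>f. toeplitz_op \<Phi> f + hankel_op \<Psi> f)) \<longleftrightarrow> E"
  proof
    assume "\<exists>\<Phi> \<Psi>. A = (\<lambda>f. toeplitz_op \<Phi> f + hankel_op \<Psi> f)"
    then obtain \<Phi> \<Psi> where A: "A = (\<lambda>f. toeplitz_op \<Phi> f + hankel_op \<Psi> f)" by blast
    show E unfolding E_def
      by (simp add: A b backshift_toeplitz_op_shift backshift_hankel_op add_ac)
  next
    assume E
    then have "\<And>f. A (shift f) + backshift (backshift (A (shift f)))
      = backshift (A f) + backshift (A (shift (shift f)))" by (simp add: E_def)
    from shift.toeplitz_hankel_decomposition[OF assms this]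
    obtain T H where "is_toeplitz T" "is_hankel H" "\<And>f. A f = T f + H f"
      using Brown_Halmos Nehari_Page by metis
    then show "\<exists>\<Phi> \<Psi>. A = (\<lambda>f. toeplitz_op \<Phi> f + hankel_op \<Psi> f)"
      unfolding is_toeplitz_def is_hankel_def by auto
  qed
  show ?thesis using E T H S by blast
qed

end
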